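(* Let $\epsilon_0>0$ and $C_0>0$. There exists a constant $\delta_0=\delta_0(\epsilon_0,C_0)>0$ such that the following holds: if $d=(d_1,d_2,d_3):\mathbb R^2\to\mathbb S^2$ satisfies $\nabla d\in H^1(\mathbb R^2)$, $\|\nabla d\|_{L^2}\le C_0$ and $d_3\ge\epsilon_0$ on $\mathbb R^2$, then $$\|\nabla d\|_{L^4}^4\le(1-\delta_0)\|\Delta d\|_{L^2}^2.$$ Consequently, for such maps, $$\|\Delta d+|\nabla d|^2 d\|_{L^2}^2\ge\frac{\delta_0}{2}\Big(\|\Delta d\|_{L^2}^2+\|\nabla d\|_{L^4}^4\Big).$$
   Context: $\mathbb S^2$ is the unit sphere in $\mathbb R^3$; $|\nabla d|^2=\sum_{j=1}^2|\partial_j d|^2$. *)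

theory Defs
  imports "HOL-Analysis.Analysis"
begin

fun iter_partial :: "2 list \<Rightarrow> (real^2 \<Rightarrow> real) \<Rightarrow> (real^2 \<Rightarrow> real)" where
  "iter_partial [] f = f"
| "iter_partial (j # js) f =
     (\<lambda>x. frechet_derivative (iter_partial js f) (at x) (axis j 1))"

definition smooth2 :: "(real^2 \<Rightarrow> real) \<Rightarrow> bool" where
  "smooth2 \<phi> \<longleftrightarrow> (\<forall>js x. iter_partial js \<phi> differentiable (at x))"

definition test_fun :: "(real^2 \<Rightarrow> real) \<Rightarrow> bool" where
  "test_fun \<phi> \<longleftrightarrow> smooth2 \<phi> \<and> bounded {x. \<phi> x \<noteq> 0}"

definition loc_integrable :: "(real^2 \<Rightarrow> real^3) \<Rightarrow> bool" where
  "loc_integrable f \<longleftrightarrow> (\<forall>K. compact K \<longrightarrow> set_integrable lebesgue K f)"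

definition weak_partial :: "2 \<Rightarrow> (real^2 \<Rightarrow> real^3) \<Rightarrow> (real^2 \<Rightarrow> real^3) \<Rightarrow> bool" where
  "weak_partial j f g \<longleftrightarrow> loc_integrable f \<and> loc_integrable g \<and>
     (\<forall>\<phi>. test_fun \<phi> \<longrightarrow>
        (\<integral>x. iter_partial [j] \<phi> x *\<^sub>R f x \<partial>lebesgue) = - (\<integral>x. \<phi> x *\<^sub>R g x \<partial>lebesgue))"

definition L2 :: "(real^2 \<Rightarrow> real^3) \<Rightarrow> bool" where
  "L2 f \<longleftrightarrow> f \<in> borel_measurable lebesgue \<and> integrable lebesgue (\<lambda>x. (norm (f x))\<^sup>2)"

definition grad_sq :: "(2 \<Rightarrow> real^2 \<Rightarrow> real^3) \<Rightarrow> real^2 \<Rightarrow> real" where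
  "grad_sq G x = (\<Sum>j\<in>UNIV. (norm (G j x))\<^sup>2)"

text \<open>Laplacian from the weak second derivatives H j k = \<partial>_k \<partial>_j d.\<close>
definition lap :: "(2 \<Rightarrow> 2 \<Rightarrow> real^2 \<Rightarrow> real^3) \<Rightarrow> real^2 \<Rightarrow> real^3" where
  "lap H x = (\<Sum>j\<in>UNIV. H j j x)"

end

theory Submission
  imports Defs
begin

text \<open>The gain of half of \<open>N\<^sup>2\<close> is decisive. The integral of the full
  squared Hessian equals that of \<open>N\<^sup>2 + |\<tau>|\<^sup>2\<close>, so without the gain
  the two \<open>N\<^sup>2\<close> terms would cancel and the tested equation would bound nothing.
  The gain can be kept because the quadratic expression produced by the test is completed by the
  square of \<open>P \<partial>\<^sub>j\<partial>\<^sub>kd - c\<^sub>k \<partial>\<^sub>jd\<close>,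
  where c is the gradient of the logarithm of \<open>d\<^sub>3\<close>: since
  \<open>\<partial>\<^sub>jd\<close> is tangent to the sphere, only the tangential Hessian meets it.

  The obstacle is regularity. Mollifying d destroys the constraint |d| = 1, and neither the flux nor
  d has compact support. Hence the product rules are proved directly for Sobolev functions,
  vanishing at infinity is encoded by integrability of a flux and of its derivative, and the
  equality of the two \<open>L\<^sup>2\<close> norms comes from difference quotients together with
  continuity of translations. Square integrability of N, on which all the integrability claims rest,
  is read off from the pointwise identity for \<open>|\<Delta>d|\<^sup>2\<close>.\<close>

text \<open>
  Write \<open>N = |\<nabla>d|\<^sup>2\<close> and \<open>\<tau> = \<Delta>d + N d\<close>. Since \<open>|d| = 1\<close>, differentiating twice gives
  \<open>d \<bullet> \<partial>\<^sub>j\<partial>\<^sub>kd = - \<partial>\<^sub>jd \<bullet> \<partial>\<^sub>kd\<close>, hence \<open>|\<Delta>d|\<^sup>2 = N\<^sup>2 + |\<tau>|\<^sup>2\<close> pointwise, and it suffices to bound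
  \<open>\<integral>N\<^sup>2\<close> by a multiple of \<open>\<integral>|\<tau>|\<^sup>2\<close>. This is a stability argument: the positive function \<open>d\<^sub>3\<close> solves
  \<open>\<Delta>d\<^sub>3 + N d\<^sub>3 = \<tau>\<^sub>3\<close>, and testing with \<open>N / d\<^sub>3\<close> yields
  \<open>\<integral>N\<^sup>2 \<le> \<integral>|\<tau>| N / \<epsilon>0 + \<integral>\<Sum>\<^sub>j\<^sub>k |P \<partial>\<^sub>j\<partial>\<^sub>kd|\<^sup>2\<close>, where \<open>P\<close> projects onto the tangent plane at \<open>d\<close>.
  The projection gains \<open>\<Sum>\<^sub>j\<^sub>k (\<partial>\<^sub>jd \<bullet> \<partial>\<^sub>kd)\<^sup>2 \<ge> N\<^sup>2 / 2\<close> over the full Hessian, whose \<open>L\<^sup>2\<close> norm is that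
  of \<open>\<Delta>d\<close>. Thus \<open>\<integral>N\<^sup>2 / 2 \<le> \<integral>|\<tau>| N / \<epsilon>0 + \<integral>|\<tau>|\<^sup>2\<close>, and Young's inequality finishes the proof.

  Weak derivatives are handled through absolute continuity on almost every line parallel to an
  axis, which makes products and reciprocals of Sobolev functions elementary.
\<close>

section \<open>Indefinite integrals on the line\<close>

text \<open>Borel rather than Lebesgue measurability is demanded because it is inherited by the
  restriction to every line.\<close>

definition locally_integrable :: "('a::euclidean_space \<Rightarrow> real) \<Rightarrow> bool" where
  "locally_integrable f \<longleftrightarrow> f \<in> borel_measurable borel \<and> (\<forall>a b. set_integrable lborel (cbox a b) f)"

lemma locally_integrable_measurable [measurable_dest]: "locally_integrable f \<Longrightarrow> f \<in> borel_measurable borel"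
  by (simp add: locally_integrable_def)

lemma locally_integrable_cbox: "locally_integrable f \<Longrightarrow> set_integrable lborel (cbox a b) f"
  by (simp add: locally_integrable_def)

lemma locally_integrable_Icc: "locally_integrable f \<Longrightarrow> set_integrable lborel {a..b::real} f"
  using locally_integrable_cbox[of f a b] by (simp add: cbox_interval)

lemma locally_integrable_add: "locally_integrable f \<Longrightarrow> locally_integrable g \<Longrightarrow> locally_integrable (\<lambda>x. f x + g x)"
  by (auto simp: locally_integrable_def)

lemma locally_integrable_diff: "locally_integrable f \<Longrightarrow> locally_integrable g \<Longrightarrow> locally_integrable (\<lambda>x. f x - g x)"
  by (auto simp: locally_integrable_def)

lemma locally_integrable_abs: "locally_integrable f \<Longrightarrow> locally_integrable (\<lambda>x. \<bar>f x\<bar>)"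
  by (auto simp: locally_integrable_def set_integrable_abs)

lemma set_integrable_mult_bounded:
  fixes f h :: "'a \<Rightarrow> real"
  assumes "set_integrable M A f" "h \<in> borel_measurable M" "A \<in> sets M"
    and "\<And>x. x \<in> A \<Longrightarrow> \<bar>h x\<bar> \<le> B"
  shows "set_integrable M A (\<lambda>x. f x * h x)"
proof -
  have "integrable M (\<lambda>x. B * (indicator A x *\<^sub>R f x))"
    using assms(1) unfolding set_integrable_def by (intro integrable_mult_right)
  then show ?thesis unfolding set_integrable_def
  proof (rule Bochner_Integration.integrable_bound)
    have "(\<lambda>x. indicator A x *\<^sub>R f x) \<in> borel_measurable M"
      using assms(1) by (auto simp: set_integrable_def)
    then have "(\<lambda>x. (indicator A x *\<^sub>R f x) * h x) \<in> borel_measurable M"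
      using assms(2) by (rule borel_measurable_times)
    then show "(\<lambda>x. indicator A x *\<^sub>R (f x * h x)) \<in> borel_measurable M"
      by (simp add: mult.assoc)
    have "\<bar>f x\<bar> * \<bar>h x\<bar> \<le> \<bar>B\<bar> * \<bar>f x\<bar>" if "x \<in> A" for x
      using mult_left_mono[of "\<bar>h x\<bar>" "\<bar>B\<bar>" "\<bar>f x\<bar>"] assms(4)[OF that] by (simp add: mult.commute)
    then show "AE x in M. norm (indicator A x *\<^sub>R (f x * h x)) \<le> norm (B * (indicator A x *\<^sub>R f x))"
      by (auto simp: abs_mult split: split_indicator)
  qed
qed

lemma locally_integrable_mult_bounded:
  assumes f: "locally_integrable f" and h: "h \<in> borel_measurable borel"
    and B: "\<And>a b. \<exists>B. \<forall>x\<in>cbox a b. \<bar>h x\<bar> \<le> B"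
  shows "locally_integrable (\<lambda>x. f x * h x)"
  unfolding locally_integrable_def
proof (intro conjI allI)
  show "(\<lambda>x. f x * h x) \<in> borel_measurable borel"
    using f h by (auto simp: locally_integrable_def)
  fix a b
  obtain B where "\<forall>x\<in>cbox a b. \<bar>h x\<bar> \<le> B" using B by blast
  then show "set_integrable lborel (cbox a b) (\<lambda>x. f x * h x)"
    using f h by (intro set_integrable_mult_bounded[where B=B]) (auto simp: locally_integrable_def)
qed

lemma locally_integrable_mult_continuous:
  assumes "locally_integrable f" "continuous_on UNIV h"
  shows "locally_integrable (\<lambda>x. f x * h x)"
proof (rule locally_integrable_mult_bounded[OF assms(1)])
  show "h \<in> borel_measurable borel" using assms(2) by (rule borel_measurable_continuous_onI)
  fix a b
  have "bounded (h ` cbox a b)"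
    by (intro compact_imp_bounded compact_continuous_image continuous_on_subset[OF assms(2)]) auto
  then show "\<exists>B. \<forall>x\<in>cbox a b. \<bar>h x\<bar> \<le> B" unfolding bounded_iff by auto
qed

lemma locally_integrable_continuous: "continuous_on UNIV f \<Longrightarrow> locally_integrable f"
  unfolding locally_integrable_def set_integrable_def
  by (intro conjI allI borel_measurable_continuous_onI borel_integrable_compact)
    (auto intro: continuous_on_subset)

lemma locally_integrable_const: "locally_integrable (\<lambda>_. c)"
  by (rule locally_integrable_continuous) simp

text \<open>Lebesgue differentiation: off a negligible set, \<open>f x\<close> is the limit of
  averages over shrinking cubes with corner \<open>x\<close>, and these averages are all
  zero.\<close>

lemma AE_zero_if_cbox_integrals_zero:
  assumes f: "locally_integrable f" and 0: "\<And>a b. (LINT x:cbox a b|lborel. f x) = 0"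
  shows "AE x in lborel. f x = 0"
proof -
  have int: "f integrable_on cbox a b" "integral (cbox a b) f = 0" for a b
    using set_borel_integral_eq_integral[OF locally_integrable_cbox[OF f, of a b]] 0[of a b] by auto
  obtain N where N: "negligible N" and *: "\<And>x e. \<lbrakk>x \<notin> N; 0 < e\<rbrakk> \<Longrightarrow>
     \<exists>d>0. \<forall>h. 0 < h \<and> h < d \<longrightarrow>
        norm(integral (cbox x (x + h *\<^sub>R One)) f /\<^sub>R h ^ DIM('a) - f x) < e"
    using integrable_ccontinuous_explicit[of f, OF int(1)] by blast
  have "f x = 0" if "x \<notin> N" for x
  proof (rule ccontr)
    assume "f x \<noteq> 0"
    then obtain d where "d > 0" "\<forall>h. 0 < h \<and> h < d \<longrightarrow>
        norm(integral (cbox x (x + h *\<^sub>R One)) f /\<^sub>R h ^ DIM('a) - f x) < \<bar>f x\<bar>"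
      using *[of x "\<bar>f x\<bar>"] \<open>x \<notin> N\<close> by auto
    then show False using int(2) by (auto dest: spec[of _ "d/2"])
  qed
  then have "{x. f x \<noteq> 0} \<subseteq> N" by auto
  then have "negligible {x. f x \<noteq> 0}" using N negligible_subset by blast
  then have "AE x in lebesgue. f x = 0"
    by (auto simp: negligible_iff_null_sets dest!: AE_not_in)
  then show ?thesis using f
    by (subst (asm) AE_completion_iff) auto
qed

text \<open>Local absolute continuity of \<open>F\<close> with a.e. derivative \<open>g\<close>,
  expressed by increments so that \<open>F\<close> itself never has to be differentiated.\<close>

definition indefinite_integral :: "(real \<Rightarrow> real) \<Rightarrow> (real \<Rightarrow> real) \<Rightarrow> bool" where
  "indefinite_integral F g \<longleftrightarrow> locally_integrable g \<and> (\<forall>s t. s \<le> t \<longrightarrow> F t - F s = (LINT r:{s..t}|lborel. g r))"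

lemma indefinite_integral_locally_integrable: "indefinite_integral F g \<Longrightarrow> locally_integrable g"
  and indefinite_integralD: "indefinite_integral F g \<Longrightarrow> s \<le> t \<Longrightarrow> (LINT r:{s..t}|lborel. g r) = F t - F s"
  by (auto simp: indefinite_integral_def)

lemma indefinite_integral_continuous:
  assumes "indefinite_integral F g"
  shows "continuous_on UNIV F"
proof -
  have g: "locally_integrable g" using assms by (rule indefinite_integral_locally_integrable)
  have "isCont F x" for x
  proof -
    have "continuous_on {x-1..x+1} (\<lambda>t. F (x-1) + integral {x-1..t} g)"
      using set_borel_integral_eq_integral(1)[OF locally_integrable_Icc[OF g]]
      by (intro continuous_intros indefinite_integral_continuous_1) auto
    moreover have "F (x-1) + integral {x-1..t} g = F t" if "t \<in> {x-1..x+1}" for t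
      using indefinite_integralD[OF assms, of "x-1" t] set_borel_integral_eq_integral(2)[OF locally_integrable_Icc[OF g], of "x-1" t] that
      by simp
    ultimately have "continuous_on {x-1..x+1} F"
      by (subst (asm) continuous_on_cong[OF refl, where g=F]) auto
    then show ?thesis by (rule continuous_on_interior) simp
  qed
  then show ?thesis by (simp add: continuous_at_imp_continuous_on)
qed

lemma set_integral_Icc_split:
  assumes "locally_integrable q" "a \<le> b" "b \<le> c"
  shows "(LINT r:{a..c}|lborel. q r) = (LINT r:{a..b}|lborel. q r) + (LINT r:{b..c::real}|lborel. q r)"
proof -
  have "(LINT r:{a..b}\<union>{b..c}|lborel. q r) = (LINT r:{a..b}|lborel. q r) + (LINT r:{b..c}|lborel. q r)"
  proof (rule set_integral_Un_AE)
    have "AE x in lborel. x \<noteq> b" by (rule AE_lborel_singleton)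
    then show "AE x in lborel. \<not> (x \<in> {a..b} \<and> x \<in> {b..c})" by eventually_elim auto
  qed (use locally_integrable_Icc[OF assms(1)] in auto)
  moreover have "{a..b}\<union>{b..c} = {a..c}" using assms by auto
  ultimately show ?thesis by simp
qed

text \<open>Calculus rules for indefinite Lebesgue integrals are reduced to local estimates:
  an additive interval function that is locally \<open>o(\<integral>m)\<close> vanishes.\<close>

lemma indefinite_integralI_local:
  assumes q: "locally_integrable q" and m: "locally_integrable m"
    and loc: "\<And>x \<eta>. \<eta> > 0 \<Longrightarrow> \<exists>d>0. \<forall>a b. a \<le> x \<and> x \<le> b \<and> b - a < d \<longrightarrow>
       \<bar>\<Phi> b - \<Phi> a - (LINT r:{a..b}|lborel. q r)\<bar> \<le> \<eta> * (LINT r:{a..b}|lborel. m r)"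
  shows "indefinite_integral \<Phi> q"
  unfolding indefinite_integral_def
proof (intro conjI allI impI q)
  fix s t :: real assume st: "s \<le> t"
  define E where "E a b = \<Phi> b - \<Phi> a - (LINT r:{a..b}|lborel. q r)" for a b
  \<comment> \<open>Bisection principle: the bound is additive over adjacent intervals, so it is
    enough to have it on short intervals around each point.\<close>
  have le: "\<bar>E s t\<bar> \<le> \<eta> * (LINT r:{s..t}|lborel. m r)" if "\<eta> > 0" for \<eta>
    using st
  proof (induction rule: Bolzano)
    case (trans a b c)
    have "E a c = E a b + E b c"
      using set_integral_Icc_split[OF q trans(3,4)] by (simp add: E_def)
    then show ?case
      using trans set_integral_Icc_split[OF m trans(3,4)] by (simp add: distrib_left)
  next
    case (local x)
    then show ?case using loc[OF \<open>\<eta> > 0\<close>] unfolding E_def by blast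
  qed
  define I where "I = (LINT r:{s..t}|lborel. m r)"
  have "\<bar>E s t\<bar> \<le> 0"
  proof (rule field_le_epsilon)
    fix e :: real assume "e > 0"
    \<comment> \<open>\<open>I\<close> may vanish, hence the denominator
      \<open>\<bar>I\<bar> + 1\<close>.\<close>
    have "\<bar>E s t\<bar> \<le> e / (\<bar>I\<bar> + 1) * I"
      using le[of "e / (\<bar>I\<bar> + 1)"] \<open>e > 0\<close> unfolding I_def by simp
    also have "\<dots> = e * (I / (\<bar>I\<bar> + 1))" by simp
    also have "\<dots> \<le> e * 1" using \<open>e > 0\<close> by (intro mult_left_mono) (auto simp: field_simps)
    finally show "\<bar>E s t\<bar> \<le> 0 + e" by simp
  qed
  then show "\<Phi> t - \<Phi> s = (LINT r:{s..t}|lborel. q r)" by (simp add: E_def)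
qed

lemma set_integral_abs_le:
  fixes f m :: "'a \<Rightarrow> real"
  assumes "set_integrable M A f" "set_integrable M A m" "\<And>x. x \<in> A \<Longrightarrow> \<bar>f x\<bar> \<le> c * m x"
  shows "\<bar>LINT x:A|M. f x\<bar> \<le> c * (LINT x:A|M. m x)"
proof -
  have "\<bar>LINT x:A|M. f x\<bar> \<le> (LINT x:A|M. \<bar>f x\<bar>)"
    unfolding set_lebesgue_integral_def
    using integral_abs_bound[of M "\<lambda>x. indicator A x *\<^sub>R f x"] by (simp add: abs_mult)
  also have "\<dots> \<le> (LINT x:A|M. c * m x)"
    using assms by (intro set_integral_mono set_integrable_abs) auto
  finally show ?thesis by simp
qed

text \<open>With the second factors frozen at the endpoints, the increment of the product is exactly
  the integral of \<open>f r * G a + g r * F b\<close>. By continuity, replacing \<open>G a\<close>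
  and \<open>F b\<close> by \<open>G r\<close> and \<open>F r\<close> on a short interval costs at
  most \<eta> times the integral of \<open>\<bar>f\<bar> + \<bar>g\<bar>\<close>.\<close>

lemma indefinite_integral_mult:
  assumes F: "indefinite_integral F f" and G: "indefinite_integral G g"
  shows "indefinite_integral (\<lambda>t. F t * G t) (\<lambda>t. f t * G t + g t * F t)"
proof -
  note [simp] = locally_integrable_Icc
  have f: "locally_integrable f" and g: "locally_integrable g" and cF: "continuous_on UNIV F" and cG: "continuous_on UNIV G"
    using F G indefinite_integral_locally_integrable indefinite_integral_continuous by auto
  have fG: "locally_integrable (\<lambda>t. f t * G t)" and gF: "locally_integrable (\<lambda>t. g t * F t)"
    using f g cF cG by (auto intro: locally_integrable_mult_continuous)
  show ?thesis
  proof (rule indefinite_integralI_local[where m="\<lambda>t. \<bar>f t\<bar> + \<bar>g t\<bar>"])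
    show "locally_integrable (\<lambda>t. f t * G t + g t * F t)" using fG gF by (rule locally_integrable_add)
    show "locally_integrable (\<lambda>t. \<bar>f t\<bar> + \<bar>g t\<bar>)" using f g by (intro locally_integrable_add locally_integrable_abs)
    fix x \<eta> :: real assume "\<eta> > 0"
    then have e: "\<eta>/2 > 0" by simp
    obtain d1 where d1: "d1 > 0" "\<And>y. \<bar>y - x\<bar> < d1 \<Longrightarrow> \<bar>F y - F x\<bar> < \<eta>/2"
      using cF e unfolding continuous_on_iff dist_real_def by blast
    obtain d2 where d2: "d2 > 0" "\<And>y. \<bar>y - x\<bar> < d2 \<Longrightarrow> \<bar>G y - G x\<bar> < \<eta>/2"
      using cG e unfolding continuous_on_iff dist_real_def by blast
    show "\<exists>d>0. \<forall>a b. a \<le> x \<and> x \<le> b \<and> b - a < d \<longrightarrow>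
       \<bar>F b * G b - F a * G a - (LINT r:{a..b}|lborel. f r * G r + g r * F r)\<bar>
        \<le> \<eta> * (LINT r:{a..b}|lborel. \<bar>f r\<bar> + \<bar>g r\<bar>)"
    proof (intro exI[of _ "min d1 d2"] conjI allI impI)
      fix a b assume ab: "a \<le> x \<and> x \<le> b \<and> b - a < min d1 d2"
      have "F b * G b - F a * G a = (F b - F a) * G a + (G b - G a) * F b" by algebra
      also have "\<dots> = (LINT r:{a..b}|lborel. f r * G a) + (LINT r:{a..b}|lborel. g r * F b)"
        using indefinite_integralD[OF F, of a b] indefinite_integralD[OF G, of a b] ab by simp
      finally have "F b * G b - F a * G a =
        (LINT r:{a..b}|lborel. f r * G a) + (LINT r:{a..b}|lborel. g r * F b)" .
      then have eq: "F b * G b - F a * G a - (LINT r:{a..b}|lborel. f r * G r + g r * F r) =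
         (LINT r:{a..b}|lborel. f r * G a + g r * F b - (f r * G r + g r * F r))"
        using f g fG gF by simp
      show "\<bar>F b * G b - F a * G a - (LINT r:{a..b}|lborel. f r * G r + g r * F r)\<bar>
          \<le> \<eta> * (LINT r:{a..b}|lborel. \<bar>f r\<bar> + \<bar>g r\<bar>)"
        unfolding eq
      proof (rule set_integral_abs_le)
        show "set_integrable lborel {a..b} (\<lambda>r. f r * G a + g r * F b - (f r * G r + g r * F r))"
          using f g fG gF
          by (intro set_integral_diff set_integral_add set_integrable_mult_left locally_integrable_Icc)
        show "set_integrable lborel {a..b} (\<lambda>r. \<bar>f r\<bar> + \<bar>g r\<bar>)"
          using f g by (intro set_integral_add set_integrable_abs locally_integrable_Icc)
        fix r assume r: "r \<in> {a..b}"
        have 1: "\<bar>G a - G r\<bar> \<le> \<eta>" "\<bar>F b - F r\<bar> \<le> \<eta>"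
        proof -
          have "\<bar>a - x\<bar> < d2" "\<bar>r - x\<bar> < d2" "\<bar>b - x\<bar> < d1" "\<bar>r - x\<bar> < d1"
            using ab r by auto
          from d2(2)[OF this(1)] d2(2)[OF this(2)] d1(2)[OF this(3)] d1(2)[OF this(4)]
          show "\<bar>G a - G r\<bar> \<le> \<eta>" "\<bar>F b - F r\<bar> \<le> \<eta>" by linarith+
        qed
        have "f r * G a + g r * F b - (f r * G r + g r * F r) = f r * (G a - G r) + g r * (F b - F r)"
          by (simp add: algebra_simps)
        moreover have "\<bar>f r * (G a - G r) + g r * (F b - F r)\<bar> \<le> \<bar>f r\<bar> * \<bar>G a - G r\<bar> + \<bar>g r\<bar> * \<bar>F b - F r\<bar>"
          by (metis abs_mult abs_triangle_ineq)
        moreover have "\<bar>f r\<bar> * \<bar>G a - G r\<bar> + \<bar>g r\<bar> * \<bar>F b - F r\<bar> \<le> \<bar>f r\<bar> * \<eta> + \<bar>g r\<bar> * \<eta>"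
          using 1 by (intro add_mono mult_left_mono) auto
        ultimately show "\<bar>f r * G a + g r * F b - (f r * G r + g r * F r)\<bar> \<le> \<eta> * (\<bar>f r\<bar> + \<bar>g r\<bar>)"
          by (simp add: algebra_simps)
      qed
    qed (use d1 d2 in auto)
  qed
qed

text \<open>The increment of \<open>1 / F\<close> is the increment of \<open>F\<close> times
  \<open>- 1 / (F a * F b)\<close>, and near a point this factor is close to
  \<open>- 1 / (F r)\<^sup>2\<close>.\<close>

lemma indefinite_integral_inverse:
  assumes F: "indefinite_integral F f" and pos: "\<And>t. F t > 0"
  shows "indefinite_integral (\<lambda>t. 1 / F t) (\<lambda>t. - (f t * (1 / (F t)\<^sup>2)))"
proof -
  note [simp] = locally_integrable_Icc
  have f: "locally_integrable f" and cF: "continuous_on UNIV F"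
    using F indefinite_integral_locally_integrable indefinite_integral_continuous by auto
  have nz: "F t \<noteq> 0" for t using pos[of t] by simp
  have cR: "continuous_on UNIV (\<lambda>t. 1 / F t)" "continuous_on UNIV (\<lambda>t. 1 / (F t)\<^sup>2)"
    using nz by (auto intro!: continuous_intros cF)
  have fR: "locally_integrable (\<lambda>t. f t * (1 / (F t)\<^sup>2))"
    using f cR(2) by (rule locally_integrable_mult_continuous)
  have fR': "locally_integrable (\<lambda>t. - (f t * (1 / (F t)\<^sup>2)))"
    using locally_integrable_diff[OF locally_integrable_const[of 0] fR] by simp
  show ?thesis
  proof (rule indefinite_integralI_local[where m="\<lambda>t. \<bar>f t\<bar>"])
    show "locally_integrable (\<lambda>t. - (f t * (1 / (F t)\<^sup>2)))" by (rule fR')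
    show "locally_integrable (\<lambda>t. \<bar>f t\<bar>)" using f by (intro locally_integrable_abs)
    fix x \<eta> :: real assume "\<eta> > 0"
    \<comment> \<open>The error depends on the three points \<open>r\<close>, \<open>a\<close>,
      \<open>b\<close>; joint continuity at the diagonal point, where it vanishes, controls all of
      them at once.\<close>
    have "isCont (\<lambda>p. 1 / (F (fst p))\<^sup>2 - 1 / (F (fst (snd p)) * F (snd (snd p)))) (x, x, x)"
    proof -
      have F: "isCont F x" for x using cF by (simp add: continuous_on_eq_continuous_at)
      have "isCont (\<lambda>p. F (fst p)) (x, x, x)" "isCont (\<lambda>p. F (fst (snd p))) (x, x, x)"
        "isCont (\<lambda>p. F (snd (snd p))) (x, x, x)"
        by (rule isCont_o2[OF _ F], simp)+
      then show ?thesis using nz by (intro continuous_intros) auto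
    qed
    then have "\<forall>e>0. \<exists>d>0. \<forall>p. dist p (x, x, x) < d \<longrightarrow>
        dist (1 / (F (fst p))\<^sup>2 - 1 / (F (fst (snd p)) * F (snd (snd p)))) (1 / (F x)\<^sup>2 - 1 / (F x * F x)) < e"
      unfolding continuous_at_eps_delta by simp
    then obtain d where d: "d > 0" "\<And>p. dist p (x, x, x) < d \<Longrightarrow>
        dist (1 / (F (fst p))\<^sup>2 - 1 / (F (fst (snd p)) * F (snd (snd p)))) (1 / (F x)\<^sup>2 - 1 / (F x * F x)) < \<eta>"
      using \<open>\<eta> > 0\<close> by blast
    have d': "\<bar>1 / (F r)\<^sup>2 - 1 / (F a * F b)\<bar> < \<eta>" if "\<bar>r - x\<bar> < d/3" "\<bar>a - x\<bar> < d/3" "\<bar>b - x\<bar> < d/3" for r a b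
    proof -
      have "dist (r, a, b) (x, x, x) \<le> \<bar>r - x\<bar> + (\<bar>a - x\<bar> + \<bar>b - x\<bar>)"
        unfolding dist_Pair_Pair dist_real_def
        by (rule order_trans[OF sqrt_sum_squares_le_sum_abs]) (auto intro!: order_trans[OF sqrt_sum_squares_le_sum_abs])
      then show ?thesis using d(2)[of "(r,a,b)"] that by (simp add: power2_eq_square)
    qed
    show "\<exists>d>0. \<forall>a b. a \<le> x \<and> x \<le> b \<and> b - a < d \<longrightarrow>
       \<bar>1 / F b - 1 / F a - (LINT r:{a..b}|lborel. - (f r * (1 / (F r)\<^sup>2)))\<bar>
        \<le> \<eta> * (LINT r:{a..b}|lborel. \<bar>f r\<bar>)"
    proof (intro exI[of _ "d/3"] conjI allI impI)
      fix a b assume ab: "a \<le> x \<and> x \<le> b \<and> b - a < d/3"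
      have "1 / F b - 1 / F a = - ((F b - F a) * (1 / (F a * F b)))"
        using nz by (simp add: field_simps)
      also have "\<dots> = - (LINT r:{a..b}|lborel. f r * (1 / (F a * F b)))"
        using indefinite_integralD[OF F, of a b] ab by simp
      finally have eq: "1 / F b - 1 / F a - (LINT r:{a..b}|lborel. - (f r * (1 / (F r)\<^sup>2))) =
         (LINT r:{a..b}|lborel. f r * (1 / (F r)\<^sup>2) - f r * (1 / (F a * F b)))"
        using f locally_integrable_Icc[OF fR, of a b] set_integral_uminus[OF locally_integrable_Icc[OF fR, of a b]]
        by simp
      show "\<bar>1 / F b - 1 / F a - (LINT r:{a..b}|lborel. - (f r * (1 / (F r)\<^sup>2)))\<bar>
          \<le> \<eta> * (LINT r:{a..b}|lborel. \<bar>f r\<bar>)"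
        unfolding eq
      proof (rule set_integral_abs_le)
        show "set_integrable lborel {a..b} (\<lambda>r. f r * (1 / (F r)\<^sup>2) - f r * (1 / (F a * F b)))"
          using f fR by (intro set_integral_diff set_integrable_mult_left locally_integrable_Icc)
        show "set_integrable lborel {a..b} (\<lambda>r. \<bar>f r\<bar>)"
          using f by (intro set_integrable_abs locally_integrable_Icc)
        fix r assume r: "r \<in> {a..b}"
        have "\<bar>1 / (F r)\<^sup>2 - 1 / (F a * F b)\<bar> \<le> \<eta>"
          using ab r unfolding atLeastAtMost_iff by (intro less_imp_le d') linarith+
        then have "\<bar>f r\<bar> * \<bar>1 / (F r)\<^sup>2 - 1 / (F a * F b)\<bar> \<le> \<bar>f r\<bar> * \<eta>"
          by (intro mult_left_mono) auto
        then show "\<bar>f r * (1 / (F r)\<^sup>2) - f r * (1 / (F a * F b))\<bar> \<le> \<eta> * \<bar>f r\<bar>"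
          by (simp add: right_diff_distrib[symmetric] abs_mult mult.commute del: times_divide_eq_right)
      qed
    qed (use d in auto)
  qed
qed

section \<open>Invariance under null sets and translations, and absolutely continuous
  representatives\<close>

lemma set_integral_cong_AE_borel:
  fixes f g :: "'a::euclidean_space \<Rightarrow> real"
  assumes "f \<in> borel_measurable borel" "g \<in> borel_measurable borel" "A \<in> sets borel"
    and "AE x in lborel. f x = g x"
  shows "(LINT x:A|lborel. f x) = (LINT x:A|lborel. g x)"
  unfolding set_lebesgue_integral_def
  using assms by (intro integral_cong_AE) (auto elim: eventually_mono)

lemma locally_integrable_cong_AE:
  assumes "locally_integrable f" "g \<in> borel_measurable borel" "AE x in lborel. f x = g x"
  shows "locally_integrable g"
proof -
  have "set_integrable lborel (cbox a b) g" for a b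
    using locally_integrable_cbox[OF assms(1), of a b] unfolding set_integrable_def
  proof (rule integrable_cong_AE_imp)
    show "(\<lambda>x. indicat_real (cbox a b) x *\<^sub>R g x) \<in> borel_measurable lborel"
      using assms(2) by simp
    show "AE x in lborel. indicat_real (cbox a b) x *\<^sub>R f x = indicat_real (cbox a b) x *\<^sub>R g x"
      using assms(3) by eventually_elim simp
  qed
  then show ?thesis using assms(2) by (simp add: locally_integrable_def)
qed

lemma AE_lborel_shift:
  fixes c :: "'a::euclidean_space"
  assumes "AE x in lborel. P x"
  shows "AE x in lborel. P (c + x)"
  using AE_distrD[of "(+) c" lborel borel P] assms unfolding lborel_distr_plus by simp

lemma integrable_lborel_shift:
  fixes c :: "'a::euclidean_space" and f :: "'a \<Rightarrow> real"
  shows "integrable lborel f \<Longrightarrow> integrable lborel (\<lambda>x. f (c + x))"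
  using integrable_distr[of "(+) c" lborel borel f] by (simp add: lborel_distr_plus)

lemma integral_lborel_shift:
  fixes c :: "'a::euclidean_space" and f :: "'a \<Rightarrow> real"
  assumes "f \<in> borel_measurable borel"
  shows "(\<integral>x. f (c + x) \<partial>lborel) = (\<integral>x. f x \<partial>lborel)"
  using integral_distr[of "(+) c" lborel borel f] assms by (simp add: lborel_distr_plus)

text \<open>Only some a.e. representative of \<open>f\<close> has to be absolutely continuous. A
  Sobolev function is known only up to null sets, so its restriction to a line cannot be expected to
  be continuous itself.\<close>

definition ac_deriv :: "(real \<Rightarrow> real) \<Rightarrow> (real \<Rightarrow> real) \<Rightarrow> bool" where
  "ac_deriv f g \<longleftrightarrow> (\<exists>F. indefinite_integral F g \<and> (AE t in lborel. f t = F t))"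

text \<open>A nonempty open set is not null. This upgrades a.e. relations between continuous
  representatives to relations at every point.\<close>

lemma open_AE_empty:
  assumes "open S" "AE x in lborel. x \<notin> S"
  shows "S = {}"
proof (rule ccontr)
  assume "S \<noteq> {}"
  then have "\<not> negligible S" using assms(1) open_not_negligible by blast
  moreover have "S \<in> null_sets lborel"
    using assms by (subst AE_iff_null_sets) auto
  ultimately show False
    by (simp add: negligible_iff_null_sets null_sets_completionI)
qed

lemma ac_deriv_cong_AE:
  assumes "ac_deriv f g" "AE t in lborel. f t = f' t" "g' \<in> borel_measurable borel" "AE t in lborel. g t = g' t"
  shows "ac_deriv f' g'"
proof -
  obtain F where F: "indefinite_integral F g" "AE t in lborel. f t = F t" using assms(1) by (auto simp: ac_deriv_def)
  have g: "locally_integrable g" using F(1) by (rule indefinite_integral_locally_integrable)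
  have "indefinite_integral F g'" unfolding indefinite_integral_def
  proof (intro conjI allI impI)
    show "locally_integrable g'" using g assms(3,4) by (rule locally_integrable_cong_AE)
    fix s t :: real assume "s \<le> t"
    then show "F t - F s = (LINT r:{s..t}|lborel. g' r)"
      using indefinite_integralD[OF F(1)] set_integral_cong_AE_borel[OF _ assms(3) _ assms(4), of "{s..t}"] locally_integrable_measurable[OF g]
      by simp
  qed
  moreover have "AE t in lborel. f' t = F t" using assms(2) F(2) by eventually_elim simp
  ultimately show ?thesis by (auto simp: ac_deriv_def)
qed

lemma ac_deriv_const: "ac_deriv (\<lambda>_. c) (\<lambda>_. 0)"
  by (auto simp: ac_deriv_def indefinite_integral_def locally_integrable_const set_lebesgue_integral_def intro!: exI[of _ "\<lambda>_. c"])

lemma ac_deriv_add: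
  assumes "ac_deriv f f'" "ac_deriv g g'"
  shows "ac_deriv (\<lambda>t. f t + g t) (\<lambda>t. f' t + g' t)"
proof -
  obtain F where F: "indefinite_integral F f'" "AE t in lborel. f t = F t" using assms(1) by (auto simp: ac_deriv_def)
  obtain G where G: "indefinite_integral G g'" "AE t in lborel. g t = G t" using assms(2) by (auto simp: ac_deriv_def)
  have "indefinite_integral (\<lambda>t. F t + G t) (\<lambda>t. f' t + g' t)"
    unfolding indefinite_integral_def
    using indefinite_integral_locally_integrable[OF F(1)] indefinite_integral_locally_integrable[OF G(1)] indefinite_integralD[OF F(1)] indefinite_integralD[OF G(1)]
    by (simp add: locally_integrable_add locally_integrable_Icc)
  moreover have "AE t in lborel. f t + g t = F t + G t" using F(2) G(2) by eventually_elim simp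
  ultimately show ?thesis by (auto simp: ac_deriv_def)
qed

lemma ac_deriv_mult:
  assumes "ac_deriv f f'" "ac_deriv g g'" and [measurable]: "f \<in> borel_measurable borel" "g \<in> borel_measurable borel"
  shows "ac_deriv (\<lambda>t. f t * g t) (\<lambda>t. f' t * g t + g' t * f t)"
proof -
  obtain F where F: "indefinite_integral F f'" "AE t in lborel. f t = F t" using assms(1) by (auto simp: ac_deriv_def)
  obtain G where G: "indefinite_integral G g'" "AE t in lborel. g t = G t" using assms(2) by (auto simp: ac_deriv_def)
  note [measurable] = locally_integrable_measurable[OF indefinite_integral_locally_integrable[OF F(1)]] locally_integrable_measurable[OF indefinite_integral_locally_integrable[OF G(1)]]
  have "ac_deriv (\<lambda>t. F t * G t) (\<lambda>t. f' t * G t + g' t * F t)"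
    using indefinite_integral_mult[OF F(1) G(1)] by (auto simp: ac_deriv_def)
  then show ?thesis
  proof (rule ac_deriv_cong_AE)
    show "AE t in lborel. F t * G t = f t * g t"
      "AE t in lborel. f' t * G t + g' t * F t = f' t * g t + g' t * f t"
      using F(2) G(2) by (eventually_elim, simp)+
  qed measurable
qed

lemma ac_deriv_inverse:
  assumes "ac_deriv f g" and [measurable]: "f \<in> borel_measurable borel"
    and "\<epsilon> > 0" "AE t in lborel. f t \<ge> \<epsilon>"
  shows "ac_deriv (\<lambda>t. 1 / f t) (\<lambda>t. - (g t * (1 / (f t)\<^sup>2)))"
proof -
  obtain F where F: "indefinite_integral F g" "AE t in lborel. f t = F t" using assms(1) by (auto simp: ac_deriv_def)
  note [measurable] = locally_integrable_measurable[OF indefinite_integral_locally_integrable[OF F(1)]]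
  \<comment> \<open>The lower bound passes from \<open>f\<close> to its continuous representative
    \<open>F\<close> and then holds everywhere, which is what the reciprocal rule asks for.\<close>
  have "open {t. F t < \<epsilon>}"
    using indefinite_integral_continuous[OF F(1)] by (intro open_Collect_less) auto
  moreover have "AE t in lborel. t \<notin> {t. F t < \<epsilon>}" using assms(4) F(2) by eventually_elim auto
  ultimately have "{t. F t < \<epsilon>} = {}" by (rule open_AE_empty)
  then have "F t > 0" for t
    using assms(3) by (metis (mono_tags) empty_Collect_eq less_le_trans not_less)
  then have "ac_deriv (\<lambda>t. 1 / F t) (\<lambda>t. - (g t * (1 / (F t)\<^sup>2)))"
    using indefinite_integral_inverse[OF F(1)] by (auto simp: ac_deriv_def)
  then show ?thesis
  proof (rule ac_deriv_cong_AE)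
    show "AE t in lborel. 1 / F t = 1 / f t"
      "AE t in lborel. - (g t * (1 / (F t)\<^sup>2)) = - (g t * (1 / (f t)\<^sup>2))"
      using F(2) by (eventually_elim, simp)+
  qed measurable
qed

text \<open>Two continuous representatives of \<open>f\<close> coincide, so \<open>g\<close> and
  \<open>g'\<close> have equal integrals over every interval.\<close>

lemma ac_deriv_unique:
  assumes "ac_deriv f g" "ac_deriv f g'"
  shows "AE t in lborel. g t = g' t"
proof -
  obtain F where F: "indefinite_integral F g" "AE t in lborel. f t = F t" using assms(1) by (auto simp: ac_deriv_def)
  obtain G where G: "indefinite_integral G g'" "AE t in lborel. f t = G t" using assms(2) by (auto simp: ac_deriv_def)
  have "open {t. F t \<noteq> G t}"
    using indefinite_integral_continuous[OF F(1)] indefinite_integral_continuous[OF G(1)] by (intro open_Collect_neq)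
  moreover have "AE t in lborel. t \<notin> {t. F t \<noteq> G t}" using F(2) G(2) by eventually_elim auto
  ultimately have "{t. F t \<noteq> G t} = {}" by (rule open_AE_empty)
  then have eq: "F t = G t" for t by auto
  have "AE t in lborel. g t - g' t = 0"
  proof (rule AE_zero_if_cbox_integrals_zero)
    show "locally_integrable (\<lambda>t. g t - g' t)"
      using F G by (intro locally_integrable_diff indefinite_integral_locally_integrable)
    fix a b
    show "(LINT x:cbox a b|lborel. g x - g' x) = 0"
    proof (cases "a \<le> b")
      case True
      then show ?thesis
        using indefinite_integralD[OF F(1) True] indefinite_integralD[OF G(1) True] eq
          locally_integrable_Icc[OF indefinite_integral_locally_integrable[OF F(1)]] locally_integrable_Icc[OF indefinite_integral_locally_integrable[OF G(1)]]
        by (simp add: cbox_interval)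
    qed (simp add: set_lebesgue_integral_def)
  qed
  then show ?thesis by simp
qed

lemma ac_deriv_increment:
  assumes "ac_deriv f g" "h \<ge> 0"
  shows "AE t in lborel. f (t + h) - f t = (LINT r:{t..t+h}|lborel. g r)"
proof -
  obtain F where F: "indefinite_integral F g" "AE t in lborel. f t = F t" using assms(1) by (auto simp: ac_deriv_def)
  have "AE t in lborel. f (h + t) = F (h + t)" using F(2) by (rule AE_lborel_shift)
  with F(2) show ?thesis
    using indefinite_integralD[OF F(1), of t "t+h" for t] assms(2)
    by (auto simp: add.commute elim!: eventually_elim2)
qed

text \<open>Integrating \<open>f (t + 1) - f t\<close> over the line gives zero by translation invariance and
  \<open>\<integral>g\<close> by Fubini.\<close>

lemma ac_deriv_integral_zero:
  assumes "ac_deriv f g" "integrable lborel f" "integrable lborel g"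
  shows "(\<integral>t. g t \<partial>lborel) = 0"
proof -
  note [measurable] = borel_measurable_integrable[OF assms(3)]
  let ?K = "\<lambda>(r, x). indicator {x..x+1::real} r *\<^sub>R g r"
  \<comment> \<open>Seen from \<open>r\<close>, the window is an interval of length one in
    \<open>x\<close>; integrating the kernel over \<open>x\<close> first therefore returns
    \<open>g r\<close> with weight one.\<close>
  have *: "indicator {x..x+1} r = (indicator {r-1..r} x :: real)" for x r :: real
    by (auto split: split_indicator)
  have int: "integrable (lborel \<Otimes>\<^sub>M lborel) ?K"
  proof (rule lborel_pair.Fubini_integrable)
    have "(\<lambda>(r,x). indicator {z. snd z \<le> fst z \<and> fst z \<le> snd z + 1} (r,x) *\<^sub>R g r)
        \<in> borel_measurable (lborel \<Otimes>\<^sub>M (lborel :: real measure))"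
      by measurable
    also have "(\<lambda>(r,x). indicator {z. snd z \<le> fst z \<and> fst z \<le> snd z + 1} (r,x) *\<^sub>R g r) = ?K"
      by (auto split: split_indicator)
    finally show "?K \<in> borel_measurable (lborel \<Otimes>\<^sub>M lborel)" .
    have "(\<integral>x. norm (?K (r, x)) \<partial>lborel) = \<bar>g r\<bar>" for r
      by (simp add: * abs_mult)
    then show "integrable lborel (\<lambda>r. \<integral>x. norm (?K (r, x)) \<partial>lborel)"
      using assms(3) by simp
    show "AE r in lborel. integrable lborel (\<lambda>x. ?K (r, x))"
      by (simp add: * integrable_mult_left)
  qed
  have "(\<integral>x. \<integral>r. ?K (r, x) \<partial>lborel \<partial>lborel) = (\<integral>r. \<integral>x. ?K (r, x) \<partial>lborel \<partial>lborel)"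
    using lborel_pair.Fubini_integral[of "curry ?K"] int by simp
  also have "\<dots> = (\<integral>r. g r \<partial>lborel)" by (simp add: *)
  finally have 1: "(\<integral>x. \<integral>r. ?K (r, x) \<partial>lborel \<partial>lborel) = (\<integral>r. g r \<partial>lborel)" .
  have f1: "integrable lborel (\<lambda>t. f (1 + t))" using assms(2) by (rule integrable_lborel_shift)
  have "(\<integral>x. \<integral>r. ?K (r, x) \<partial>lborel \<partial>lborel) = (\<integral>x. f (1 + x) - f x \<partial>lborel)"
  proof (rule integral_cong_AE)
    show "(\<lambda>x. \<integral>r. ?K (r, x) \<partial>lborel) \<in> borel_measurable lborel"
      using lborel_pair.integrable_snd[of "curry ?K"] int by simp
    show "(\<lambda>x. f (1 + x) - f x) \<in> borel_measurable lborel"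
      using f1 assms(2) by (intro borel_measurable_diff borel_measurable_integrable)
    show "AE x in lborel. (\<integral>r. ?K (r, x) \<partial>lborel) = f (1 + x) - f x"
      using ac_deriv_increment[OF assms(1) zero_le_one]
      by eventually_elim (simp add: set_lebesgue_integral_def add.commute)
  qed
  also have "\<dots> = 0"
    using f1 assms(2) integral_lborel_shift[of f 1] borel_measurable_integrable[OF assms(2)] by simp
  finally show ?thesis using 1 by simp
qed

section \<open>Derivatives along almost every line\<close>

definition other :: "2 \<Rightarrow> 2" where "other k = (if k = 1 then 2 else 1)"

definition line_point :: "2 \<Rightarrow> real \<Rightarrow> real \<Rightarrow> real^2" where
  "line_point k y t = (\<chi> i. if i = k then t else y)"

lemma other_neq [simp]: "other k \<noteq> k" "k \<noteq> other k"
  using exhaust_2[of k] by (auto simp: other_def)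

lemma UNIV_other: "(UNIV :: 2 set) = {k, other k}"
  using exhaust_2[of k] by (auto simp: other_def UNIV_2)

lemma line_point_nth [simp]: "line_point k y t $ k = t" "line_point k y t $ other k = y"
  by (auto simp: line_point_def)

lemma line_point_add_axis: "axis k h + line_point k y t = line_point k y (h + t)"
  using exhaust_2[of k] by (auto simp: line_point_def axis_def vec_eq_iff forall_2)

lemma line_point_add_axis_other: "axis k h + line_point (other k) y t = line_point (other k) (h + y) t"
  using exhaust_2[of k] by (auto simp: line_point_def axis_def other_def vec_eq_iff forall_2)

lemma continuous_on_line_point: "continuous_on UNIV (\<lambda>z. line_point k (fst z) (snd z))"
  unfolding line_point_def
proof (intro continuous_on_vec_lambda)
  show "continuous_on UNIV (\<lambda>z. if i = k then snd z else fst z)" for i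
    by (cases "i = k") (auto intro!: continuous_intros)
qed

lemma measurable_line_point: "(\<lambda>z. line_point k (fst z) (snd z)) \<in> borel_measurable borel"
  by (rule borel_measurable_continuous_onI[OF continuous_on_line_point])

lemma measurable_line_point_line [measurable]: "(\<lambda>t. line_point k y t) \<in> borel_measurable borel"
  using measurable_compose[OF _ measurable_line_point[of k], of "\<lambda>t. (y, t)" borel] by simp

text \<open>Boxes pull back to products of intervals of the same area. This gives Fubini with either
  coordinate as the inner variable, for both directions \<open>k\<close> at once.\<close>

lemma distr_line_point: "distr lborel borel (\<lambda>z. line_point k (fst z) (snd z)) = lborel"
proof (rule lborel_eqI[symmetric])
  fix l u :: "real^2" assume lu: "\<And>b. b \<in> Basis \<Longrightarrow> l \<bullet> b \<le> u \<bullet> b"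
  have le: "l $ i \<le> u $ i" for i
    using lu[of "axis i 1"] by (simp add: inner_axis)
  have "(\<lambda>z. line_point k (fst z) (snd z)) -` box l u = {l $ other k<..<u $ other k} \<times> {l $ k<..<u $ k}"
    using UNIV_other[of k] by (auto simp: mem_box_cart) (metis (full_types) UNIV_I insertE line_point_nth singletonD)+
  then have "emeasure (distr lborel borel (\<lambda>z. line_point k (fst z) (snd z))) (box l u) =
      emeasure (lborel \<Otimes>\<^sub>M lborel) ({l $ other k<..<u $ other k} \<times> {l $ k<..<u $ k})"
    using measurable_line_point[of k] by (subst emeasure_distr) (auto simp: lborel_prod)
  also have "\<dots> = ennreal ((u $ other k - l $ other k) * (u $ k - l $ k))"
    using le by (subst lborel.emeasure_pair_measure_Times) (auto simp: ennreal_mult)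
  also have "(u $ other k - l $ other k) * (u $ k - l $ k) = (\<Prod>i\<in>UNIV. (u - l) $ i)"
    by (subst UNIV_other[of k]) (simp add: mult.commute)
  also have "\<dots> = (\<Prod>b\<in>Basis. (u - l) \<bullet> b)"
  proof -
    have B: "(Basis :: (real^2) set) = (\<lambda>i. axis i 1) ` UNIV" by (auto simp: Basis_vec_def)
    have "inj_on (\<lambda>i. axis i 1 :: real^2) UNIV" by (auto simp: inj_on_def axis_eq_axis)
    then show ?thesis unfolding B by (subst prod.reindex) (auto simp: inner_axis)
  qed
  finally show "emeasure (distr lborel borel (\<lambda>z. line_point k (fst z) (snd z))) (box l u) =
      ennreal (\<Prod>b\<in>Basis. (u - l) \<bullet> b)" .
qed simp

lemma AE_line_point:
  assumes "AE x in lborel. P x"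
  shows "AE y in lborel. AE t in lborel. P (line_point k y t)"
proof -
  have "AE z in lborel \<Otimes>\<^sub>M lborel. P (line_point k (fst z) (snd z))"
    using AE_distrD[of "\<lambda>z. line_point k (fst z) (snd z)" lborel borel P] measurable_line_point[of k] assms
    unfolding distr_line_point lborel_prod by simp
  then have "AE y in lborel. AE t in lborel. P (line_point k (fst (y, t)) (snd (y, t)))"
    by (rule lborel_pair.AE_pair)
  then show ?thesis by simp
qed

text \<open>Null sections give a null set only for a measurable set, hence the Borel condition on
  the property.\<close>

lemma AE_ln_ptI:
  assumes P: "{x. P x} \<in> sets borel" and "AE y in lborel. AE t in lborel. P (line_point k y t)"
  shows "AE x in lborel. P x"
proof -
  have "AE z in lborel \<Otimes>\<^sub>M lborel. P (line_point k (fst z) (snd z))"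
  proof (rule lborel_pair.AE_pair_measure)
    show "AE y in lborel. AE t in lborel. P (line_point k (fst (y, t)) (snd (y, t)))" using assms(2) by simp
    have "(\<lambda>z. line_point k (fst z) (snd z)) -` {x. P x} \<inter> space borel \<in> sets borel"
      using measurable_line_point P by (rule measurable_sets)
    then show "{z \<in> space (lborel \<Otimes>\<^sub>M lborel). P (line_point k (fst z) (snd z))} \<in> sets (lborel \<Otimes>\<^sub>M lborel)"
      unfolding lborel_prod by (simp add: vimage_def)
  qed
  then have "AE x in distr lborel borel (\<lambda>z. line_point k (fst z) (snd z)). P x"
    using P measurable_line_point[of k] unfolding lborel_prod by (subst AE_distr_iff) auto
  then show ?thesis unfolding distr_line_point .
qed

lemma integrable_line_point_iff:
  fixes f :: "real^2 \<Rightarrow> real"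
  assumes "f \<in> borel_measurable borel"
  shows "integrable (lborel \<Otimes>\<^sub>M lborel) (\<lambda>(y, t). f (line_point k y t)) \<longleftrightarrow> integrable lborel f"
  using integrable_distr_eq[of "\<lambda>z. line_point k (fst z) (snd z)" lborel borel f] measurable_line_point[of k] assms
  by (simp add: distr_line_point lborel_prod case_prod_unfold)

lemma integral_line_point:
  fixes f :: "real^2 \<Rightarrow> real"
  assumes "f \<in> borel_measurable borel"
  shows "(\<integral>z. f (line_point k (fst z) (snd z)) \<partial>(lborel \<Otimes>\<^sub>M lborel)) = (\<integral>x. f x \<partial>lborel)"
  using integral_distr[of "\<lambda>z. line_point k (fst z) (snd z)" lborel borel f] measurable_line_point[of k] assms
  by (simp add: distr_line_point lborel_prod)

lemma Fubini_line_point: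
  fixes f :: "real^2 \<Rightarrow> real"
  assumes "integrable lborel f"
  shows "AE y in lborel. integrable lborel (\<lambda>t. f (line_point k y t))"
    and "integrable lborel (\<lambda>y. \<integral>t. f (line_point k y t) \<partial>lborel)"
    and "(\<integral>y. \<integral>t. f (line_point k y t) \<partial>lborel \<partial>lborel) = (\<integral>x. f x \<partial>lborel)"
proof -
  have f: "f \<in> borel_measurable borel" using assms by auto
  then have i: "integrable (lborel \<Otimes>\<^sub>M lborel) (\<lambda>(y, t). f (line_point k y t))"
    using assms by (subst integrable_line_point_iff)
  show "AE y in lborel. integrable lborel (\<lambda>t. f (line_point k y t))"
    "integrable lborel (\<lambda>y. \<integral>t. f (line_point k y t) \<partial>lborel)"
    using lborel_pair.AE_integrable_fst[OF i] lborel_pair.integrable_fst[OF i] by auto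
  show "(\<integral>y. \<integral>t. f (line_point k y t) \<partial>lborel \<partial>lborel) = (\<integral>x. f x \<partial>lborel)"
    using lborel_pair.integral_fst[OF i] integral_line_point[OF f, of k] by (simp add: case_prod_unfold)
qed

text \<open>Absolute continuity along almost every line in direction \<open>k\<close>. The exceptional set
  is a set of lines, so every one-dimensional calculus rule transfers at once.\<close>

definition line_deriv :: "2 \<Rightarrow> (real^2 \<Rightarrow> real) \<Rightarrow> (real^2 \<Rightarrow> real) \<Rightarrow> bool" where
  "line_deriv k f g \<longleftrightarrow> f \<in> borel_measurable borel \<and> g \<in> borel_measurable borel \<and>
     (AE y in lborel. ac_deriv (\<lambda>t. f (line_point k y t)) (\<lambda>t. g (line_point k y t)))"

lemma line_deriv_measurable [measurable_dest]:
  "line_deriv k f g \<Longrightarrow> f \<in> borel_measurable borel" "line_deriv k f g \<Longrightarrow> g \<in> borel_measurable borel"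
  by (auto simp: line_deriv_def)

lemma line_deriv_cong_AE:
  assumes "line_deriv k f g" and [measurable]: "f' \<in> borel_measurable borel" "g' \<in> borel_measurable borel"
    and "AE x in lborel. f x = f' x" "AE x in lborel. g x = g' x"
  shows "line_deriv k f' g'"
proof -
  have "AE y in lborel. ac_deriv (\<lambda>t. f (line_point k y t)) (\<lambda>t. g (line_point k y t))"
    using assms(1) by (simp add: line_deriv_def)
  then have "AE y in lborel. ac_deriv (\<lambda>t. f' (line_point k y t)) (\<lambda>t. g' (line_point k y t))"
    using AE_line_point[OF assms(4), of k] AE_line_point[OF assms(5), of k]
  proof eventually_elim
    case (elim y)
    show ?case by (rule ac_deriv_cong_AE[OF elim(1,2) _ elim(3)]) measurable
  qed
  then show ?thesis by (simp add: line_deriv_def assms)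
qed

lemma line_deriv_const: "line_deriv k (\<lambda>_. c) (\<lambda>_. 0)"
  by (simp add: line_deriv_def ac_deriv_const)

lemma line_deriv_add:
  assumes "line_deriv k f f'" "line_deriv k g g'"
  shows "line_deriv k (\<lambda>x. f x + g x) (\<lambda>x. f' x + g' x)"
  using assms unfolding line_deriv_def by (auto intro: ac_deriv_add elim!: eventually_elim2)

lemma line_deriv_mult:
  assumes "line_deriv k f f'" "line_deriv k g g'"
  shows "line_deriv k (\<lambda>x. f x * g x) (\<lambda>x. f' x * g x + g' x * f x)"
proof -
  note [measurable] = line_deriv_measurable[OF assms(1)] line_deriv_measurable[OF assms(2)]
  have "AE y in lborel. ac_deriv (\<lambda>t. f (line_point k y t)) (\<lambda>t. f' (line_point k y t))"
    "AE y in lborel. ac_deriv (\<lambda>t. g (line_point k y t)) (\<lambda>t. g' (line_point k y t))"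
    using assms by (auto simp: line_deriv_def)
  then have "AE y in lborel. ac_deriv (\<lambda>t. f (line_point k y t) * g (line_point k y t))
     (\<lambda>t. f' (line_point k y t) * g (line_point k y t) + g' (line_point k y t) * f (line_point k y t))"
    by eventually_elim (rule ac_deriv_mult, measurable)
  then show ?thesis unfolding line_deriv_def by (intro conjI) measurable
qed

lemma line_deriv_sum:
  assumes "\<And>i. i \<in> I \<Longrightarrow> line_deriv k (f i) (f' i)"
  shows "line_deriv k (\<lambda>x. \<Sum>i\<in>I. f i x) (\<lambda>x. \<Sum>i\<in>I. f' i x)"
  using assms by (induction I rule: infinite_finite_induct) (auto intro: line_deriv_add line_deriv_const)

lemma line_deriv_inverse:
  assumes "line_deriv k f f'" "\<epsilon> > 0" "AE x in lborel. f x \<ge> \<epsilon>"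
  shows "line_deriv k (\<lambda>x. 1 / f x) (\<lambda>x. - (f' x * (1 / (f x)\<^sup>2)))"
proof -
  note [measurable] = line_deriv_measurable[OF assms(1)]
  have "AE y in lborel. ac_deriv (\<lambda>t. f (line_point k y t)) (\<lambda>t. f' (line_point k y t))"
    using assms by (auto simp: line_deriv_def)
  then have "AE y in lborel. ac_deriv (\<lambda>t. 1 / f (line_point k y t))
     (\<lambda>t. - (f' (line_point k y t) * (1 / (f (line_point k y t))\<^sup>2)))"
    using AE_line_point[OF assms(3), of k]
  proof eventually_elim
    case (elim y)
    show ?case by (rule ac_deriv_inverse[OF elim(1) _ assms(2) elim(2)]) measurable
  qed
  then show ?thesis unfolding line_deriv_def by (intro conjI) measurable
qed

lemma line_deriv_unique:
  assumes "line_deriv k f g" "line_deriv k f g'"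
  shows "AE x in lborel. g x = g' x"
proof (rule AE_ln_ptI[where k=k])
  note [measurable] = line_deriv_measurable[OF assms(1)] line_deriv_measurable[OF assms(2)]
  show "{x. g x = g' x} \<in> sets borel" by measurable
  have "AE y in lborel. ac_deriv (\<lambda>t. f (line_point k y t)) (\<lambda>t. g (line_point k y t))"
    "AE y in lborel. ac_deriv (\<lambda>t. f (line_point k y t)) (\<lambda>t. g' (line_point k y t))"
    using assms by (auto simp: line_deriv_def)
  then show "AE y in lborel. AE t in lborel. g (line_point k y t) = g' (line_point k y t)"
    by eventually_elim (rule ac_deriv_unique)
qed

text \<open>On almost every line both restrictions are integrable, so the derivative has integral
  zero there; Fubini adds up the lines. This is the divergence theorem on the whole plane, with
  integrability of \<open>f\<close> in place of boundary conditions.\<close>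

lemma line_deriv_integral_zero:
  assumes "line_deriv k f g" "integrable lborel f" "integrable lborel g"
  shows "(\<integral>x. g x \<partial>lborel) = 0"
proof -
  have "AE y in lborel. ac_deriv (\<lambda>t. f (line_point k y t)) (\<lambda>t. g (line_point k y t))"
    using assms by (auto simp: line_deriv_def)
  then have "AE y in lborel. (\<integral>t. g (line_point k y t) \<partial>lborel) = 0"
    using Fubini_line_point(1)[OF assms(2), of k] Fubini_line_point(1)[OF assms(3), of k]
    by eventually_elim (rule ac_deriv_integral_zero)
  then have "(\<integral>y. \<integral>t. g (line_point k y t) \<partial>lborel \<partial>lborel) = 0"
    by (rule integral_eq_zero_AE)
  then show ?thesis using Fubini_line_point(3)[OF assms(3), of k] by simp
qed

text \<open>A translation across the lines merely relabels them, \<open>y\<close> becoming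
  \<open>h + y\<close>.\<close>

lemma line_deriv_shift:
  assumes "line_deriv k f g"
  shows "line_deriv k (\<lambda>x. f (axis (other k) h + x)) (\<lambda>x. g (axis (other k) h + x))"
proof -
  note [measurable] = line_deriv_measurable[OF assms(1)]
  have "AE y in lborel. ac_deriv (\<lambda>t. f (line_point k y t)) (\<lambda>t. g (line_point k y t))"
    using assms by (auto simp: line_deriv_def)
  then have "AE y in lborel. ac_deriv (\<lambda>t. f (line_point k (h + y) t)) (\<lambda>t. g (line_point k (h + y) t))"
    by (rule AE_lborel_shift)
  moreover have "axis (other k) h + line_point k y t = line_point k (h + y) t" for y t
    using line_point_add_axis_other[of "other k" h y t] exhaust_2[of k] by (auto simp: other_def)
  ultimately show ?thesis unfolding line_deriv_def by simp
qed

section \<open>Test functions\<close>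

text \<open>A coinductive form of infinite differentiability: \<open>X\<close> is a family
  containing \<open>f\<close> in which every member has its derivative. Smoothness is then proved by
  exhibiting a family, without indexing higher derivatives.\<close>

definition smooth1 :: "(real \<Rightarrow> real) \<Rightarrow> bool" where
  "smooth1 f \<longleftrightarrow> (\<exists>X. f \<in> X \<and> (\<forall>h\<in>X. \<exists>h'\<in>X. \<forall>t. (h has_real_derivative h' t) (at t)))"

lemma smooth1I:
  assumes "f \<in> X" "\<And>h. h \<in> X \<Longrightarrow> \<exists>h'\<in>X. \<forall>t. (h has_real_derivative h' t) (at t)"
  shows "smooth1 f"
  using assms unfolding smooth1_def by blast

lemma smooth1E:
  assumes "smooth1 f"
  obtains X where "f \<in> X" "\<And>h. h \<in> X \<Longrightarrow> \<exists>h'\<in>X. \<forall>t. (h has_real_derivative h' t) (at t)"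
  using assms unfolding smooth1_def by blast

lemma smooth1_derivE:
  assumes "smooth1 f"
  obtains f' where "smooth1 f'" "\<And>t. (f has_real_derivative f' t) (at t)"
  using assms unfolding smooth1_def by metis

lemma smooth1_continuous: "smooth1 f \<Longrightarrow> continuous_on S f"
  by (metis DERIV_isCont continuous_at_imp_continuous_on smooth1_derivE)

lemma smooth1_antiderivative:
  assumes "smooth1 f'" "\<And>t. (f has_real_derivative f' t) (at t)"
  shows "smooth1 f"
proof -
  obtain X where "f' \<in> X" "\<And>h. h \<in> X \<Longrightarrow> \<exists>h'\<in>X. \<forall>t. (h has_real_derivative h' t) (at t)"
    using assms(1) smooth1E by blast
  then show ?thesis using assms(2) by (intro smooth1I[of f "insert f X"]) auto
qed

text \<open>By the Leibniz rule, the finite sums of products of members of two derivative-closed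
  families are again derivative-closed.\<close>

inductive_set prods :: "(real \<Rightarrow> real) set \<Rightarrow> (real \<Rightarrow> real) set \<Rightarrow> (real \<Rightarrow> real) set" for X Y where
  "f \<in> X \<Longrightarrow> g \<in> Y \<Longrightarrow> (\<lambda>t. f t * g t) \<in> prods X Y"
| "p \<in> prods X Y \<Longrightarrow> q \<in> prods X Y \<Longrightarrow> (\<lambda>t. p t + q t) \<in> prods X Y"

lemma smooth1_mult:
  assumes "smooth1 f" "smooth1 g"
  shows "smooth1 (\<lambda>t. f t * g t)"
proof -
  obtain X where X: "f \<in> X" "\<And>h. h \<in> X \<Longrightarrow> \<exists>h'\<in>X. \<forall>t. (h has_real_derivative h' t) (at t)"
    using assms(1) smooth1E by blast
  obtain Y where Y: "g \<in> Y" "\<And>h. h \<in> Y \<Longrightarrow> \<exists>h'\<in>Y. \<forall>t. (h has_real_derivative h' t) (at t)"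
    using assms(2) smooth1E by blast
  show ?thesis
  proof (rule smooth1I[of _ "prods X Y"])
    show "(\<lambda>t. f t * g t) \<in> prods X Y" using X Y by (auto intro: prods.intros)
    fix h assume "h \<in> prods X Y"
    then show "\<exists>h'\<in>prods X Y. \<forall>t. (h has_real_derivative h' t) (at t)"
    proof induction
      case (1 a b)
      obtain a' where a': "a' \<in> X" "\<And>t. (a has_real_derivative a' t) (at t)" using X 1 by blast
      obtain b' where b': "b' \<in> Y" "\<And>t. (b has_real_derivative b' t) (at t)" using Y 1 by blast
      show ?case
      proof (intro bexI allI)
        show "(\<lambda>t. a' t * b t + a t * b' t) \<in> prods X Y" using 1 a' b' by (intro prods.intros)
        show "((\<lambda>t. a t * b t) has_real_derivative a' t * b t + a t * b' t) (at t)" for t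
          using a' b' by (auto intro!: derivative_eq_intros)
      qed
    next
      case (2 p q)
      then obtain p' q' where "p' \<in> prods X Y" "q' \<in> prods X Y"
        "\<And>t. (p has_real_derivative p' t) (at t)" "\<And>t. (q has_real_derivative q' t) (at t)" by blast
      then show ?case by (intro bexI[of _ "\<lambda>t. p' t + q' t"]) (auto intro: prods.intros derivative_intros)
    qed
  qed
qed

lemma smooth1_affine:
  assumes "smooth1 f"
  shows "smooth1 (\<lambda>t. a * f (c * t + d))"
proof -
  obtain X where X: "f \<in> X" "\<And>h. h \<in> X \<Longrightarrow> \<exists>h'\<in>X. \<forall>t. (h has_real_derivative h' t) (at t)"
    using assms(1) smooth1E by blast
  show ?thesis
  proof (rule smooth1I[of _ "{\<lambda>t. a * h (c * t + d) |a h. h \<in> X}"])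
    fix p assume "p \<in> {\<lambda>t. a * h (c * t + d) |a h. h \<in> X}"
    then obtain a h where p: "p = (\<lambda>t. a * h (c * t + d))" "h \<in> X" by blast
    obtain h' where h': "h' \<in> X" "\<And>t. (h has_real_derivative h' t) (at t)" using X p by blast
    have "(p has_real_derivative (a * c) * h' (c * t + d)) (at t)" for t
      unfolding p(1) by (rule derivative_eq_intros DERIV_chain2[OF h'(2)] refl | simp)+
    then show "\<exists>p'\<in>{\<lambda>t. a * h (c * t + d) |a h. h \<in> X}. \<forall>t. (p has_real_derivative p' t) (at t)"
      using h'(1) by (intro bexI[of _ "\<lambda>t. (a * c) * h' (c * t + d)"]) auto
  qed (use X in auto)
qed

lemma smooth1_add:
  assumes "smooth1 f" "smooth1 g"
  shows "smooth1 (\<lambda>t. f t + g t)"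
proof -
  obtain X where X: "f \<in> X" "\<And>h. h \<in> X \<Longrightarrow> \<exists>h'\<in>X. \<forall>t. (h has_real_derivative h' t) (at t)"
    using assms(1) smooth1E by blast
  obtain Y where Y: "g \<in> Y" "\<And>h. h \<in> Y \<Longrightarrow> \<exists>h'\<in>Y. \<forall>t. (h has_real_derivative h' t) (at t)"
    using assms(2) smooth1E by blast
  show ?thesis
  proof (rule smooth1I[of _ "{\<lambda>t. a t + b t |a b. a \<in> X \<and> b \<in> Y}"])
    fix p assume "p \<in> {\<lambda>t. a t + b t |a b. a \<in> X \<and> b \<in> Y}"
    then obtain a b where p: "p = (\<lambda>t. a t + b t)" "a \<in> X" "b \<in> Y" by blast
    obtain a' b' where "a' \<in> X" "b' \<in> Y" "\<And>t. (a has_real_derivative a' t) (at t)"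
      "\<And>t. (b has_real_derivative b' t) (at t)" using X Y p by metis
    then show "\<exists>p'\<in>{\<lambda>t. a t + b t |a b. a \<in> X \<and> b \<in> Y}. \<forall>t. (p has_real_derivative p' t) (at t)"
      unfolding p(1) by (intro bexI[of _ "\<lambda>t. a' t + b' t"]) (auto intro: derivative_intros)
  qed (use X Y in auto)
qed

definition poly_exp_inverse :: "real poly \<Rightarrow> real \<Rightarrow> real" where
  "poly_exp_inverse p t = (if t > 0 then poly p (1 / t) * exp (- (1 / t)) else 0)"

lemma poly_exp_minus_tendsto_0: "((\<lambda>u. poly p u * exp (- u)) \<longlongrightarrow> (0::real)) at_top"
proof -
  have "((\<lambda>u. \<Sum>i\<le>degree p. coeff p i * (u ^ i / exp u)) \<longlongrightarrow> (\<Sum>i\<le>degree p. coeff p i * 0)) at_top"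
    by (intro tendsto_intros tendsto_power_div_exp_0)
  then show ?thesis by (simp add: poly_altdef exp_minus sum_distrib_right divide_inverse mult.assoc)
qed

text \<open>With u = 1/t, differentiating p(u) exp(-u) in t gives the factor
  \<open>u\<^sup>2\<close>, the polynomial \<open>[:0,0,1:]\<close>, times p(u) - p'(u). At zero the
  exponential beats every polynomial, so the derivative there is zero.\<close>

lemma poly_exp_inverse_has_derivative:
  "(poly_exp_inverse p has_real_derivative poly_exp_inverse ([:0,0,1:] * (p - pderiv p)) t) (at t)"
proof -
  consider "t > 0" | "t < 0" | "t = 0" by linarith
  then show ?thesis
  proof cases
    case 1
    have "((\<lambda>t. poly p (1 / t) * exp (- (1 / t))) has_real_derivative
        poly_exp_inverse ([:0,0,1:] * (p - pderiv p)) t) (at t)"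
      using 1 by (auto intro!: derivative_eq_intros DERIV_chain2[OF poly_DERIV]
          simp: poly_exp_inverse_def field_simps power2_eq_square)
    then show ?thesis
      by (rule has_field_derivative_transform_within_open[where S="{0<..}"]) (use 1 in \<open>auto simp: poly_exp_inverse_def\<close>)
  next
    case 2
    have "((\<lambda>t. 0) has_real_derivative poly_exp_inverse ([:0,0,1:] * (p - pderiv p)) t) (at t)"
      using 2 by (simp add: poly_exp_inverse_def)
    then show ?thesis
      by (rule has_field_derivative_transform_within_open[where S="{..<0}"]) (use 2 in \<open>auto simp: poly_exp_inverse_def\<close>)
  next
    case 3
    \<comment> \<open>Dividing by \<open>h\<close> multiplies by u = 1/h, which raises the degree of
      the polynomial by one.\<close>
    have "((\<lambda>h. poly (pCons 0 p) (inverse h) * exp (- inverse h)) \<longlongrightarrow> 0) (at_right 0)"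
      by (rule filterlim_compose[OF poly_exp_minus_tendsto_0 filterlim_inverse_at_top_right])
    then have "((\<lambda>h. poly_exp_inverse p h / h) \<longlongrightarrow> 0) (at_right 0)"
      by (rule Lim_transform_eventually)
        (auto simp: poly_exp_inverse_def eventually_at_right_less field_simps intro!: eventually_mono[OF eventually_at_right_less])
    moreover have "((\<lambda>h. poly_exp_inverse p h / h) \<longlongrightarrow> 0) (at_left 0)"
      by (rule tendsto_eventually) (auto simp: poly_exp_inverse_def eventually_at_left_field intro!: exI[of _ "-1"])
    ultimately have "((\<lambda>h. poly_exp_inverse p h / h) \<longlongrightarrow> 0) (at 0)"
      by (simp add: filterlim_at_split)
    then show ?thesis using 3 by (simp add: has_field_derivative_iff poly_exp_inverse_def)
  qed
qed

lemma smooth1_poly_exp_inverse: "smooth1 (poly_exp_inverse p)"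
  by (rule smooth1I[of _ "range poly_exp_inverse"]) (use poly_exp_inverse_has_derivative in auto)

text \<open>The factor \<open>Suc n\<close> steepens both flanks: inside the interval the two
  exponents tend to zero as \<open>n\<close> grows, so these test functions converge to the
  indicator of the open interval while staying below 1.\<close>

definition bump :: "real \<Rightarrow> real \<Rightarrow> nat \<Rightarrow> real \<Rightarrow> real" where
  "bump a b n t = poly_exp_inverse 1 (real (Suc n) * (t - a)) * poly_exp_inverse 1 (real (Suc n) * (b - t))"

lemma bump_nonneg: "0 \<le> bump a b n t" and bump_le_1: "bump a b n t \<le> 1"
  and bump_eq_0: "t \<notin> {a<..<b} \<Longrightarrow> bump a b n t = 0"
  by (auto simp: bump_def poly_exp_inverse_def zero_less_mult_iff intro!: mult_le_one)

lemma bump_tendsto: "(\<lambda>n. bump a b n t) \<longlonglongrightarrow> indicator {a<..<b} t"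
proof (cases "t \<in> {a<..<b}")
  case True
  have "(\<lambda>n. exp (- (1 / (real (Suc n) * c)))) \<longlonglongrightarrow> 1" if "c > 0" for c
  proof -
    have "(\<lambda>n. exp (- (inverse (real (Suc n)) * inverse c))) \<longlonglongrightarrow> exp (- (0 * inverse c))"
      by (intro tendsto_intros LIMSEQ_inverse_real_of_nat)
    then show ?thesis by (simp add: divide_inverse)
  qed
  from tendsto_mult[OF this[of "t - a"] this[of "b - t"]] True
  show ?thesis by (simp add: bump_def poly_exp_inverse_def zero_less_mult_iff)
next
  case False
  then show ?thesis by (simp add: bump_eq_0)
qed

definition test1 :: "(real \<Rightarrow> real) \<Rightarrow> bool" where
  "test1 f \<longleftrightarrow> smooth1 f \<and> (\<exists>R. \<forall>t. t \<notin> {-R..R} \<longrightarrow> f t = 0)"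

lemma test1_bump: "test1 (bump a b n)"
proof -
  have "smooth1 (\<lambda>t. 1 * poly_exp_inverse 1 (real (Suc n) * t + (- real (Suc n) * a)))"
    "smooth1 (\<lambda>t. 1 * poly_exp_inverse 1 (- real (Suc n) * t + real (Suc n) * b))"
    by (intro smooth1_affine smooth1_poly_exp_inverse)+
  from smooth1_mult[OF this] have "smooth1 (bump a b n)"
    unfolding bump_def[abs_def] by (simp add: algebra_simps)
  moreover have "bump a b n t = 0" if "t \<notin> {- (\<bar>a\<bar> + \<bar>b\<bar>)..\<bar>a\<bar> + \<bar>b\<bar>}" for t
    using that by (intro bump_eq_0) auto
  ultimately show ?thesis unfolding test1_def by blast
qed

lemma test1_bounded:
  assumes "test1 f"
  obtains B where "\<And>t. \<bar>f t\<bar> \<le> B"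
proof -
  obtain R where R: "\<And>t. t \<notin> {-R..R} \<Longrightarrow> f t = 0" using assms by (auto simp: test1_def)
  have "bounded (f ` {-R..R})"
    using assms by (intro compact_imp_bounded compact_continuous_image smooth1_continuous) (auto simp: test1_def)
  then obtain B where B: "\<And>t. t \<in> {-R..R} \<Longrightarrow> \<bar>f t\<bar> \<le> B" unfolding bounded_iff by fastforce
  have "\<bar>f t\<bar> \<le> max B 0" for t using B[of t] R[of t] by (cases "t \<in> {-R..R}") auto
  then show ?thesis by (rule that)
qed

lemma test1_measurable [measurable_dest]: "test1 f \<Longrightarrow> f \<in> borel_measurable borel"
  by (auto simp: test1_def intro!: borel_measurable_continuous_onI smooth1_continuous)

lemma test1_derivE:
  assumes "test1 f"
  obtains f' where "test1 f'" "\<And>t. (f has_real_derivative f' t) (at t)"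
proof -
  obtain R where R: "\<And>t. t \<notin> {-R..R} \<Longrightarrow> f t = 0" using assms by (auto simp: test1_def)
  obtain f' where f': "smooth1 f'" "\<And>t. (f has_real_derivative f' t) (at t)"
    using assms smooth1_derivE unfolding test1_def by blast
  have "f' t = 0" if "t \<notin> {-R..R}" for t
  proof -
    have "((\<lambda>t. 0) has_real_derivative f' t) (at t)"
      by (rule has_field_derivative_transform_within_open[OF f'(2)[of t], where S="- {-R..R}"])
        (use that R in auto)
    then show ?thesis using DERIV_unique DERIV_const by blast
  qed
  then show ?thesis using f' that by (auto simp: test1_def)
qed

section \<open>Products of one-variable test functions as test functions on the plane\<close>

lemma has_derivative_tensor:
  assumes "\<And>t. (a has_real_derivative a' t) (at t)" "\<And>t. (b has_real_derivative b' t) (at t)"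
  shows "((\<lambda>x::real^2. a (x $ k) * b (x $ other k)) has_derivative
     (\<lambda>h. a' (x $ k) * b (x $ other k) * h $ k + a (x $ k) * b' (x $ other k) * h $ other k)) (at x)"
proof -
  have nth: "((\<lambda>x::real^2. x $ i) has_derivative (\<lambda>h. h $ i)) (at x)" for i
    by (rule bounded_linear_imp_has_derivative) (rule bounded_linear_vec_nth)
  have "((\<lambda>x::real^2. a (x $ k)) has_derivative (\<lambda>h. a' (x $ k) * h $ k)) (at x)"
    "((\<lambda>x::real^2. b (x $ other k)) has_derivative (\<lambda>h. b' (x $ other k) * h $ other k)) (at x)"
    using has_derivative_compose[OF nth assms(1)[unfolded has_field_derivative_def]]
      has_derivative_compose[OF nth assms(2)[unfolded has_field_derivative_def]] by auto
  from has_derivative_mult[OF this] show ?thesis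
    by (simp add: algebra_simps)
qed

lemma iter_partial_tensor:
  assumes "\<And>t. (a has_real_derivative a' t) (at t)" "\<And>t. (b has_real_derivative b' t) (at t)"
  shows "iter_partial [k] (\<lambda>x. a (x $ k) * b (x $ other k)) = (\<lambda>x. a' (x $ k) * b (x $ other k))"
    and "iter_partial [other k] (\<lambda>x. a (x $ k) * b (x $ other k)) = (\<lambda>x. a (x $ k) * b' (x $ other k))"
  by (auto simp: frechet_derivative_at[OF has_derivative_tensor[OF assms], symmetric] axis_def)

lemma test_fun_tensor:
  assumes "test1 \<alpha>" "test1 \<beta>"
  shows "test_fun (\<lambda>x. \<alpha> (x $ k) * \<beta> (x $ other k))"
proof -
  let ?\<phi> = "\<lambda>a b (x::real^2). a (x $ k) * b (x $ other k) :: real"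
  obtain X where X: "\<alpha> \<in> X" "\<And>h. h \<in> X \<Longrightarrow> \<exists>h'\<in>X. \<forall>t. (h has_real_derivative h' t) (at t)"
    using assms(1) smooth1E unfolding test1_def by blast
  obtain Y where Y: "\<beta> \<in> Y" "\<And>h. h \<in> Y \<Longrightarrow> \<exists>h'\<in>Y. \<forall>t. (h has_real_derivative h' t) (at t)"
    using assms(2) smooth1E unfolding test1_def by blast
  \<comment> \<open>Each partial derivative acts on one factor only, so all iterated partials remain
    products of a member of \<open>X\<close> and a member of \<open>Y\<close>.\<close>
  have *: "\<exists>a\<in>X. \<exists>b\<in>Y. iter_partial js (?\<phi> \<alpha> \<beta>) = ?\<phi> a b" for js
  proof (induction js)
    case Nil
    then show ?case using X Y by auto
  next
    case (Cons j js)
    then obtain a b where ab: "a \<in> X" "b \<in> Y" "iter_partial js (?\<phi> \<alpha> \<beta>) = ?\<phi> a b" by blast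
    obtain a' b' where d: "a' \<in> X" "b' \<in> Y" "\<And>t. (a has_real_derivative a' t) (at t)"
      "\<And>t. (b has_real_derivative b' t) (at t)" using X Y ab by metis
    have eq: "iter_partial (j # js) (?\<phi> \<alpha> \<beta>) = iter_partial [j] (?\<phi> a b)"
      using ab(3) by simp
    have "j = k \<or> j = other k" using UNIV_other[of k] by auto
    then show ?case
      unfolding eq using iter_partial_tensor[of a a' b b' k] d ab by blast
  qed
  have "smooth2 (?\<phi> \<alpha> \<beta>)"
    unfolding smooth2_def
  proof (intro allI)
    fix js x
    obtain a b where ab: "a \<in> X" "b \<in> Y" "iter_partial js (?\<phi> \<alpha> \<beta>) = ?\<phi> a b" using * by blast
    obtain a' b' where d: "\<And>t. (a has_real_derivative a' t) (at t)"
      "\<And>t. (b has_real_derivative b' t) (at t)" using X Y ab by metis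
    show "iter_partial js (?\<phi> \<alpha> \<beta>) differentiable at x"
      unfolding ab(3) using has_derivative_tensor[of a a' b b', OF d] by (auto simp: differentiable_def)
  qed
  moreover have "bounded {x. ?\<phi> \<alpha> \<beta> x \<noteq> 0}"
  proof -
    obtain R S where "\<And>t. t \<notin> {-R..R} \<Longrightarrow> \<alpha> t = 0" "\<And>t. t \<notin> {-S..S} \<Longrightarrow> \<beta> t = 0"
      using assms by (auto simp: test1_def)
    then have "{x. ?\<phi> \<alpha> \<beta> x \<noteq> 0} \<subseteq> cbox (line_point k (-S) (-R)) (line_point k S R)"
      using UNIV_other[of k] by (auto simp: mem_box_cart) (metis (full_types) UNIV_I atLeastAtMost_iff insertE line_point_nth singletonD)+
    then show ?thesis using bounded_cbox bounded_subset by blast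
  qed
  ultimately show ?thesis by (simp add: test_fun_def)
qed

section \<open>Pairing with test functions, fundamental lemmas and antiderivatives\<close>

lemma integrable_locally_integrable_mult:
  assumes w: "locally_integrable w" and m: "\<phi> \<in> borel_measurable borel" and B: "\<And>x. \<bar>\<phi> x\<bar> \<le> B"
    and 0: "\<And>x. x \<notin> cbox a b \<Longrightarrow> \<phi> x = 0"
  shows "integrable lborel (\<lambda>x. \<phi> x * w x)"
proof -
  have "set_integrable lborel (cbox a b) (\<lambda>x. w x * \<phi> x)"
    using m B by (intro set_integrable_mult_bounded[where B=B] locally_integrable_cbox w) auto
  moreover have "indicator (cbox a b) x *\<^sub>R (w x * \<phi> x) = \<phi> x * w x" for x
    using 0[of x] by (auto split: split_indicator)
  ultimately show ?thesis by (simp only: set_integrable_def)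
qed

lemma integrable_locally_integrable_mult_test1:
  assumes "locally_integrable w" "test1 \<phi>"
  shows "integrable lborel (\<lambda>t. \<phi> t * w t)"
proof -
  obtain B where "\<And>t. \<bar>\<phi> t\<bar> \<le> B" using test1_bounded[OF assms(2)] by blast
  moreover obtain R where "\<And>t. t \<notin> {-R..R} \<Longrightarrow> \<phi> t = 0" using assms(2) by (auto simp: test1_def)
  ultimately show ?thesis using assms
    by (intro integrable_locally_integrable_mult[where a="-R" and b=R]) (auto simp: cbox_interval test1_measurable)
qed

lemma integrable_locally_integrable_mult_tensor:
  assumes "locally_integrable w" "test1 \<alpha>" "test1 \<beta>"
  shows "integrable lborel (\<lambda>x. \<alpha> (x $ k) * \<beta> (x $ other k) * w x)"
proof -
  obtain A where A: "\<And>t. \<bar>\<alpha> t\<bar> \<le> A" using test1_bounded[OF assms(2)] by blast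
  obtain B where B: "\<And>t. \<bar>\<beta> t\<bar> \<le> B" using test1_bounded[OF assms(3)] by blast
  have A0: "A \<ge> 0" using A[of 0] by linarith
  obtain R S where "\<And>t. t \<notin> {-R..R} \<Longrightarrow> \<alpha> t = 0" "\<And>t. t \<notin> {-S..S} \<Longrightarrow> \<beta> t = 0"
    using assms by (auto simp: test1_def)
  then have "\<alpha> (x $ k) * \<beta> (x $ other k) = 0" if "x \<notin> cbox (line_point k (-S) (-R)) (line_point k S R)" for x
    using that UNIV_other[of k]
    by (auto simp: mem_box_cart) (metis (full_types) UNIV_I atLeastAtMost_iff insertE line_point_nth singletonD)+
  moreover have "\<bar>\<alpha> (x $ k) * \<beta> (x $ other k)\<bar> \<le> A * B" for x :: "real^2"
    unfolding abs_mult using A B A0 by (intro mult_mono) auto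
  moreover have "(\<lambda>x::real^2. \<alpha> (x $ k) * \<beta> (x $ other k)) \<in> borel_measurable borel"
    using test1_measurable[OF assms(2)] test1_measurable[OF assms(3)] by measurable
  ultimately show ?thesis using assms(1) by (intro integrable_locally_integrable_mult)
qed

text \<open>Dominated convergence with majorant \<open>\<bar>w\<bar>\<close> on the closed box. The
  limit sees the open box only, but the boundary is a null set.\<close>

lemma tendsto_set_integral_box:
  fixes w :: "'a::euclidean_space \<Rightarrow> real"
  assumes w: "locally_integrable w" and m: "\<And>n. \<phi> n \<in> borel_measurable borel"
    and B: "\<And>n x. \<bar>\<phi> n x\<bar> \<le> 1" and 0: "\<And>n x. x \<notin> box a b \<Longrightarrow> \<phi> n x = 0"
    and lim: "\<And>x. (\<lambda>n. \<phi> n x) \<longlonglongrightarrow> indicator (box a b) x"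
  shows "(\<lambda>n. \<integral>x. \<phi> n x * w x \<partial>lborel) \<longlonglongrightarrow> (LINT x:cbox a b|lborel. w x)"
proof -
  note [measurable] = m locally_integrable_measurable[OF w]
  have "AE x in lebesgue. x \<notin> cbox a b - box a b"
    using negligible_frontier_interval[of a b] by (auto simp: negligible_iff_null_sets dest!: AE_not_in)
  then have bd: "AE x in lborel. x \<notin> cbox a b - box a b"
    by (subst (asm) AE_completion_iff) auto
  have "(\<lambda>n. \<integral>x. \<phi> n x * w x \<partial>lborel) \<longlonglongrightarrow> (\<integral>x. indicator (cbox a b) x *\<^sub>R w x \<partial>lborel)"
  proof (rule integral_dominated_convergence)
    show "integrable lborel (\<lambda>x. indicator (cbox a b) x *\<^sub>R \<bar>w x\<bar>)"
      using locally_integrable_cbox[OF locally_integrable_abs[OF w], of a b] by (simp add: set_integrable_def)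
    show "AE x in lborel. (\<lambda>n. \<phi> n x * w x) \<longlonglongrightarrow> indicator (cbox a b) x *\<^sub>R w x"
      using bd
    proof eventually_elim
      case (elim x)
      then have "indicator (cbox a b) x = (indicator (box a b) x :: real)"
        using box_subset_cbox[of a b] by (auto split: split_indicator)
      then show ?case using tendsto_mult[OF lim[of x] tendsto_const[of "w x"]] by simp
    qed
    fix n
    have "\<bar>\<phi> n x\<bar> * \<bar>w x\<bar> \<le> 1 * \<bar>w x\<bar>" for x
      using B by (intro mult_right_mono) auto
    then show "AE x in lborel. norm (\<phi> n x * w x) \<le> indicator (cbox a b) x *\<^sub>R \<bar>w x\<bar>"
      using 0[of _ n] box_subset_cbox[of a b] by (intro AE_I2) (force simp: abs_mult split: split_indicator)
  qed measurable
  then show ?thesis by (simp add: set_lebesgue_integral_def)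
qed

lemma bump_measurable [measurable]: "bump a b n \<in> borel_measurable borel"
  by (rule test1_measurable[OF test1_bump])

lemma abs_bump_le: "\<bar>bump a b n t\<bar> \<le> 1"
  using bump_nonneg[of a b n t] bump_le_1[of a b n t] by simp

lemma bump_integral_tendsto:
  assumes "locally_integrable w"
  shows "(\<lambda>n. \<integral>t. bump a b n t * w t \<partial>lborel) \<longlonglongrightarrow> (LINT t:{a..b}|lborel. w t)"
  using tendsto_set_integral_box[OF assms, of "bump a b" a b] bump_tendsto bump_eq_0 abs_bump_le
  by (simp add: cbox_interval box_real)

lemma fundamental_lemma_1:
  assumes "locally_integrable w" "\<And>\<beta>. test1 \<beta> \<Longrightarrow> (\<integral>t. \<beta> t * w t \<partial>lborel) = 0"
  shows "AE t in lborel. w t = (0::real)"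
proof (rule AE_zero_if_cbox_integrals_zero[OF assms(1)])
  fix a b
  show "(LINT t:cbox a b|lborel. w t) = 0"
    using bump_integral_tendsto[OF assms(1), of a b] assms(2)[OF test1_bump]
    by (simp add: LIMSEQ_const_iff cbox_interval)
qed

text \<open>Products of bumps converge to the indicator of a box, so the vanishing pairings force
  all box integrals of \<open>w\<close> to vanish.\<close>

lemma fundamental_lemma_2:
  assumes "locally_integrable w" "\<And>\<alpha> \<beta>. test1 \<alpha> \<Longrightarrow> test1 \<beta> \<Longrightarrow> (\<integral>x. \<alpha> (x $ k) * \<beta> (x $ other k) * w x \<partial>lborel) = 0"
  shows "AE x in lborel. w x = 0"
proof (rule AE_zero_if_cbox_integrals_zero[OF assms(1)])
  fix a b :: "real^2"
  define \<phi> where "\<phi> n x = bump (a $ k) (b $ k) n (x $ k) * bump (a $ other k) (b $ other k) n (x $ other k)" for n and x :: "real^2"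
  have box: "x \<in> box a b \<longleftrightarrow> x $ k \<in> {a $ k<..<b $ k} \<and> x $ other k \<in> {a $ other k<..<b $ other k}" for x
  proof -
    have "x \<in> box a b \<longleftrightarrow> (\<forall>i\<in>{k, other k}. a $ i < x $ i \<and> x $ i < b $ i)"
      unfolding mem_box_cart UNIV_other[of k, symmetric] by auto
    then show ?thesis by auto
  qed
  have "(\<lambda>n. \<integral>x. \<phi> n x * w x \<partial>lborel) \<longlonglongrightarrow> (LINT x:cbox a b|lborel. w x)"
  proof (rule tendsto_set_integral_box[OF assms(1)])
    show "\<phi> n \<in> borel_measurable borel" for n unfolding \<phi>_def by measurable
    show "\<bar>\<phi> n x\<bar> \<le> 1" for n x
      unfolding \<phi>_def abs_mult using abs_bump_le by (intro mult_le_one) auto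
    show "\<phi> n x = 0" if "x \<notin> box a b" for n x
      using that bump_eq_0 unfolding \<phi>_def box by auto
    show "(\<lambda>n. \<phi> n x) \<longlonglongrightarrow> indicator (box a b) x" for x
    proof -
      have "indicator (box a b) x = (indicator {a $ k<..<b $ k} (x $ k) *
          indicator {a $ other k<..<b $ other k} (x $ other k) :: real)"
        by (auto simp: box split: split_indicator)
      then show ?thesis unfolding \<phi>_def by (simp only: tendsto_mult[OF bump_tendsto bump_tendsto])
    qed
  qed
  moreover have "(\<integral>x. \<phi> n x * w x \<partial>lborel) = 0" for n
    unfolding \<phi>_def by (intro assms(2) test1_bump)
  ultimately show "(LINT x:cbox a b|lborel. w x) = 0" by (simp add: LIMSEQ_const_iff)
qed

lemma indefinite_integral_C1:
  assumes "\<And>t. (\<alpha> has_real_derivative \<alpha>' t) (at t)" "continuous_on UNIV \<alpha>'"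
  shows "indefinite_integral \<alpha> \<alpha>'"
  unfolding indefinite_integral_def
proof (intro conjI allI impI)
  show "locally_integrable \<alpha>'" using assms(2) by (rule locally_integrable_continuous)
  fix s t :: real assume "s \<le> t"
  then have "(\<integral>r. indicator {s..t} r *\<^sub>R \<alpha>' r \<partial>lborel) = \<alpha> t - \<alpha> s"
    using assms by (intro integral_FTC_atLeastAtMost)
      (auto simp: has_real_derivative_iff_has_vector_derivative[symmetric]
        intro: has_field_derivative_at_within continuous_on_subset)
  then show "\<alpha> t - \<alpha> s = (LINT r:{s..t}|lborel. \<alpha>' r)" by (simp add: set_lebesgue_integral_def)
qed

lemma indefinite_integral_exists:
  assumes g: "locally_integrable g"
  obtains P where "indefinite_integral P g"
proof
  define P where "P t = (if t \<ge> 0 then LINT r:{0..t}|lborel. g r else - (LINT r:{t..0}|lborel. g r))" for t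
  have "P t - P s = (LINT r:{s..t}|lborel. g r)" if "s \<le> t" for s t
  proof -
    consider "0 \<le> s" | "s < 0" "0 \<le> t" | "t < 0" using that by linarith
    then show ?thesis
    proof cases
      case 1
      then show ?thesis using that set_integral_Icc_split[OF g, of 0 s t] by (simp add: P_def)
    next
      case 2
      then show ?thesis using that set_integral_Icc_split[OF g, of s 0 t] by (simp add: P_def)
    next
      case 3
      then show ?thesis using that set_integral_Icc_split[OF g, of s t 0] by (simp add: P_def)
    qed
  qed
  then show "indefinite_integral P g" using g by (auto simp: indefinite_integral_def)
qed

lemma bump_shift: "bump a (a + L) n t = bump 0 L n (t - a)"
  by (simp add: bump_def algebra_simps)

text \<open>The two bumps are translates of each other, so their difference has integral zero and
  its antiderivative is again compactly supported. These antiderivatives are the only test functions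
  required along a single line.\<close>

lemma test1_bump_antiderivative:
  "\<exists>\<alpha>. test1 \<alpha> \<and> (\<forall>t. (\<alpha> has_real_derivative bump a (a + L) n t - bump 0 L n t) (at t))"
proof -
  define \<eta> where "\<eta> t = bump a (a + L) n t - bump 0 L n t" for t
  have smooth1: "smooth1 \<eta>"
    using smooth1_add[of "bump a (a + L) n" "\<lambda>t. (-1) * bump 0 L n (1 * t + 0)"] test1_bump smooth1_affine[of "bump 0 L n" "-1" 1 0]
    unfolding \<eta>_def test1_def by simp
  have c: "continuous_on UNIV \<eta>" using smooth1 by (rule smooth1_continuous)
  obtain P where P: "indefinite_integral P \<eta>" using indefinite_integral_exists locally_integrable_continuous[OF c] by blast
  define R where "R = \<bar>a\<bar> + \<bar>L\<bar>"
  have z: "\<eta> t = 0" if "t \<le> -R \<or> t \<ge> R" for t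
  proof -
    have "t \<notin> {a<..<a + L}" "t \<notin> {0<..<L}" using that by (auto simp: R_def)
    then show ?thesis by (simp add: \<eta>_def bump_eq_0 del: greaterThanLessThan_iff)
  qed
  have i: "integrable lborel (\<lambda>t. bump c d n t)" for c d
    using integrable_locally_integrable_mult_test1[OF locally_integrable_const test1_bump, of c d n 1] by simp
  have tot: "(LINT r:{-R..R}|lborel. \<eta> r) = 0"
  proof -
    have "(LINT r:{-R..R}|lborel. \<eta> r) = (\<integral>r. \<eta> r \<partial>lborel)"
      unfolding set_lebesgue_integral_def using z
      by (intro Bochner_Integration.integral_cong) (auto split: split_indicator simp: not_le)
    also have "\<dots> = (\<integral>r. bump 0 L n (- a + r) \<partial>lborel) - (\<integral>r. bump 0 L n r \<partial>lborel)"
      unfolding \<eta>_def using i[of a "a+L"] i[of 0 L] by (simp add: bump_shift)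
    also have "\<dots> = 0" by (subst integral_lborel_shift) auto
    finally show ?thesis .
  qed
  define \<alpha> where "\<alpha> t = P t - P (-R)" for t
  have "(P has_real_derivative \<eta> t) (at t)" for t
  proof -
    have "((\<lambda>u. integral {t-1..u} \<eta>) has_real_derivative \<eta> t) (at t within {t-1..t+1})"
      using c by (intro integral_has_real_derivative) (auto intro: continuous_on_subset)
    then have "((\<lambda>u. P (t-1) + integral {t-1..u} \<eta>) has_real_derivative \<eta> t) (at t within {t-1..t+1})"
      by (auto intro!: derivative_eq_intros)
    then have "(P has_real_derivative \<eta> t) (at t within {t-1..t+1})"
    proof (rule has_field_derivative_transform_within[where d=1])
      fix u assume "u \<in> {t-1..t+1}" "dist u t < 1"
      then show "P (t-1) + integral {t-1..u} \<eta> = P u"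
        using indefinite_integralD[OF P, of "t-1" u] set_borel_integral_eq_integral(2)[OF locally_integrable_Icc[OF locally_integrable_continuous[OF c]], of "t-1" u]
        by simp
    qed auto
    then show ?thesis
      using at_within_interior[of t "{t-1..t+1}"] by simp
  qed
  then have d: "(\<alpha> has_real_derivative \<eta> t) (at t)" for t
    unfolding \<alpha>_def by (auto intro!: derivative_eq_intros)
  have "\<alpha> t = 0" if "t \<notin> {-R..R}" for t
  proof (cases "t < -R")
    case True
    have "(LINT r:{t..-R}|lborel. \<eta> r) = 0"
      unfolding set_lebesgue_integral_def using z by (intro integral_eq_zero_AE) (auto split: split_indicator)
    then show ?thesis using indefinite_integralD[OF P, of t "-R"] True by (simp add: \<alpha>_def)
  next
    case False
    then have "R < t" "-R \<le> R" using that by (auto simp: R_def)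
    have "(LINT r:{R..t}|lborel. \<eta> r) = 0"
      unfolding set_lebesgue_integral_def using z by (intro integral_eq_zero_AE) (auto split: split_indicator)
    then show ?thesis
      using indefinite_integralD[OF P, of "-R" R] indefinite_integralD[OF P, of R t] tot \<open>R < t\<close> \<open>-R \<le> R\<close> by (simp add: \<alpha>_def)
  qed
  then have "test1 \<alpha>" using smooth1_antiderivative[OF smooth1 d] by (auto simp: test1_def)
  then show ?thesis using d unfolding \<eta>_def by blast
qed

section \<open>Weak derivatives are derivatives along lines\<close>

text \<open>The averages over \<open>{x..x + 1 / real (Suc m)}\<close> do not depend on
  \<open>x\<close>, yet for almost every \<open>x\<close> they converge to \<open>u x\<close>; hence
  \<open>u\<close> equals their common limit.\<close>

lemma AE_const_if_translation_invariant:
  assumes u: "locally_integrable u"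
    and inv: "\<And>x m. (LINT r:{x..x + 1 / real (Suc m)}|lborel. u r) = (LINT r:{0..1 / real (Suc m)}|lborel. u r)"
  obtains c :: real where "AE t in lborel. u t = c"
proof -
  have int: "u integrable_on cbox a b" "integral (cbox a b) u = (LINT r:cbox a b|lborel. u r)" for a b
    using set_borel_integral_eq_integral[OF locally_integrable_cbox[OF u, of a b]] by auto
  obtain N where N: "negligible N" and *: "\<And>x e. \<lbrakk>x \<notin> N; 0 < e\<rbrakk> \<Longrightarrow>
     \<exists>d>0. \<forall>h. 0 < h \<and> h < d \<longrightarrow>
        norm(integral (cbox x (x + h *\<^sub>R One)) u /\<^sub>R h ^ DIM(real) - u x) < e"
    using integrable_ccontinuous_explicit[of u, OF int(1)] by blast
  define A where "A m = (LINT r:{0..1 / real (Suc m)}|lborel. u r) * real (Suc m)" for m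
  have lim: "A \<longlonglongrightarrow> u x" if x: "x \<notin> N" for x
  proof (rule LIMSEQ_I)
    fix e :: real assume "e > 0"
    then obtain d where d: "d > 0" "\<And>h. 0 < h \<Longrightarrow> h < d \<Longrightarrow>
        norm(integral (cbox x (x + h *\<^sub>R One)) u /\<^sub>R h ^ DIM(real) - u x) < e"
      using *[OF x] by blast
    obtain M where M: "inverse (real (Suc M)) < d" using reals_Archimedean[OF d(1)] by blast
    show "\<exists>M. \<forall>m\<ge>M. norm (A m - u x) < e"
    proof (intro exI allI impI)
      fix m assume "m \<ge> M"
      then have "1 / real (Suc m) \<le> inverse (real (Suc M))" by (simp add: field_simps)
      then have "1 / real (Suc m) < d" using M by linarith
      moreover have "integral (cbox x (x + (1 / real (Suc m)) *\<^sub>R One)) u /\<^sub>R (1 / real (Suc m)) ^ DIM(real) = A m"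
        using int(2)[of x "x + 1 / real (Suc m)"] inv[of x m] by (simp add: cbox_interval A_def mult.commute)
      ultimately show "norm (A m - u x) < e" using d(2)[of "1 / real (Suc m)"] by simp
    qed
  qed
  have "N \<noteq> UNIV" using N non_negligible_UNIV by blast
  then obtain x0 where x0: "x0 \<notin> N" by blast
  have "u x = u x0" if "x \<notin> N" for x
    using LIMSEQ_unique[OF lim[OF that] lim[OF x0]] .
  then have "negligible {x. u x \<noteq> u x0}" using N by (intro negligible_subset[OF N]) auto
  then have "AE x in lebesgue. u x = u x0"
    by (auto simp: negligible_iff_null_sets dest!: AE_not_in)
  then have "AE x in lborel. u x = u x0" using u by (subst (asm) AE_completion_iff) auto
  then show ?thesis by (rule that)
qed

text \<open>The du Bois-Reymond argument: with an indefinite integral \<open>P\<close> of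
  \<open>g\<close>, the function \<open>f - P\<close> pairs equally with a bump and with its
  translates, hence is a.e. constant. Restricting \<open>a\<close> to rationals and the length to
  \<open>1 / real (Suc m)\<close> leaves countably many conditions, so that they can hold
  simultaneously on almost every line.\<close>

lemma ac_deriv_if_weak:
  assumes f: "locally_integrable f" and g: "locally_integrable g"
    and w: "\<And>a m n. a \<in> \<rat> \<Longrightarrow> \<exists>\<alpha>. test1 \<alpha> \<and>
       (\<forall>t. (\<alpha> has_real_derivative bump a (a + 1 / real (Suc m)) n t - bump 0 (1 / real (Suc m)) n t) (at t)) \<and>
       (\<integral>t. (bump a (a + 1 / real (Suc m)) n t - bump 0 (1 / real (Suc m)) n t) * f t + \<alpha> t * g t \<partial>lborel) = 0"
  shows "ac_deriv f g"
proof -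
  obtain P where P: "indefinite_integral P g" using indefinite_integral_exists[OF g] .
  have cP: "continuous_on UNIV P" using P by (rule indefinite_integral_continuous)
  have lP: "locally_integrable P" using cP by (rule locally_integrable_continuous)
  define u where "u t = f t - P t" for t
  have u: "locally_integrable u" unfolding u_def using f lP by (rule locally_integrable_diff)
  have eq_n: "(\<integral>t. bump a (a + 1 / real (Suc m)) n t * u t \<partial>lborel) = (\<integral>t. bump 0 (1 / real (Suc m)) n t * u t \<partial>lborel)"
    if a: "a \<in> \<rat>" for a m n
  proof -
    let ?b1 = "bump a (a + 1 / real (Suc m)) n" and ?b2 = "bump 0 (1 / real (Suc m)) n"
    obtain \<alpha> where \<alpha>: "test1 \<alpha>" "\<And>t. (\<alpha> has_real_derivative ?b1 t - ?b2 t) (at t)"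
       and 0: "(\<integral>t. (?b1 t - ?b2 t) * f t + \<alpha> t * g t \<partial>lborel) = 0"
      using w[OF a, of m n] by blast
    have i: "integrable lborel (\<lambda>t. (?b1 t - ?b2 t) * h t)" if "locally_integrable h" for h
      unfolding left_diff_distrib
      using that by (intro Bochner_Integration.integrable_diff integrable_locally_integrable_mult_test1 test1_bump)
    have ig: "integrable lborel (\<lambda>t. \<alpha> t * g t)" using g \<alpha>(1) by (rule integrable_locally_integrable_mult_test1)
    have "continuous_on UNIV (\<lambda>t. ?b1 t - ?b2 t)"
      using test1_bump by (intro continuous_on_diff smooth1_continuous) (auto simp: test1_def)
    then have "indefinite_integral \<alpha> (\<lambda>t. ?b1 t - ?b2 t)" using \<alpha>(2) by (intro indefinite_integral_C1)
    from indefinite_integral_mult[OF this P]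
    have "ac_deriv (\<lambda>t. \<alpha> t * P t) (\<lambda>t. (?b1 t - ?b2 t) * P t + g t * \<alpha> t)"
      by (auto simp: ac_deriv_def)
    then have "(\<integral>t. (?b1 t - ?b2 t) * P t + g t * \<alpha> t \<partial>lborel) = 0"
    proof (rule ac_deriv_integral_zero)
      show "integrable lborel (\<lambda>t. \<alpha> t * P t)" using lP \<alpha>(1) by (rule integrable_locally_integrable_mult_test1)
      show "integrable lborel (\<lambda>t. (?b1 t - ?b2 t) * P t + g t * \<alpha> t)"
        using i[OF lP] ig by (simp add: mult.commute)
    qed
    then have "(\<integral>t. (?b1 t - ?b2 t) * P t \<partial>lborel) = (\<integral>t. (?b1 t - ?b2 t) * f t \<partial>lborel)"
      using 0 i[OF lP] i[OF f] ig by (simp add: mult.commute)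
    then have "(\<integral>t. (?b1 t - ?b2 t) * u t \<partial>lborel) = 0"
      unfolding u_def using i[OF lP] i[OF f] by (simp add: right_diff_distrib)
    then show ?thesis
      using integrable_locally_integrable_mult_test1[OF u test1_bump] by (simp add: left_diff_distrib)
  qed
  \<comment> \<open>Letting \<open>n\<close> grow turns the bumps into indicators of
    intervals.\<close>
  have eq_rat: "(LINT r:{a..a + 1 / real (Suc m)}|lborel. u r) = (LINT r:{0..1 / real (Suc m)}|lborel. u r)"
    if "a \<in> \<rat>" for a m
    using bump_integral_tendsto[OF u, of a "a + 1 / real (Suc m)"] bump_integral_tendsto[OF u, of 0 "1 / real (Suc m)"]
    unfolding eq_n[OF that] by (rule LIMSEQ_unique)
  obtain U where U: "indefinite_integral U u" using indefinite_integral_exists[OF u] .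
  \<comment> \<open>The integral over the moving interval is an increment of the continuous function
    \<open>U\<close>; density of the rationals extends the equality to every real
    \<open>a\<close>.\<close>
  have eq: "(LINT r:{a..a + 1 / real (Suc m)}|lborel. u r) = (LINT r:{0..1 / real (Suc m)}|lborel. u r)" for a m
  proof -
    let ?L = "1 / real (Suc m)"
    have inc: "(LINT r:{a..a + ?L}|lborel. u r) = U (a + ?L) - U a" for a
      by (rule indefinite_integralD[OF U]) simp
    have cU: "continuous_on UNIV U" using U by (rule indefinite_integral_continuous)
    have "continuous_on UNIV (\<lambda>a. U (a + ?L) - U a)"
      using cU by (intro continuous_intros continuous_on_compose2[OF cU]) auto
    then have "U (a + ?L) - U a = (LINT r:{0..?L}|lborel. u r)"
      using continuous_constant_on_closure[of \<rat> "\<lambda>a. U (a + ?L) - U a" "LINT r:{0..?L}|lborel. u r" a]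
        eq_rat[of _ m, unfolded inc] by (simp only: Rats_closure_real UNIV_I)
    then show ?thesis by (simp only: inc)
  qed
  obtain c where "AE t in lborel. u t = c"
    using AE_const_if_translation_invariant[OF u eq] by blast
  then have "AE t in lborel. f t = P t + c"
    by eventually_elim (simp add: u_def)
  moreover have "indefinite_integral (\<lambda>t. P t + c) g" using P by (simp add: indefinite_integral_def)
  ultimately show ?thesis unfolding ac_deriv_def by blast
qed

text \<open>Fubini on each of countably many squares exhausting the plane leaves only a null set of
  bad lines.\<close>

lemma locally_integrable_line_point:
  assumes f: "locally_integrable f"
  shows "AE y in lborel. locally_integrable (\<lambda>t. f (line_point k y t))"
proof -
  note [measurable] = locally_integrable_measurable[OF f]
  define C where "C n = cbox (line_point k (- real n) (- real n)) (line_point k (real n) (real n))" for n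
  have C: "line_point k y t \<in> C n \<longleftrightarrow> y \<in> {-real n..real n} \<and> t \<in> {-real n..real n}" for y t n
  proof -
    have "line_point k y t \<in> C n \<longleftrightarrow> (\<forall>i\<in>{k, other k}. - real n \<le> line_point k y t $ i \<and> line_point k y t $ i \<le> real n)"
      unfolding C_def mem_box_cart UNIV_other[of k, symmetric] by (auto simp: line_point_def)
    then show ?thesis by auto
  qed
  have "AE y in lborel. \<forall>n. integrable lborel (\<lambda>t. indicator (C n) (line_point k y t) *\<^sub>R f (line_point k y t))"
    using locally_integrable_cbox[OF f] unfolding AE_all_countable C_def set_integrable_def
    by (intro allI Fubini_line_point(1))
  then show ?thesis
  proof eventually_elim
    case (elim y)
    show ?case unfolding locally_integrable_def
    proof (intro conjI allI)
      show "(\<lambda>t. f (line_point k y t)) \<in> borel_measurable borel" by measurable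
      fix a b :: real
      obtain n where n: "real n \<ge> max \<bar>y\<bar> (max \<bar>a\<bar> \<bar>b\<bar>)" using real_arch_simple by blast
      then have "y \<in> {-real n..real n}" by auto
      then have "(\<lambda>t. indicator (C n) (line_point k y t) *\<^sub>R f (line_point k y t)) =
          (\<lambda>t. indicator {-real n..real n} t *\<^sub>R f (line_point k y t))"
        by (auto simp: C indicator_def)
      then have "set_integrable lborel {-real n..real n} (\<lambda>t. f (line_point k y t))"
        using elim[rule_format, of n] unfolding set_integrable_def by simp
      then show "set_integrable lborel (cbox a b) (\<lambda>t. f (line_point k y t))"
        by (rule set_integrable_subset) (use n in \<open>auto simp: cbox_interval\<close>)
    qed
  qed
qed

text \<open>Testing with \<alpha> along the lines and \<beta> across them separates the variables:
  the weak identity on a line, as a function of the line, is orthogonal to every \<beta> and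
  therefore vanishes a.e. A fixed countable set of \<alpha> then makes the exceptional set of lines
  independent of \<alpha>.\<close>

lemma line_deriv_if_weak:
  assumes f: "locally_integrable f" and g: "locally_integrable g"
    and w: "\<And>\<alpha> \<alpha>' \<beta>. test1 \<alpha> \<Longrightarrow> test1 \<beta> \<Longrightarrow> (\<And>t. (\<alpha> has_real_derivative \<alpha>' t) (at t)) \<Longrightarrow>
      (\<integral>x. \<alpha>' (x $ k) * \<beta> (x $ other k) * f x \<partial>lborel) = - (\<integral>x. \<alpha> (x $ k) * \<beta> (x $ other k) * g x \<partial>lborel)"
  shows "line_deriv k f g"
proof -
  note [measurable] = locally_integrable_measurable[OF f] locally_integrable_measurable[OF g]
  have line: "AE y in lborel. (\<integral>t. \<alpha>' t * f (line_point k y t) + \<alpha> t * g (line_point k y t) \<partial>lborel) = 0"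
    if \<alpha>: "test1 \<alpha>" and \<alpha>': "test1 \<alpha>'" and d: "\<And>t. (\<alpha> has_real_derivative \<alpha>' t) (at t)" for \<alpha> \<alpha>'
  proof (rule fundamental_lemma_1)
    note [measurable] = test1_measurable[OF \<alpha>] test1_measurable[OF \<alpha>']
    let ?h = "\<lambda>x. \<alpha>' (x $ k) * f x + \<alpha> (x $ k) * g x"
    let ?W = "\<lambda>y. \<integral>t. \<alpha>' t * f (line_point k y t) + \<alpha> t * g (line_point k y t) \<partial>lborel"
    have fub: "integrable lborel (\<lambda>y. \<beta> y * ?W y)"
      "(\<integral>y. \<beta> y * ?W y \<partial>lborel) = (\<integral>x. \<beta> (x $ other k) * ?h x \<partial>lborel)"
      if "integrable lborel (\<lambda>x. \<beta> (x $ other k) * ?h x)" for \<beta>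
      using Fubini_line_point(2,3)[OF that, of k] by simp_all
    show "locally_integrable ?W" unfolding locally_integrable_def
    proof (intro conjI allI)
      have "(\<lambda>(y, t). \<alpha>' t * f (line_point k y t) + \<alpha> t * g (line_point k y t)) \<in> borel_measurable (borel \<Otimes>\<^sub>M lborel)"
        using measurable_compose[OF measurable_line_point[of k], of f borel] measurable_compose[OF measurable_line_point[of k], of g borel]
        unfolding borel_prod[symmetric] case_prod_unfold by measurable
      then show "?W \<in> borel_measurable borel"
        by (rule lborel.borel_measurable_lebesgue_integral)
      fix a b :: real
      obtain A where A: "\<And>t. \<bar>\<alpha> t\<bar> \<le> A" using test1_bounded[OF \<alpha>] by blast
      obtain A' where A': "\<And>t. \<bar>\<alpha>' t\<bar> \<le> A'" using test1_bounded[OF \<alpha>'] by blast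
      obtain R where R: "\<And>t. t \<notin> {-R..R} \<Longrightarrow> \<alpha> t = 0" using \<alpha> by (auto simp: test1_def)
      obtain R' where R': "\<And>t. t \<notin> {-R'..R'} \<Longrightarrow> \<alpha>' t = 0" using \<alpha>' by (auto simp: test1_def)
      have 1: "integrable lborel (\<lambda>x. (indicator {a..b} (x $ other k) * \<gamma> (x $ k)) * v x)"
        if v: "locally_integrable v" and m: "\<gamma> \<in> borel_measurable borel" and G: "\<And>t. \<bar>\<gamma> t\<bar> \<le> G"
          and S: "\<And>t. t \<notin> {-S..S} \<Longrightarrow> \<gamma> t = 0" for v and \<gamma> :: "real \<Rightarrow> real" and G S
      proof (rule integrable_locally_integrable_mult[OF v])
        show "(\<lambda>x. indicator {a..b} (x $ other k) * \<gamma> (x $ k)) \<in> borel_measurable borel"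
          using m by measurable
        show "\<bar>indicator {a..b} (x $ other k) * \<gamma> (x $ k)\<bar> \<le> G" for x
          using G[of "x $ k"] G[of 0] by (auto split: split_indicator)
        fix x assume x: "x \<notin> cbox (line_point k a (-S)) (line_point k b S)"
        have "x \<in> cbox (line_point k a (-S)) (line_point k b S) \<longleftrightarrow>
          (\<forall>i\<in>{k, other k}. line_point k a (-S) $ i \<le> x $ i \<and> x $ i \<le> line_point k b S $ i)"
          unfolding mem_box_cart UNIV_other[of k, symmetric] by auto
        then have "x $ k \<notin> {-S..S} \<or> x $ other k \<notin> {a..b}" using x by auto
        then show "indicator {a..b} (x $ other k) * \<gamma> (x $ k) = 0" using S by auto
      qed
      have "integrable lborel (\<lambda>x. (indicator {a..b} (x $ other k) * \<alpha>' (x $ k)) * f x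
           + (indicator {a..b} (x $ other k) * \<alpha> (x $ k)) * g x)"
        by (intro Bochner_Integration.integrable_add 1[OF f _ A' R'] 1[OF g _ A R]) auto
      then have "integrable lborel (\<lambda>x. indicator {a..b} (x $ other k) * ?h x)"
        by (simp add: distrib_left mult.assoc)
      from fub(1)[OF this] show "set_integrable lborel (cbox a b) ?W"
        by (simp add: set_integrable_def cbox_interval)
    qed
    fix \<beta> assume \<beta>: "test1 \<beta>"
    have i: "integrable lborel (\<lambda>x. \<alpha>' (x $ k) * \<beta> (x $ other k) * f x)"
      "integrable lborel (\<lambda>x. \<alpha> (x $ k) * \<beta> (x $ other k) * g x)"
      using integrable_locally_integrable_mult_tensor f g \<alpha> \<alpha>' \<beta> by auto
    have eq: "(\<lambda>x. \<beta> (x $ other k) * ?h x) = (\<lambda>x. \<alpha>' (x $ k) * \<beta> (x $ other k) * f x + \<alpha> (x $ k) * \<beta> (x $ other k) * g x)"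
      by (simp add: fun_eq_iff algebra_simps)
    have "integrable lborel (\<lambda>x. \<beta> (x $ other k) * ?h x)" unfolding eq using i by simp
    from fub(2)[OF this] show "(\<integral>y. \<beta> y * ?W y \<partial>lborel) = 0"
      unfolding eq using i w[OF \<alpha> \<beta> d] by simp
  qed
  obtain A where A: "\<And>a m n. test1 (A a m n)"
    "\<And>a m n t. (A a m n has_real_derivative
        bump a (a + 1 / real (Suc m)) n t - bump 0 (1 / real (Suc m)) n t) (at t)"
  proof -
    have "\<exists>A. \<forall>a m n. test1 (A a m n) \<and> (\<forall>t. (A a m n has_real_derivative
        bump a (a + 1 / real (Suc m)) n t - bump 0 (1 / real (Suc m)) n t) (at t))"
      using test1_bump_antiderivative by (intro choice allI)
    then show ?thesis using that by blast
  qed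
  \<comment> \<open>Countably many triples \<open>a\<close>, \<open>m\<close>, \<open>n\<close>: the
    exceptional null sets of lines may be united.\<close>
  have "AE y in lborel. \<forall>a\<in>\<rat>. \<forall>m n. (\<integral>t. (bump a (a + 1 / real (Suc m)) n t - bump 0 (1 / real (Suc m)) n t) * f (line_point k y t)
       + A a m n t * g (line_point k y t) \<partial>lborel) = 0"
  proof (subst AE_ball_countable[OF countable_rat], intro ballI, unfold AE_all_countable, intro allI)
    fix a :: real and m n
    obtain \<alpha>' where \<alpha>': "test1 \<alpha>'" "\<And>t. (A a m n has_real_derivative \<alpha>' t) (at t)"
      using test1_derivE[OF A(1)] by blast
    then have "\<alpha>' = (\<lambda>t. bump a (a + 1 / real (Suc m)) n t - bump 0 (1 / real (Suc m)) n t)"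
      using A(2) DERIV_unique by blast
    then show "AE y in lborel. (\<integral>t. (bump a (a + 1 / real (Suc m)) n t - bump 0 (1 / real (Suc m)) n t) * f (line_point k y t)
       + A a m n t * g (line_point k y t) \<partial>lborel) = 0"
      using line[OF A(1) \<alpha>'] by simp
  qed
  then have "AE y in lborel. ac_deriv (\<lambda>t. f (line_point k y t)) (\<lambda>t. g (line_point k y t))"
    using locally_integrable_line_point[OF f, of k] locally_integrable_line_point[OF g, of k]
  proof eventually_elim
    case (elim y)
    show ?case
      by (rule ac_deriv_if_weak[OF elim(2,3)]) (use elim(1) A in blast)
  qed
  then show ?thesis unfolding line_deriv_def by (intro conjI) measurable
qed

section \<open>Continuity of translations in the square-integrable functions\<close>

definition sq_integrable :: "('a::euclidean_space \<Rightarrow> real) \<Rightarrow> bool" where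
  "sq_integrable f \<longleftrightarrow> f \<in> borel_measurable borel \<and> integrable lborel (\<lambda>x. (f x)\<^sup>2)"

lemma sq_integrable_measurable [measurable_dest]: "sq_integrable f \<Longrightarrow> f \<in> borel_measurable borel"
  by (simp add: sq_integrable_def)

lemma sq_integrable_bound:
  assumes "sq_integrable g" "f \<in> borel_measurable borel" "AE x in lborel. \<bar>f x\<bar> \<le> \<bar>g x\<bar>"
  shows "sq_integrable f"
  unfolding sq_integrable_def
proof (intro conjI assms(2))
  show "integrable lborel (\<lambda>x. (f x)\<^sup>2)"
  proof (rule Bochner_Integration.integrable_bound)
    show "integrable lborel (\<lambda>x. (g x)\<^sup>2)" using assms(1) by (simp add: sq_integrable_def)
    show "AE x in lborel. norm ((f x)\<^sup>2) \<le> norm ((g x)\<^sup>2)"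
      using assms(3) by eventually_elim (simp add: abs_le_square_iff)
  qed (use assms(2) in measurable)
qed

lemma abs_mult_le_weighted:
  fixes a b c :: real
  assumes "c > 0"
  shows "\<bar>a * b\<bar> \<le> c * a\<^sup>2 + b\<^sup>2 / c"
proof -
  have "0 \<le> (c * \<bar>a\<bar> - \<bar>b\<bar>)\<^sup>2 / c" using assms by simp
  then have "2 * \<bar>a * b\<bar> \<le> c * a\<^sup>2 + b\<^sup>2 / c"
    using assms by (simp add: field_simps power2_eq_square abs_mult)
  then show ?thesis by simp
qed

lemma sq_integrable_mult_integrable:
  assumes "sq_integrable f" "sq_integrable g"
  shows "integrable lborel (\<lambda>x. f x * g x)"
proof (rule Bochner_Integration.integrable_bound)
  show "integrable lborel (\<lambda>x. (f x)\<^sup>2 + (g x)\<^sup>2)" using assms by (simp add: sq_integrable_def)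
  show "AE x in lborel. norm (f x * g x) \<le> norm ((f x)\<^sup>2 + (g x)\<^sup>2)"
    using abs_mult_le_weighted[of 1] by simp
qed (use sq_integrable_measurable[OF assms(1)] sq_integrable_measurable[OF assms(2)] in measurable)

text \<open>Young's inequality in integrated form; the free weight \<open>c\<close> lets a small
  norm of \<open>g\<close> compensate a large norm of \<open>f\<close>.\<close>

lemma sq_integrable_mult_integral_bound:
  assumes "sq_integrable f" "sq_integrable g" "c > 0"
  shows "\<bar>\<integral>x. f x * g x \<partial>lborel\<bar> \<le> c * (\<integral>x. (f x)\<^sup>2 \<partial>lborel) + (\<integral>x. (g x)\<^sup>2 \<partial>lborel) / c"
proof -
  have "\<bar>\<integral>x. f x * g x \<partial>lborel\<bar> \<le> (\<integral>x. \<bar>f x * g x\<bar> \<partial>lborel)"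
    by (rule integral_abs_bound)
  also have "\<dots> \<le> (\<integral>x. c * (f x)\<^sup>2 + (g x)\<^sup>2 / c \<partial>lborel)"
    using assms sq_integrable_mult_integrable[OF assms(1,2)]
    by (intro integral_mono abs_mult_le_weighted) (auto simp: sq_integrable_def)
  finally show ?thesis using assms by (simp add: sq_integrable_def)
qed

lemma sq_integrable_add: "sq_integrable f \<Longrightarrow> sq_integrable g \<Longrightarrow> sq_integrable (\<lambda>x. f x + g x)"
  using sq_integrable_mult_integrable[of f g] by (auto simp: sq_integrable_def power2_sum mult.assoc)

lemma sq_integrable_cmult: "sq_integrable f \<Longrightarrow> sq_integrable (\<lambda>x. c * f x)"
  by (auto simp: sq_integrable_def power_mult_distrib)

lemma sq_integrable_diff: "sq_integrable f \<Longrightarrow> sq_integrable g \<Longrightarrow> sq_integrable (\<lambda>x. f x - g x)"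
  using sq_integrable_add[of f "\<lambda>x. -1 * g x"] sq_integrable_cmult[of g "-1"] by simp

lemma sq_integrable_shift: "sq_integrable f \<Longrightarrow> sq_integrable (\<lambda>x. f (v + x))"
  using integrable_lborel_shift[of "\<lambda>x. (f x)\<^sup>2" v] by (auto simp: sq_integrable_def)

lemma sq_integrable_indicator:
  assumes "S \<in> sets borel" "emeasure lborel S < \<infinity>"
  shows "sq_integrable (indicator S :: 'a::euclidean_space \<Rightarrow> real)"
proof -
  have "(\<lambda>x. (indicator S x :: real)\<^sup>2) = indicator S" by (auto split: split_indicator)
  then show ?thesis using assms unfolding sq_integrable_def by simp
qed

lemma sq_integrable_locally_integrable: "sq_integrable f \<Longrightarrow> locally_integrable f"
proof -
  assume f: "sq_integrable f"
  have "set_integrable lborel (cbox a b) f" for a b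
  proof -
    have "sq_integrable (indicator (cbox a b) :: 'a \<Rightarrow> real)"
      by (rule sq_integrable_indicator) (auto simp: less_top emeasure_lborel_cbox_eq)
    from sq_integrable_mult_integrable[OF this f] show ?thesis by (simp add: set_integrable_def)
  qed
  then show "locally_integrable f" using f by (auto simp: locally_integrable_def sq_integrable_def)
qed

text \<open>Weak continuity of translation, with the condition placed on \<open>w\<close> and
  \<open>u\<close> ranging over all of \<open>L\<^sup>2\<close>. As a property of \<open>w\<close>
  it is preserved by linear combinations and dominated limits, so it can be built up from
  boxes.\<close>

definition translation_continuous :: "('a::euclidean_space \<Rightarrow> real) \<Rightarrow> bool" where
  "translation_continuous w \<longleftrightarrow> (\<forall>u. sq_integrable u \<longrightarrow> isCont (\<lambda>v. \<integral>x. u (v + x) * w x \<partial>lborel) 0)"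

lemma translation_continuous_add:
  assumes "sq_integrable w" "sq_integrable z" "translation_continuous w" "translation_continuous z"
  shows "translation_continuous (\<lambda>x. w x + z x)"
  unfolding translation_continuous_def
proof (intro allI impI)
  fix u :: "'a \<Rightarrow> real" assume u: "sq_integrable u"
  have "(\<lambda>v. \<integral>x. u (v + x) * (w x + z x) \<partial>lborel) =
      (\<lambda>v. (\<integral>x. u (v + x) * w x \<partial>lborel) + (\<integral>x. u (v + x) * z x \<partial>lborel))"
    using sq_integrable_mult_integrable[OF sq_integrable_shift[OF u]] assms by (simp add: distrib_left)
  then show "isCont (\<lambda>v. \<integral>x. u (v + x) * (w x + z x) \<partial>lborel) 0"
    using assms u by (auto simp: translation_continuous_def)
qed

lemma translation_continuous_cmult:
  assumes "translation_continuous w"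
  shows "translation_continuous (\<lambda>x. c * w x)"
  unfolding translation_continuous_def
proof (intro allI impI)
  fix u :: "'a \<Rightarrow> real" assume u: "sq_integrable u"
  have "(\<lambda>v. \<integral>x. u (v + x) * (c * w x) \<partial>lborel) = (\<lambda>v. c * (\<integral>x. u (v + x) * w x \<partial>lborel))"
    by (simp add: mult.left_commute)
  then show "isCont (\<lambda>v. \<integral>x. u (v + x) * (c * w x) \<partial>lborel) 0"
    using assms u by (auto simp: translation_continuous_def)
qed

lemma translation_continuous_diff:
  assumes "sq_integrable w" "sq_integrable z" "translation_continuous w" "translation_continuous z"
  shows "translation_continuous (\<lambda>x. w x - z x)"
  using translation_continuous_add[of w "\<lambda>x. -1 * z x"] translation_continuous_cmult[of z "-1"] sq_integrable_cmult[of z "-1"] assms by simp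

text \<open>The \<open>wm m\<close> converge to \<open>w\<close> in \<open>L\<^sup>2\<close> by
  dominated convergence, and the norm of a translate of \<open>u\<close> does not depend on the
  translation. Hence the pairings converge uniformly in \<open>v\<close>, and continuity survives a
  uniform limit.\<close>

lemma translation_continuous_limit:
  assumes w: "sq_integrable w" and wm: "\<And>m. wm m \<in> borel_measurable borel" "\<And>m x. \<bar>wm m x\<bar> \<le> \<bar>w x\<bar>"
    and lim: "\<And>x. (\<lambda>m. wm m x) \<longlonglongrightarrow> w x" and tc: "\<And>m. translation_continuous (wm m)"
  shows "translation_continuous w"
  unfolding translation_continuous_def
proof (intro allI impI)
  fix u :: "'a \<Rightarrow> real" assume u: "sq_integrable u"
  have lm: "sq_integrable (wm m)" for m using w wm by (intro sq_integrable_bound[OF w]) auto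
  have "(\<lambda>m. \<integral>x. (w x - wm m x)\<^sup>2 \<partial>lborel) \<longlonglongrightarrow> (\<integral>x. 0 \<partial>(lborel :: 'a measure))"
  proof (rule integral_dominated_convergence)
    show "integrable lborel (\<lambda>x. 4 * (w x)\<^sup>2)" using w by (simp add: sq_integrable_def)
    show "AE x in lborel. (\<lambda>m. (w x - wm m x)\<^sup>2) \<longlonglongrightarrow> 0"
    proof (rule AE_I2)
      fix x
      have "(\<lambda>m. (w x - wm m x)\<^sup>2) \<longlonglongrightarrow> (w x - w x)\<^sup>2" by (intro tendsto_intros lim)
      then show "(\<lambda>m. (w x - wm m x)\<^sup>2) \<longlonglongrightarrow> 0" by simp
    qed
    show "AE x in lborel. norm ((w x - wm m x)\<^sup>2) \<le> 4 * (w x)\<^sup>2" for m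
    proof (rule AE_I2)
      fix x
      have "\<bar>w x - wm m x\<bar> \<le> \<bar>2 * w x\<bar>" using wm(2)[of m x] by linarith
      then show "norm ((w x - wm m x)\<^sup>2) \<le> 4 * (w x)\<^sup>2"
        by (simp add: abs_le_square_iff power_mult_distrib)
    qed
  qed (use sq_integrable_measurable[OF w] wm in measurable)
  then have sq: "(\<lambda>m. \<integral>x. (w x - wm m x)\<^sup>2 \<partial>lborel) \<longlonglongrightarrow> 0" by simp
  define K where "K = (\<integral>x. (u x)\<^sup>2 \<partial>lborel)"
  have K: "K \<ge> 0" unfolding K_def by simp
  show "isCont (\<lambda>v. \<integral>x. u (v + x) * w x \<partial>lborel) 0"
    unfolding continuous_at_eps_delta
  proof (intro allI impI)
    fix e :: real assume e: "e > 0"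
    \<comment> \<open>With this weight each of the two terms of
      \<open>sq_integrable_mult_integral_bound\<close> is at most \<open>e / 6\<close>;
      \<open>K + 1\<close> avoids division by zero.\<close>
    define c where "c = e / (6 * (K + 1))"
    have c: "c > 0" "c * K \<le> e / 6" using e K by (auto simp: c_def field_simps)
    have "c * (e / 6) > 0" using c e by simp
    then obtain m where m: "(\<integral>x. (w x - wm m x)\<^sup>2 \<partial>lborel) < c * (e / 6)"
      using order_tendstoD(2)[OF sq] by (meson eventually_sequentially order_refl)
    have "(\<integral>x. (w x - wm m x)\<^sup>2 \<partial>lborel) / c \<le> e / 6"
      using m c(1) by (simp add: field_simps)
    have small: "\<bar>(\<integral>x. u (v + x) * w x \<partial>lborel) - (\<integral>x. u (v + x) * wm m x \<partial>lborel)\<bar> \<le> e / 3" for v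
    proof -
      have "(\<integral>x. u (v + x) * w x \<partial>lborel) - (\<integral>x. u (v + x) * wm m x \<partial>lborel) =
          (\<integral>x. u (v + x) * (w x - wm m x) \<partial>lborel)"
        using sq_integrable_mult_integrable[OF sq_integrable_shift[OF u] w] sq_integrable_mult_integrable[OF sq_integrable_shift[OF u] lm]
        by (simp add: right_diff_distrib)
      also have "\<bar>\<dots>\<bar> \<le> c * (\<integral>x. (u (v + x))\<^sup>2 \<partial>lborel) + (\<integral>x. (w x - wm m x)\<^sup>2 \<partial>lborel) / c"
        by (intro sq_integrable_mult_integral_bound sq_integrable_shift sq_integrable_diff u w lm c)
      also have "(\<integral>x. (u (v + x))\<^sup>2 \<partial>lborel) = K"
        unfolding K_def using integral_lborel_shift[of "\<lambda>x. (u x)\<^sup>2" v] sq_integrable_measurable[OF u] by simp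
      finally show ?thesis
        using c(2) \<open>(\<integral>x. (w x - wm m x)\<^sup>2 \<partial>lborel) / c \<le> e / 6\<close> by linarith
    qed
    obtain d where d: "d > 0" "\<And>v. dist v 0 < d \<Longrightarrow>
        dist (\<integral>x. u (v + x) * wm m x \<partial>lborel) (\<integral>x. u (0 + x) * wm m x \<partial>lborel) < e / 3"
    proof -
      have "isCont (\<lambda>v. \<integral>x. u (v + x) * wm m x \<partial>lborel) 0" using tc[of m] u by (simp add: translation_continuous_def)
      then have "\<exists>d>0. \<forall>v. dist v 0 < d \<longrightarrow>
          dist (\<integral>x. u (v + x) * wm m x \<partial>lborel) (\<integral>x. u (0 + x) * wm m x \<partial>lborel) < e / 3"
        unfolding continuous_at_eps_delta by (rule allE[where x="e/3"]) (use e in simp)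
      then show ?thesis using that by blast
    qed
    show "\<exists>d>0. \<forall>v. dist v 0 < d \<longrightarrow>
       dist (\<integral>x. u (v + x) * w x \<partial>lborel) (\<integral>x. u (0 + x) * w x \<partial>lborel) < e"
    proof (intro exI[of _ d] conjI d(1) allI impI)
      fix v :: 'a assume "dist v 0 < d"
      from d(2)[OF this] small[of v] small[of 0]
      show "dist (\<integral>x. u (v + x) * w x \<partial>lborel) (\<integral>x. u (0 + x) * w x \<partial>lborel) < e"
        unfolding dist_real_def by linarith
    qed
  qed
qed

text \<open>A change of variables moves the translation from \<open>u\<close> to the box. Away from
  the boundary, a null set, the indicator of the moving box is eventually constant, and one larger
  box dominates all of them.\<close>

lemma translation_continuous_box: "translation_continuous (indicator (box a b))"
  unfolding translation_continuous_def
proof (intro allI impI)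
  fix u :: "'a \<Rightarrow> real" assume u: "sq_integrable u"
  note [measurable] = sq_integrable_measurable[OF u]
  show "isCont (\<lambda>v. \<integral>x. u (v + x) * indicator (box a b) x \<partial>lborel) 0"
    unfolding continuous_at_sequentially comp_def
  proof (intro allI impI)
    fix v :: "nat \<Rightarrow> 'a" assume v: "v \<longlonglongrightarrow> 0"
    have sh: "(\<integral>x. u (z + x) * indicator (box a b) x \<partial>lborel) = (\<integral>x. indicator (box a b) (x - z) * u x \<partial>lborel)" for z
      using integral_lborel_shift[of "\<lambda>x. indicator (box a b) (x - z) * u x" z] by (simp add: mult.commute)
    obtain B where B: "\<And>n. norm (v n) \<le> B"
      using convergent_imp_Bseq[of v] v unfolding convergent_def Bseq_def by blast
    define C where "C = cbox (a - B *\<^sub>R One) (b + B *\<^sub>R One)"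
    have C: "x \<in> C" if "x - v n \<in> box a b" for x n
    proof -
      have "\<bar>v n \<bullet> i\<bar> \<le> B" if "i \<in> Basis" for i
        using Basis_le_norm[OF that, of "v n"] B[of n] by linarith
      then show ?thesis using that unfolding C_def mem_box
        by (fastforce simp: inner_simps)
    qed
    have "AE x in lebesgue. x \<notin> cbox a b - box a b"
      using negligible_frontier_interval[of a b] by (auto simp: negligible_iff_null_sets dest!: AE_not_in)
    then have bd: "AE x in lborel. x \<notin> cbox a b - box a b"
      by (subst (asm) AE_completion_iff) auto
    have "(\<lambda>n. \<integral>x. indicator (box a b) (x - v n) * u x \<partial>lborel) \<longlonglongrightarrow> (\<integral>x. indicator (box a b) x * u x \<partial>lborel)"
    proof (rule integral_dominated_convergence)
      show "integrable lborel (\<lambda>x. indicator C x *\<^sub>R \<bar>u x\<bar>)"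
        using locally_integrable_cbox[OF locally_integrable_abs[OF sq_integrable_locally_integrable[OF u]]] unfolding C_def set_integrable_def by blast
      show "AE x in lborel. norm (indicator (box a b) (x - v n) * u x) \<le> indicator C x *\<^sub>R \<bar>u x\<bar>" for n
        using C[of _ n] by (intro AE_I2) (auto split: split_indicator)
      show "AE x in lborel. (\<lambda>n. indicator (box a b) (x - v n) * u x) \<longlonglongrightarrow> indicator (box a b) x * u x"
        using bd
      proof eventually_elim
        case (elim x)
        have vx: "(\<lambda>n. x - v n) \<longlonglongrightarrow> x" using tendsto_diff[OF tendsto_const v, of x] by simp
        have "eventually (\<lambda>n. indicator (box a b) (x - v n) = (indicator (box a b) x :: real)) sequentially"
        proof (cases "x \<in> box a b")
          case True
          from topological_tendstoD[OF vx open_box True]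
          show ?thesis by eventually_elim (use True in simp)
        next
          case False
          then have "x \<in> - cbox a b" using elim by auto
          from topological_tendstoD[OF vx _ this]
          have "eventually (\<lambda>n. x - v n \<in> - cbox a b) sequentially" by (simp add: open_Compl closed_cbox)
          then show ?thesis
            by eventually_elim (use False box_subset_cbox[of a b] in \<open>auto split: split_indicator\<close>)
        qed
        then have "(\<lambda>n. indicator (box a b) (x - v n)) \<longlonglongrightarrow> (indicator (box a b) x :: real)"
          by (rule tendsto_eventually)
        then show ?case by (intro tendsto_mult tendsto_const)
      qed
    qed measurable
    then show "(\<lambda>n. \<integral>x. u (v n + x) * indicator (box a b) x \<partial>lborel) \<longlonglongrightarrow> (\<integral>x. u (0 + x) * indicator (box a b) x \<partial>lborel)"
      unfolding sh by simp
  qed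
qed

lemma sq_integrable_indicator_bounded:
  assumes "A \<in> sets borel"
  shows "sq_integrable (indicator (A \<inter> box a b) :: 'a::euclidean_space \<Rightarrow> real)"
proof (rule sq_integrable_bound)
  show "sq_integrable (indicator (box a b) :: 'a \<Rightarrow> real)" by (rule sq_integrable_indicator) (auto simp: less_top emeasure_lborel_box_eq)
  show "indicat_real (A \<inter> box a b) \<in> borel_measurable borel" using assms by measurable
qed (auto split: split_indicator)

text \<open>Dynkin's argument over the intersection-stable system of boxes. Intersecting with a
  fixed box keeps complements and countable unions square integrable.\<close>

lemma translation_continuous_indicator_bounded:
  assumes "A \<in> sets (borel :: 'a::euclidean_space measure)"
  shows "translation_continuous (indicator (A \<inter> box c d) :: 'a \<Rightarrow> real)"
proof -
  let ?E = "range (\<lambda>(a, b). box a b :: 'a set)"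
  have "Int_stable ?E" by (auto simp: Int_stable_def box_Int_box)
  moreover have "?E \<subseteq> Pow UNIV" by simp
  moreover have sets: "sigma_sets UNIV ?E = sets borel" by (simp add: borel_eq_box)
  then have "A \<in> sigma_sets UNIV ?E" using assms by simp
  ultimately show ?thesis
  proof (induction rule: sigma_sets_induct_disjoint)
    case (basic A)
    then obtain a b where "A = box a b" by auto
    then show ?case using translation_continuous_box by (auto simp: box_Int_box)
  next
    case empty
    then show ?case by (simp add: translation_continuous_def)
  next
    case (compl A)
    have eq: "indicator ((UNIV - A) \<inter> box c d) = (\<lambda>x. indicator (box c d) x - indicator (A \<inter> box c d) x :: real)"
      by (auto split: split_indicator)
    show ?case unfolding eq
      using compl sets sq_integrable_indicator_bounded[of UNIV c d] sq_integrable_indicator_bounded[of A c d] translation_continuous_box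
      by (intro translation_continuous_diff) auto
  next
    case (union A)
    have A: "A i \<in> sets borel" for i using union(2) sets by auto
    define S where "S m x = (\<Sum>i<m. indicator (A i \<inter> box c d) x :: real)" for m :: nat and x
    have S: "S m = indicator ((\<Union>i<m. A i) \<inter> box c d)" for m
    proof
      fix x
      have "S m x = indicator (box c d) x * (\<Sum>i<m. indicator (A i) x)"
        unfolding S_def sum_distrib_left by (intro sum.cong) (auto split: split_indicator)
      also have "(\<Sum>i<m. indicator (A i) x) = (indicator (\<Union>i<m. A i) x :: real)"
        using union(1) by (subst indicator_UN_disjoint) (auto simp: disjoint_family_on_def)
      finally show "S m x = indicator ((\<Union>i<m. A i) \<inter> box c d) x" by (auto split: split_indicator)
    qed
    have l: "sq_integrable (S m)" for m unfolding S using A by (intro sq_integrable_indicator_bounded) auto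
    have tc: "translation_continuous (S m)" for m
    proof (induction m)
      case 0
      then show ?case by (simp add: S_def translation_continuous_def)
    next
      case (Suc m)
      have "S (Suc m) = (\<lambda>x. S m x + indicator (A m \<inter> box c d) x)" by (simp add: S_def fun_eq_iff)
      then show ?case
        using translation_continuous_add[OF l[of m] sq_integrable_indicator_bounded[OF A[of m]] Suc union(3)[of m]] by simp
    qed
    show ?case
    proof (rule translation_continuous_limit[where wm=S])
      show "sq_integrable (indicat_real (\<Union> (range A) \<inter> box c d))" using A by (intro sq_integrable_indicator_bounded) auto
      show "S m \<in> borel_measurable borel" for m using l by (rule sq_integrable_measurable)
      show "\<bar>S m x\<bar> \<le> \<bar>indicat_real (\<Union> (range A) \<inter> box c d) x\<bar>" for m x
        unfolding S by (auto split: split_indicator)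
      show "(\<lambda>m. S m x) \<longlonglongrightarrow> indicat_real (\<Union> (range A) \<inter> box c d) x" for x
      proof -
        have "(\<lambda>m. indicator (\<Union>i<m. A i \<inter> box c d) x :: real) \<longlonglongrightarrow> indicator (\<Union>i. A i \<inter> box c d) x"
          by (rule LIMSEQ_indicator_UN)
        moreover have "(\<Union>i<m. A i \<inter> box c d) = (\<Union>i<m. A i) \<inter> box c d" for m by auto
        moreover have "(\<Union>i. A i \<inter> box c d) = \<Union> (range A) \<inter> box c d" by auto
        ultimately show ?thesis unfolding S by simp
      qed
    qed (rule tc)
  qed
qed

lemma translation_continuous_sq_integrable_nonneg:
  assumes "w \<in> borel_measurable borel" "\<And>x. 0 \<le> w x" "sq_integrable w"
  shows "translation_continuous w"
  using assms
proof (induction rule: borel_measurable_induct_real)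
  case (set A)
  \<comment> \<open>Truncation by growing cubes reduces the indicator to bounded sets.\<close>
  define wm where "wm m = (indicator (A \<inter> box (- (real m *\<^sub>R One)) (real m *\<^sub>R One)) :: 'a \<Rightarrow> real)" for m :: nat
  show ?case
  proof (rule translation_continuous_limit[where wm=wm])
    show "(\<lambda>m. wm m x) \<longlonglongrightarrow> indicator A x" for x
    proof -
      obtain M where M: "\<And>i. i \<in> Basis \<Longrightarrow> \<bar>x \<bullet> i\<bar> < real M"
        using reals_Archimedean2[of "norm x"] Basis_le_norm[of _ x] by (meson le_less_trans)
      have "wm m x = indicator A x" if "m \<ge> M" for m
      proof -
        have "x \<in> box (- (real m *\<^sub>R One)) (real m *\<^sub>R One)"
          using M that by (force simp: mem_box inner_simps abs_less_iff)
        then show ?thesis by (simp add: wm_def indicator_def)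
      qed
      then show ?thesis by (intro tendsto_eventually) (auto simp: eventually_sequentially)
    qed
    show "translation_continuous (wm m)" for m unfolding wm_def using set by (intro translation_continuous_indicator_bounded) auto
    show "wm m \<in> borel_measurable borel" for m unfolding wm_def using set by measurable
  qed (use set in \<open>auto simp: wm_def split: split_indicator\<close>)
next
  case (mult u c)
  \<comment> \<open>For \<open>c = 0\<close> the square integrability of \<open>u\<close> cannot be
    recovered from that of the product, but the claim is then trivial.\<close>
  show ?case
  proof (cases "c = 0")
    case True
    then show ?thesis by (simp add: translation_continuous_def)
  next
    case False
    have "sq_integrable u" using sq_integrable_cmult[OF mult.prems, of "1 / c"] False by simp
    then show ?thesis using mult by (intro translation_continuous_cmult)
  qed
next
  case (add u v)
  have "sq_integrable u" "sq_integrable v"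
    using add by (auto intro!: sq_integrable_bound[OF add.prems])
  then show ?case using add by (intro translation_continuous_add) auto
next
  case (seq U)
  have "incseq U" and lim: "\<And>x. (\<lambda>i. U i x) \<longlonglongrightarrow> w x" using seq by auto
  then have le: "U i x \<le> w x" for i x
    using incseq_le[of "\<lambda>i. U i x" "w x" i] by (auto simp: incseq_def le_fun_def)
  have abs_le: "\<bar>U i x\<bar> \<le> \<bar>w x\<bar>" for i x using le[of i x] seq.hyps(2)[of i x] by simp
  show ?case
  proof (rule translation_continuous_limit[where wm=U])
    show "translation_continuous (U i)" for i
    proof -
      have "sq_integrable (U i)" using seq.hyps(1) abs_le by (intro sq_integrable_bound[OF seq.prems(1)]) auto
      then show ?thesis using seq by blast
    qed
  qed (use seq lim abs_le in auto)
qed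

lemma translation_continuous_sq_integrable:
  assumes "sq_integrable w"
  shows "translation_continuous w"
proof -
  note [measurable] = sq_integrable_measurable[OF assms]
  have p: "sq_integrable (\<lambda>x. max 0 (w x))" and n: "sq_integrable (\<lambda>x. max 0 (- w x))"
    by (rule sq_integrable_bound[OF assms]; auto)+
  have "translation_continuous (\<lambda>x. max 0 (w x) - max 0 (- w x))"
    using p n by (intro translation_continuous_diff translation_continuous_sq_integrable_nonneg) auto
  moreover have "(\<lambda>x. max 0 (w x) - max 0 (- w x)) = w" by auto
  ultimately show ?thesis by simp
qed

section \<open>Difference quotients and the integral of a Jacobian\<close>

lemma other_other [simp]: "other (other k) = k"
  using exhaust_2[of k] by (auto simp: other_def)

lemma norm_axis_real: "norm (axis k r :: real^2) = \<bar>r\<bar>"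
proof -
  have "axis k r = r *\<^sub>R (axis k 1 :: real^2)" by (simp add: vec_eq_iff axis_def)
  then show ?thesis by simp
qed

lemma measurable_axis [measurable]: "(\<lambda>r::real. axis k r :: real^2) \<in> borel_measurable borel"
proof (rule borel_measurable_continuous_onI)
  show "continuous_on UNIV (\<lambda>r::real. axis k r :: real^2)"
    unfolding axis_def
  proof (intro continuous_on_vec_lambda)
    show "continuous_on UNIV (\<lambda>r. if i = k then r else 0)" for i
      by (cases "i = k") (auto intro!: continuous_intros)
  qed
qed

lemma line_deriv_increment:
  assumes a: "line_deriv k a a1" and h: "h \<ge> 0"
  shows "AE x in lborel. a (axis k h + x) - a x = (LINT r:{0..h}|lborel. a1 (axis k r + x))"
proof (rule AE_ln_ptI[where k=k])
  note [measurable] = line_deriv_measurable[OF a]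
  have "(\<lambda>(x, r). indicator {0..h} r *\<^sub>R a1 (axis k r + x)) \<in> borel_measurable (borel \<Otimes>\<^sub>M lborel)"
    by measurable
  then have [measurable]: "(\<lambda>x. LINT r:{0..h}|lborel. a1 (axis k r + x)) \<in> borel_measurable borel"
    unfolding set_lebesgue_integral_def by (rule lborel.borel_measurable_lebesgue_integral)
  show "{x. a (axis k h + x) - a x = (LINT r:{0..h}|lborel. a1 (axis k r + x))} \<in> sets borel"
    by measurable
  have "AE y in lborel. ac_deriv (\<lambda>t. a (line_point k y t)) (\<lambda>t. a1 (line_point k y t))"
    using a by (simp add: line_deriv_def)
  then show "AE y in lborel. AE t in lborel. a (axis k h + line_point k y t) - a (line_point k y t) =
      (LINT r:{0..h}|lborel. a1 (axis k r + line_point k y t))"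
  proof eventually_elim
    case (elim y)
    from ac_deriv_increment[OF this h] show ?case
    proof eventually_elim
      case (elim t)
      have "(LINT r:{t..t+h}|lborel. a1 (line_point k y r)) = (\<integral>r. indicator {t..t+h} (t + r) *\<^sub>R a1 (line_point k y (t + r)) \<partial>lborel)"
        unfolding set_lebesgue_integral_def
        using integral_lborel_shift[of "\<lambda>r. indicator {t..t+h} r *\<^sub>R a1 (line_point k y r)" t] by simp
      also have "\<dots> = (LINT r:{0..h}|lborel. a1 (line_point k y (r + t)))"
        unfolding set_lebesgue_integral_def
        by (intro Bochner_Integration.integral_cong) (auto split: split_indicator simp: add.commute)
      finally show ?case using elim by (simp add: line_point_add_axis add.commute)
    qed
  qed
qed

text \<open>Write the increment as an integral of \<open>a1\<close> over the shift \<open>r\<close>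
  and exchange the integrals. The majorant
  \<open>(a1 (axis k r + x))\<^sup>2 + (w x)\<^sup>2\<close> has the same integral in
  \<open>x\<close> for every \<open>r\<close>, so it is integrable for \<open>r\<close> in the
  bounded interval.\<close>

lemma line_deriv_increment_pairing:
  assumes a: "line_deriv k a a1" and a1: "sq_integrable a1" and w: "sq_integrable w" and h: "h \<ge> 0"
  shows "set_integrable lborel {0..h} (\<lambda>r. \<integral>x. a1 (axis k r + x) * w x \<partial>lborel)"
    and "(\<integral>x. (a (axis k h + x) - a x) * w x \<partial>lborel) =
       (LINT r:{0..h}|lborel. \<integral>x. a1 (axis k r + x) * w x \<partial>lborel)"
proof -
  note [measurable] = line_deriv_measurable[OF a] sq_integrable_measurable[OF w]
  let ?K = "\<lambda>r x. indicator {0..h} r * (a1 (axis k r + x) * w x)"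
  have sq: "(\<integral>x. (a1 (axis k r + x))\<^sup>2 \<partial>lborel) = (\<integral>x. (a1 x)\<^sup>2 \<partial>lborel)" for r
    using integral_lborel_shift[of "\<lambda>x. (a1 x)\<^sup>2" "axis k r"] by simp
  have isq: "integrable lborel (\<lambda>x. (a1 (axis k r + x))\<^sup>2 + (w x)\<^sup>2)" for r
    using sq_integrable_shift[OF a1, of "axis k r"] w by (simp add: sq_integrable_def)
  have "integrable (lborel \<Otimes>\<^sub>M lborel) (\<lambda>(r, x). indicator {0..h} r * ((a1 (axis k r + x))\<^sup>2 + (w x)\<^sup>2))"
  proof (rule lborel_pair.Fubini_integrable)
    have norm_int: "(\<integral>x. norm (case (r, x) of (r, x) \<Rightarrow> indicator {0..h} r * ((a1 (axis k r + x))\<^sup>2 + (w x)\<^sup>2)) \<partial>lborel)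
        = indicator {0..h} r * ((\<integral>x. (a1 x)\<^sup>2 \<partial>lborel) + (\<integral>x. (w x)\<^sup>2 \<partial>lborel))" for r
    proof -
      have "(\<integral>x. norm (case (r, x) of (r, x) \<Rightarrow> indicator {0..h} r * ((a1 (axis k r + x))\<^sup>2 + (w x)\<^sup>2)) \<partial>lborel)
         = (\<integral>x. indicator {0..h} r * ((a1 (axis k r + x))\<^sup>2 + (w x)\<^sup>2) \<partial>lborel)"
        by (intro Bochner_Integration.integral_cong) (auto simp: abs_mult)
      also have "\<dots> = indicator {0..h} r * ((\<integral>x. (a1 x)\<^sup>2 \<partial>lborel) + (\<integral>x. (w x)\<^sup>2 \<partial>lborel))"
        using sq_integrable_shift[OF a1, of "axis k r"] w sq[of r] by (simp add: sq_integrable_def)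
      finally show ?thesis .
    qed
    show "integrable lborel (\<lambda>r. \<integral>x. norm (case (r, x) of (r, x) \<Rightarrow> indicator {0..h} r * ((a1 (axis k r + x))\<^sup>2 + (w x)\<^sup>2)) \<partial>lborel)"
      unfolding norm_int using h by (intro integrable_mult_left integrable_real_indicator) auto
    show "AE r in lborel. integrable lborel (\<lambda>x. case (r, x) of (r, x) \<Rightarrow> indicator {0..h} r * ((a1 (axis k r + x))\<^sup>2 + (w x)\<^sup>2))"
      using isq by (auto intro!: integrable_mult_right)
  qed measurable
  then have int: "integrable (lborel \<Otimes>\<^sub>M lborel) (\<lambda>(r, x). ?K r x)"
  proof (rule Bochner_Integration.integrable_bound)
    have "norm (?K r x) \<le> norm (indicator {0..h} r * ((a1 (axis k r + x))\<^sup>2 + (w x)\<^sup>2))" for r x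
      using abs_mult_le_weighted[of 1 "a1 (axis k r + x)" "w x"] by (auto split: split_indicator)
    then show "AE z in lborel \<Otimes>\<^sub>M lborel. norm (case z of (r, x) \<Rightarrow> ?K r x) \<le>
        norm (case z of (r, x) \<Rightarrow> indicator {0..h} r * ((a1 (axis k r + x))\<^sup>2 + (w x)\<^sup>2))"
      by (intro AE_I2) (simp add: case_prod_unfold)
  qed measurable
  from lborel_pair.integrable_fst[OF int]
  show "set_integrable lborel {0..h} (\<lambda>r. \<integral>x. a1 (axis k r + x) * w x \<partial>lborel)"
    by (simp add: set_integrable_def)
  have "(\<integral>x. (a (axis k h + x) - a x) * w x \<partial>lborel) = (\<integral>x. (\<integral>r. ?K r x \<partial>lborel) \<partial>lborel)"
  proof (rule integral_cong_AE)
    show "(\<lambda>x. \<integral>r. ?K r x \<partial>lborel) \<in> borel_measurable lborel"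
      using lborel_pair.integrable_snd[OF int] by auto
    show "AE x in lborel. (a (axis k h + x) - a x) * w x = (\<integral>r. ?K r x \<partial>lborel)"
      using line_deriv_increment[OF a h]
    proof eventually_elim
      case (elim x)
      have "(\<integral>r. ?K r x \<partial>lborel) = (\<integral>r. (indicator {0..h} r * a1 (axis k r + x)) * w x \<partial>lborel)"
        by (simp add: mult.assoc)
      then show ?case using elim by (simp add: set_lebesgue_integral_def)
    qed
  qed measurable
  also have "\<dots> = (\<integral>r. (\<integral>x. ?K r x \<partial>lborel) \<partial>lborel)"
    using lborel_pair.Fubini_integral[OF int] .
  finally show "(\<integral>x. (a (axis k h + x) - a x) * w x \<partial>lborel) =
       (LINT r:{0..h}|lborel. \<integral>x. a1 (axis k r + x) * w x \<partial>lborel)"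
    by (simp add: set_lebesgue_integral_def)
qed

lemma set_integral_near_const:
  assumes "set_integrable lborel {0..h} \<psi>" "h \<ge> 0" "\<And>r. r \<in> {0..h} \<Longrightarrow> \<bar>\<psi> r - c\<bar> \<le> e"
  shows "\<bar>(LINT r:{0..h}|lborel. \<psi> r) - h * c\<bar> \<le> e * (h::real)"
proof -
  have c: "set_integrable lborel {0..h} (\<lambda>_. z :: real)" for z
    by (rule locally_integrable_Icc[OF locally_integrable_const])
  have z: "(LINT r:{0..h}|lborel. z) = h * z" for z :: real
    using assms(2) by (simp add: set_lebesgue_integral_def)
  have "(LINT r:{0..h}|lborel. \<psi> r) - h * c = (LINT r:{0..h}|lborel. \<psi> r - c)"
    using assms(1) c by (simp add: z)
  also have "\<bar>\<dots>\<bar> \<le> e * (LINT r:{0..h}|lborel. 1)"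
    using assms c by (intro set_integral_abs_le) auto
  finally show ?thesis by (simp add: z)
qed

text \<open>For smooth functions this is integration by parts twice. Here only first derivatives
  exist, so one of the derivatives is replaced by a difference quotient, whose pairing with an
  \<open>L\<^sup>2\<close> function is an average of a function that is continuous in the translation.\<close>

lemma sq_integrable_jacobian_identity:
  assumes a: "sq_integrable a" "line_deriv k a a1" "sq_integrable a1" "line_deriv (other k) a a2" "sq_integrable a2"
    and b: "sq_integrable b" "line_deriv k b b1" "sq_integrable b1" "line_deriv (other k) b b2" "sq_integrable b2"
  shows "(\<integral>x. a1 x * b2 x \<partial>lborel) = (\<integral>x. a2 x * b1 x \<partial>lborel)"
proof -
  define \<phi> where "\<phi> v = (\<integral>x. a1 (v + x) * b2 x \<partial>lborel)" for v
  define \<psi> where "\<psi> v = (\<integral>x. a2 (v + x) * b1 x \<partial>lborel)" for v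
  note i = sq_integrable_mult_integrable and s = sq_integrable_shift
  \<comment> \<open>Integration by parts along the other axis moves the derivative from
    \<open>b\<close> to \<open>a\<close>; translating the integral of \<open>a2 * b\<close> then
    moves the difference from \<open>a\<close> to \<open>b\<close>.\<close>
  have parts: "(\<integral>x. (a (axis k h + x) - a x) * b2 x \<partial>lborel) =
     (\<integral>x. (b (axis k h + x) - b x) * a2 (axis k h + x) \<partial>lborel)" for h
  proof -
    let ?A = "\<lambda>x. a (axis k h + x)" and ?A2 = "\<lambda>x. a2 (axis k h + x)"
    have pA: "line_deriv (other k) ?A ?A2" using line_deriv_shift[OF a(4), of h] by simp
    have "(\<integral>x. ?A2 x * b x + b2 x * ?A x \<partial>lborel) = 0"
      by (rule line_deriv_integral_zero[OF line_deriv_mult[OF pA b(4)]])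
        (intro Bochner_Integration.integrable_add i s a b)+
    moreover have "(\<integral>x. a2 x * b x + b2 x * a x \<partial>lborel) = 0"
      by (rule line_deriv_integral_zero[OF line_deriv_mult[OF a(4) b(4)]])
        (intro Bochner_Integration.integrable_add i s a b)+
    moreover have "(\<integral>x. ?A2 x * b (axis k h + x) \<partial>lborel) = (\<integral>x. a2 x * b x \<partial>lborel)"
      using integral_lborel_shift[of "\<lambda>x. a2 x * b x" "axis k h"] sq_integrable_measurable[OF a(5)] sq_integrable_measurable[OF b(1)]
      by simp
    moreover have int: "integrable lborel (\<lambda>x. ?A2 x * b x)" "integrable lborel (\<lambda>x. b2 x * ?A x)"
      "integrable lborel (\<lambda>x. a2 x * b x)" "integrable lborel (\<lambda>x. b2 x * a x)"
      "integrable lborel (\<lambda>x. ?A2 x * b (axis k h + x))"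
      by (intro i s a b)+
    moreover have "(\<integral>x. (?A x - a x) * b2 x \<partial>lborel) = (\<integral>x. b2 x * ?A x \<partial>lborel) - (\<integral>x. b2 x * a x \<partial>lborel)"
      using int by (subst Bochner_Integration.integral_diff[symmetric]) (auto simp: algebra_simps)
    moreover have "(\<integral>x. (b (axis k h + x) - b x) * ?A2 x \<partial>lborel) =
        (\<integral>x. ?A2 x * b (axis k h + x) \<partial>lborel) - (\<integral>x. ?A2 x * b x \<partial>lborel)"
      using int by (subst Bochner_Integration.integral_diff[symmetric]) (auto simp: algebra_simps)
    ultimately show ?thesis by simp
  qed
  have eq: "(LINT r:{0..h}|lborel. \<phi> (axis k r)) = (LINT r:{0..h}|lborel. \<psi> (axis k (h - r)))"
    and iphi: "set_integrable lborel {0..h} (\<lambda>r. \<phi> (axis k r))"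
    and ichi: "set_integrable lborel {0..h} (\<lambda>r. \<psi> (axis k (h - r)))" if h: "h \<ge> 0" for h
  proof -
    \<comment> \<open>Substituting \<open>axis k r + x\<close> leaves the relative shift
      \<open>h - r\<close>.\<close>
    have *: "(\<integral>x. b1 (axis k r + x) * a2 (axis k h + x) \<partial>lborel) = \<psi> (axis k (h - r))" for r
    proof -
      have "axis k (h - r) + (axis k r + x) = (axis k h :: real^2) + x" for x
        by (simp add: vec_eq_iff axis_def)
      then have "(\<integral>x. b1 (axis k r + x) * a2 (axis k h + x) \<partial>lborel) =
          (\<integral>x. (\<lambda>z. b1 z * a2 (axis k (h - r) + z)) (axis k r + x) \<partial>lborel)"
        by (simp only:)
      also have "\<dots> = (\<integral>x. b1 x * a2 (axis k (h - r) + x) \<partial>lborel)"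
        using sq_integrable_measurable[OF s[OF a(5)]] sq_integrable_measurable[OF b(3)]
        by (intro integral_lborel_shift borel_measurable_times)
      finally show ?thesis by (simp add: \<psi>_def mult.commute)
    qed
    show "set_integrable lborel {0..h} (\<lambda>r. \<phi> (axis k r))"
      using line_deriv_increment_pairing(1)[OF a(2,3) b(5) h] by (simp add: \<phi>_def)
    show "set_integrable lborel {0..h} (\<lambda>r. \<psi> (axis k (h - r)))"
      using line_deriv_increment_pairing(1)[OF b(2,3) s[OF a(5)] h, of "axis k h"] by (simp add: *)
    show "(LINT r:{0..h}|lborel. \<phi> (axis k r)) = (LINT r:{0..h}|lborel. \<psi> (axis k (h - r)))"
      using line_deriv_increment_pairing(2)[OF a(2,3) b(5) h] line_deriv_increment_pairing(2)[OF b(2,3) s[OF a(5)] h, of "axis k h"]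
        parts[of h] by (simp add: * \<phi>_def)
  qed
  \<comment> \<open>Both integrals are \<open>h\<close> times an average over shifts of length at
    most \<open>h\<close>; for small \<open>h\<close> the averages are close to the values at
    zero.\<close>
  have "\<bar>\<phi> 0 - \<psi> 0\<bar> \<le> 0 + e" if e: "e > 0" for e
  proof -
    have "isCont \<phi> 0" "isCont \<psi> 0"
      using translation_continuous_sq_integrable[OF b(5)] translation_continuous_sq_integrable[OF b(3)] a(3,5) unfolding translation_continuous_def \<phi>_def \<psi>_def by auto
    then have c: "\<forall>e>0. \<exists>d>0. \<forall>v. dist v 0 < d \<longrightarrow> dist (\<phi> v) (\<phi> 0) < e"
      "\<forall>e>0. \<exists>d>0. \<forall>v. dist v 0 < d \<longrightarrow> dist (\<psi> v) (\<psi> 0) < e"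
      unfolding continuous_at_eps_delta by blast+
    obtain d1 where d1: "d1 > 0" "\<And>v. dist v 0 < d1 \<Longrightarrow> dist (\<phi> v) (\<phi> 0) < e / 2"
      using c(1) half_gt_zero[OF e] by blast
    obtain d2 where d2: "d2 > 0" "\<And>v. dist v 0 < d2 \<Longrightarrow> dist (\<psi> v) (\<psi> 0) < e / 2"
      using c(2) half_gt_zero[OF e] by blast
    define h where "h = min d1 d2 / 2"
    have h: "h > 0" "h < d1" "h < d2" using d1(1) d2(1) by (auto simp: h_def)
    have "\<bar>(LINT r:{0..h}|lborel. \<phi> (axis k r)) - h * \<phi> 0\<bar> \<le> e / 2 * h"
    proof (rule set_integral_near_const)
      fix r assume "r \<in> {0..h}"
      then show "\<bar>\<phi> (axis k r) - \<phi> 0\<bar> \<le> e / 2"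
        using d1(2)[of "axis k r"] h by (simp add: dist_real_def norm_axis_real)
    qed (use iphi h in auto)
    moreover have "\<bar>(LINT r:{0..h}|lborel. \<psi> (axis k (h - r))) - h * \<psi> 0\<bar> \<le> e / 2 * h"
    proof (rule set_integral_near_const)
      fix r assume "r \<in> {0..h}"
      then show "\<bar>\<psi> (axis k (h - r)) - \<psi> 0\<bar> \<le> e / 2"
        using d2(2)[of "axis k (h - r)"] h by (simp add: dist_real_def norm_axis_real)
    qed (use ichi h in auto)
    moreover have "(LINT r:{0..h}|lborel. \<phi> (axis k r)) = (LINT r:{0..h}|lborel. \<psi> (axis k (h - r)))"
      using eq h(1) by simp
    moreover have "e / 2 * h = e * h / 2" by simp
    ultimately have "\<bar>h * \<phi> 0 - h * \<psi> 0\<bar> \<le> e * h" by linarith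
    then have "h * \<bar>\<phi> 0 - \<psi> 0\<bar> \<le> h * e"
      using h(1) by (simp add: right_diff_distrib[symmetric] abs_mult mult.commute)
    then show ?thesis using h(1) by simp
  qed
  then have "\<bar>\<phi> 0 - \<psi> 0\<bar> \<le> 0" by (rule field_le_epsilon)
  then show ?thesis by (simp add: \<phi>_def \<psi>_def)
qed

section \<open>Borel versions of weakly differentiable maps\<close>

lemma measurable_vec_component [measurable (raw)]:
  fixes f :: "'a \<Rightarrow> real^'n"
  assumes "f \<in> borel_measurable M"
  shows "(\<lambda>x. f x $ i) \<in> borel_measurable M"
proof -
  have "(\<lambda>v::real^'n. v $ i) \<in> borel_measurable borel"
    by (intro borel_measurable_continuous_onI continuous_intros)
  from measurable_compose[OF assms this] show ?thesis .
qed

text \<open>The given maps are only Lebesgue measurable, which does not control their restrictions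
  to individual lines; the line calculus is applied to \<open>f'\<close> instead.\<close>

definition borel_version :: "(real^2 \<Rightarrow> real^3) \<Rightarrow> (real^2 \<Rightarrow> real^3) \<Rightarrow> bool" where
  "borel_version f f' \<longleftrightarrow> f \<in> borel_measurable lebesgue \<and> f' \<in> borel_measurable borel \<and>
     (AE x in lborel. f x = f' x)"

lemma borel_versionD:
  assumes "borel_version f f'"
  shows "f \<in> borel_measurable lebesgue" "f' \<in> borel_measurable borel" "AE x in lborel. f x = f' x"
  using assms by (auto simp: borel_version_def)

lemma borel_version_exists:
  fixes f :: "real^2 \<Rightarrow> real^3"
  assumes "f \<in> borel_measurable lebesgue"
  obtains f' where "borel_version f f'"
proof -
  have "\<exists>F\<in>borel_measurable lborel. AE x in lborel. f x $ i = F x" for i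
  proof (rule completion_ex_borel_measurable_real)
    show "(\<lambda>x. f x $ i) \<in> borel_measurable lebesgue"
      using assms by (rule measurable_vec_component)
  qed
  then have "\<exists>F. \<forall>i. F i \<in> borel_measurable borel \<and> (AE x in lborel. f x $ i = F i x)"
    by (intro choice allI) auto
  then obtain F where F: "\<And>i. F i \<in> borel_measurable borel" "\<And>i. AE x in lborel. f x $ i = F i x"
    by blast
  show ?thesis
  proof (rule that, unfold borel_version_def, intro conjI assms)
    show "(\<lambda>x. \<chi> i. F i x) \<in> borel_measurable borel"
      using F(1) by (intro iffD2[OF borel_measurable_euclidean_space]) (auto simp: Basis_vec_def inner_axis)
    have "AE x in lborel. \<forall>i. f x $ i = F i x" using F(2) by (simp add: AE_all_countable)
    then show "AE x in lborel. f x = (\<chi> i. F i x)"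
      by eventually_elim (simp add: vec_eq_iff)
  qed
qed

lemma loc_integrable_component:
  assumes f: "loc_integrable f" and f': "borel_version f f'"
  shows "locally_integrable (\<lambda>x. f' x $ i)"
  unfolding locally_integrable_def
proof (intro conjI allI)
  note f'D = borel_versionD[OF f']
  note [measurable] = f'D(2)
  show "(\<lambda>x. f' x $ i) \<in> borel_measurable borel" by measurable
  fix a b :: "real^2"
  have "integrable lebesgue (\<lambda>x. indicator (cbox a b) x *\<^sub>R f x)"
    using f by (simp add: loc_integrable_def set_integrable_def)
  then have "integrable lebesgue (\<lambda>x. (indicator (cbox a b) x *\<^sub>R f x) $ i)"
    by (rule integrable_bounded_linear[OF bounded_linear_vec_nth])
  then have "integrable lebesgue (\<lambda>x. indicator (cbox a b) x *\<^sub>R (f' x $ i))"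
  proof (rule integrable_cong_AE_imp)
    show "(\<lambda>x. indicator (cbox a b) x *\<^sub>R (f' x $ i)) \<in> borel_measurable lebesgue"
      by (rule measurable_completion) measurable
    show "AE x in lebesgue. (indicator (cbox a b) x *\<^sub>R f x) $ i = indicator (cbox a b) x *\<^sub>R (f' x $ i)"
      using AE_completion[OF f'D(3)] by eventually_elim simp
  qed
  moreover have "(\<lambda>x. indicator (cbox a b) x *\<^sub>R (f' x $ i)) \<in> borel_measurable lborel" by measurable
  ultimately show "set_integrable lborel (cbox a b) (\<lambda>x. f' x $ i)"
    unfolding set_integrable_def by (simp add: integrable_completion)
qed

lemma integral_scaleR_component:
  assumes f: "loc_integrable f" and f': "borel_version f f'"
    and \<alpha>: "test1 \<alpha>" and \<beta>: "test1 \<beta>"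
  shows "(\<integral>x. (\<alpha> (x $ k) * \<beta> (x $ other k)) *\<^sub>R f x \<partial>lebesgue) $ i =
    (\<integral>x. \<alpha> (x $ k) * \<beta> (x $ other k) * f' x $ i \<partial>lborel)"
proof -
  note f'D = borel_versionD[OF f']
  note [measurable] = f'D(2) test1_measurable[OF \<alpha>] test1_measurable[OF \<beta>]
  let ?\<phi> = "\<lambda>x::real^2. \<alpha> (x $ k) * \<beta> (x $ other k)"
  have int: "integrable lborel (\<lambda>x. ?\<phi> x *\<^sub>R f' x)"
    unfolding integrable_iff_bounded
  proof
    show "(\<lambda>x. ?\<phi> x *\<^sub>R f' x) \<in> borel_measurable lborel" by measurable
    have i: "integrable lborel (\<lambda>x. ?\<phi> x * f' x $ i)" for i
      using loc_integrable_component[OF f f'] \<alpha> \<beta> by (intro integrable_locally_integrable_mult_tensor)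
    have "(\<integral>\<^sup>+ x. ennreal (norm (?\<phi> x *\<^sub>R f' x)) \<partial>lborel) \<le> (\<integral>\<^sup>+ x. ennreal (\<Sum>i\<in>UNIV. \<bar>?\<phi> x * f' x $ i\<bar>) \<partial>lborel)"
      using norm_le_l1_cart[of "?\<phi> x *\<^sub>R f' x" for x] by (intro nn_integral_mono ennreal_leI) simp
    also have "\<dots> < \<infinity>"
      using i by (subst nn_integral_eq_integral) (auto intro!: sum_nonneg)
    finally show "(\<integral>\<^sup>+ x. ennreal (norm (?\<phi> x *\<^sub>R f' x)) \<partial>lborel) < \<infinity>" .
  qed
  have "(\<integral>x. ?\<phi> x *\<^sub>R f x \<partial>lebesgue) = (\<integral>x. ?\<phi> x *\<^sub>R f' x \<partial>lebesgue)"
  proof (rule integral_cong_AE)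
    have m: "(\<lambda>x. ?\<phi> x *\<^sub>R f' x) \<in> borel_measurable lebesgue" by (rule measurable_completion) measurable
    then show "(\<lambda>x. ?\<phi> x *\<^sub>R f' x) \<in> borel_measurable lebesgue" .
    show "AE x in lebesgue. ?\<phi> x *\<^sub>R f x = ?\<phi> x *\<^sub>R f' x"
      using AE_completion[OF f'D(3)] by eventually_elim simp
    have "?\<phi> \<in> borel_measurable lebesgue" by (rule measurable_completion) measurable
    then show "(\<lambda>x. ?\<phi> x *\<^sub>R f x) \<in> borel_measurable lebesgue"
      using f'D(1) by (rule borel_measurable_scaleR)
  qed
  also have "\<dots> = (\<integral>x. ?\<phi> x *\<^sub>R f' x \<partial>lborel)"
    by (rule integral_completion) measurable
  also have "\<dots> $ i = (\<integral>x. (?\<phi> x *\<^sub>R f' x) $ i \<partial>lborel)"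
    using int by (rule integral_bounded_linear[OF bounded_linear_vec_nth, symmetric])
  finally show ?thesis by simp
qed

lemma weak_partial_tensor:
  assumes w: "weak_partial k f g"
    and f': "borel_version f f'"
    and g': "borel_version g g'"
    and \<alpha>: "test1 \<alpha>" and \<beta>: "test1 \<beta>" and d: "\<And>t. (\<alpha> has_real_derivative \<alpha>' t) (at t)"
  shows "(\<integral>x. \<alpha>' (x $ k) * \<beta> (x $ other k) * f' x $ i \<partial>lborel) = - (\<integral>x. \<alpha> (x $ k) * \<beta> (x $ other k) * g' x $ i \<partial>lborel)"
proof -
  obtain \<alpha>'' where \<alpha>'': "test1 \<alpha>''" "\<And>t. (\<alpha> has_real_derivative \<alpha>'' t) (at t)" using test1_derivE[OF \<alpha>] by blast
  then have "\<alpha>'' = \<alpha>'" using d DERIV_unique by blast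
  then have \<alpha>': "test1 \<alpha>'" using \<alpha>'' by simp
  obtain \<beta>' where \<beta>': "\<And>t. (\<beta> has_real_derivative \<beta>' t) (at t)" using test1_derivE[OF \<beta>] by blast
  have fg: "loc_integrable f" "loc_integrable g" using w by (auto simp: weak_partial_def)
  have "(\<integral>x. iter_partial [k] (\<lambda>x. \<alpha> (x $ k) * \<beta> (x $ other k)) x *\<^sub>R f x \<partial>lebesgue)
      = - (\<integral>x. (\<alpha> (x $ k) * \<beta> (x $ other k)) *\<^sub>R g x \<partial>lebesgue)"
    using w test_fun_tensor[OF \<alpha> \<beta>, of k] unfolding weak_partial_def by blast
  then have "(\<integral>x. (\<alpha>' (x $ k) * \<beta> (x $ other k)) *\<^sub>R f x \<partial>lebesgue) $ i
      = - ((\<integral>x. (\<alpha> (x $ k) * \<beta> (x $ other k)) *\<^sub>R g x \<partial>lebesgue) $ i)"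
    unfolding iter_partial_tensor(1)[OF d \<beta>'] by simp
  then show ?thesis
    unfolding integral_scaleR_component[OF fg(1) f' \<alpha>' \<beta>] integral_scaleR_component[OF fg(2) g' \<alpha> \<beta>] .
qed

definition line_deriv_vec :: "2 \<Rightarrow> (real^2 \<Rightarrow> real^3) \<Rightarrow> (real^2 \<Rightarrow> real^3) \<Rightarrow> bool" where
  "line_deriv_vec k f g \<longleftrightarrow> (\<forall>i. line_deriv k (\<lambda>x. f x $ i) (\<lambda>x. g x $ i))"

lemma weak_partial_imp_line_deriv_vec:
  assumes w: "weak_partial k f g"
    and f': "borel_version f f'"
    and g': "borel_version g g'"
  shows "line_deriv_vec k f' g'"
  unfolding line_deriv_vec_def
proof
  fix i
  have fg: "loc_integrable f" "loc_integrable g" using w by (auto simp: weak_partial_def)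
  show "line_deriv k (\<lambda>x. f' x $ i) (\<lambda>x. g' x $ i)"
    by (rule line_deriv_if_weak[OF loc_integrable_component[OF fg(1) f'] loc_integrable_component[OF fg(2) g']])
      (rule weak_partial_tensor[OF w f' g'])
qed

text \<open>In either order, two integrations by parts turn the pairing with a product test function
  into the integral of \<open>\<alpha>' \<beta>' d\<close>, the two signs cancelling.\<close>

lemma weak_mixed_partials_commute:
  assumes w: "weak_partial k d g" "weak_partial (other k) d g2" "weak_partial (other k) g h" "weak_partial k g2 h2"
    and d': "borel_version d d'"
    and g': "borel_version g g'"
    and g2': "borel_version g2 g2'"
    and h': "borel_version h h'"
    and h2': "borel_version h2 h2'"
  shows "AE x in lborel. h' x = h2' x"
proof -
  have "AE x in lborel. h' x $ i - h2' x $ i = 0" for i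
  proof (rule fundamental_lemma_2[where k=k])
    have lh: "locally_integrable (\<lambda>x. h' x $ i)" "locally_integrable (\<lambda>x. h2' x $ i)"
      using w loc_integrable_component[OF _ h'] loc_integrable_component[OF _ h2']
      by (auto simp: weak_partial_def)
    then show "locally_integrable (\<lambda>x. h' x $ i - h2' x $ i)" by (rule locally_integrable_diff)
    fix \<alpha> \<beta> assume \<alpha>: "test1 \<alpha>" and \<beta>: "test1 \<beta>"
    obtain \<alpha>' where \<alpha>': "test1 \<alpha>'" "\<And>t. (\<alpha> has_real_derivative \<alpha>' t) (at t)" using test1_derivE[OF \<alpha>] by blast
    obtain \<beta>' where \<beta>': "test1 \<beta>'" "\<And>t. (\<beta> has_real_derivative \<beta>' t) (at t)" using test1_derivE[OF \<beta>] by blast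
    have "(\<integral>x. \<alpha> (x $ k) * \<beta> (x $ other k) * h' x $ i \<partial>lborel) = (\<integral>x. \<alpha>' (x $ k) * \<beta>' (x $ other k) * d' x $ i \<partial>lborel)"
      using weak_partial_tensor[OF w(3) g' h' \<beta> \<alpha> \<beta>'(2), of i] weak_partial_tensor[OF w(1) d' g' \<alpha> \<beta>'(1) \<alpha>'(2), of i]
      by (simp add: mult.commute)
    moreover have "(\<integral>x. \<alpha> (x $ k) * \<beta> (x $ other k) * h2' x $ i \<partial>lborel) = (\<integral>x. \<alpha>' (x $ k) * \<beta>' (x $ other k) * d' x $ i \<partial>lborel)"
      using weak_partial_tensor[OF w(4) g2' h2' \<alpha> \<beta> \<alpha>'(2), of i] weak_partial_tensor[OF w(2) d' g2' \<beta> \<alpha>'(1) \<beta>'(2), of i]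
      by (simp add: mult.commute)
    ultimately show "(\<integral>x. \<alpha> (x $ k) * \<beta> (x $ other k) * (h' x $ i - h2' x $ i) \<partial>lborel) = 0"
      using integrable_locally_integrable_mult_tensor[OF lh(1) \<alpha> \<beta>, of k] integrable_locally_integrable_mult_tensor[OF lh(2) \<alpha> \<beta>, of k]
      by (simp add: right_diff_distrib)
  qed
  then have "AE x in lborel. \<forall>i. h' x $ i - h2' x $ i = 0" by (simp add: AE_all_countable)
  then show ?thesis by eventually_elim (simp add: vec_eq_iff)
qed

lemma line_deriv_vec_inner:
  assumes "line_deriv_vec k f f'" "line_deriv_vec k g g'"
  shows "line_deriv k (\<lambda>x. f x \<bullet> g x) (\<lambda>x. f' x \<bullet> g x + f x \<bullet> g' x)"
proof -
  have "line_deriv k (\<lambda>x. \<Sum>i\<in>UNIV. f x $ i * g x $ i) (\<lambda>x. \<Sum>i\<in>UNIV. f' x $ i * g x $ i + g' x $ i * f x $ i)"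
    using assms by (intro line_deriv_sum line_deriv_mult) (auto simp: line_deriv_vec_def)
  then show ?thesis by (simp add: inner_vec_def sum.distrib mult.commute)
qed

text \<open>The vector \<open>h + q *\<^sub>R d\<close> is the tangential part of \<open>h\<close>,
  with squared norm \<open>h \<bullet> h - q\<^sup>2\<close>. Subtracting
  \<open>c *\<^sub>R g\<close>, which is tangential too, and expanding the square gives the
  bound.\<close>

lemma tangential_square_bound:
  fixes d g h :: "'a::real_inner"
  assumes "d \<bullet> d = 1" "d \<bullet> g = 0" "d \<bullet> h = - q"
  shows "2 * c * (g \<bullet> h) - c\<^sup>2 * (g \<bullet> g) \<le> h \<bullet> h - q\<^sup>2"
proof -
  have "0 \<le> (h + q *\<^sub>R d - c *\<^sub>R g) \<bullet> (h + q *\<^sub>R d - c *\<^sub>R g)" by simp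
  also have "\<dots> = h \<bullet> h + 2 * q * (d \<bullet> h) + q\<^sup>2 * (d \<bullet> d) + c\<^sup>2 * (g \<bullet> g) - 2 * c * (g \<bullet> h) - 2 * c * q * (d \<bullet> g)"
    by (simp add: inner_simps inner_commute power2_eq_square algebra_simps)
  finally show ?thesis using assms by (simp add: power2_eq_square)
qed

section \<open>The stability estimate\<close>

lemma sq_integrable_component:
  fixes f :: "real^2 \<Rightarrow> real^3"
  assumes "f \<in> borel_measurable borel" "integrable lborel (\<lambda>x. (norm (f x))\<^sup>2)"
  shows "sq_integrable (\<lambda>x. f x $ i)"
proof (rule sq_integrable_bound)
  show "sq_integrable (\<lambda>x. norm (f x))" using assms by (simp add: sq_integrable_def)
  show "(\<lambda>x. f x $ i) \<in> borel_measurable borel" using assms(1) by measurable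
  show "AE x in lborel. \<bar>f x $ i\<bar> \<le> \<bar>norm (f x)\<bar>"
    using component_le_norm_cart[of "f x" i for x] by simp
qed

lemma grad_sq_2: "grad_sq G x = G 1 x \<bullet> G 1 x + G 2 x \<bullet> G 2 x"
  by (simp add: grad_sq_def sum_2 power2_norm_eq_inner)

lemma lap_2: "lap H x = H 1 1 x + H 2 2 x"
  by (simp add: lap_def sum_2)

text \<open>The hypotheses as they survive the passage to Borel versions: the pointwise constraints
  hold a.e. only, and weak derivatives have become derivatives along lines.\<close>

locale sphere_map =
  fixes d :: "real^2 \<Rightarrow> real^3" and G :: "2 \<Rightarrow> real^2 \<Rightarrow> real^3" and H :: "2 \<Rightarrow> 2 \<Rightarrow> real^2 \<Rightarrow> real^3"
    and \<epsilon> :: real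
  assumes d_meas [measurable]: "d \<in> borel_measurable borel"
    and G_meas [measurable]: "\<And>j. G j \<in> borel_measurable borel"
    and H_meas [measurable]: "\<And>j k. H j k \<in> borel_measurable borel"
    and eps: "\<epsilon> > 0"
    and unit: "AE x in lborel. d x \<bullet> d x = 1"
    and lower: "AE x in lborel. d x $ 3 \<ge> \<epsilon>"
    and dG: "\<And>j. line_deriv_vec j d (G j)"
    and GH: "\<And>j k. line_deriv_vec k (G j) (H j k)"
    and sym: "AE x in lborel. H 1 2 x = H 2 1 x"
    and G_L2: "\<And>j. integrable lborel (\<lambda>x. (norm (G j x))\<^sup>2)"
    and H_L2: "\<And>j k. integrable lborel (\<lambda>x. (norm (H j k x))\<^sup>2)"
begin

abbreviation "N \<equiv> grad_sq G"
abbreviation "L \<equiv> lap H"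
text \<open>The tension field: a.e. it is the part of \<open>L x\<close> tangent to the sphere at
  \<open>d x\<close>.\<close>

definition "T x = L x + N x *\<^sub>R d x"

lemma N_meas [measurable]: "N \<in> borel_measurable borel"
proof -
  have "(\<lambda>x. G 1 x \<bullet> G 1 x + G 2 x \<bullet> G 2 x) \<in> borel_measurable borel" by measurable
  then show ?thesis unfolding grad_sq_2[symmetric] .
qed

lemma L_meas [measurable]: "L \<in> borel_measurable borel"
proof -
  have "(\<lambda>x. H 1 1 x + H 2 2 x) \<in> borel_measurable borel" by measurable
  then show ?thesis unfolding lap_2[symmetric] .
qed

lemma T_meas [measurable]: "T \<in> borel_measurable borel"
  unfolding T_def by measurable

lemma N_nonneg: "0 \<le> N x"
  by (simp add: grad_sq_2)

text \<open>The product rule applied to the constant function \<open>d \<bullet> d\<close>, read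
  pointwise by uniqueness of line derivatives; the next lemma repeats this one order higher.\<close>

lemma d_orth_G: "AE x in lborel. d x \<bullet> G k x = 0"
proof -
  have "line_deriv k (\<lambda>x. d x \<bullet> d x) (\<lambda>x. G k x \<bullet> d x + d x \<bullet> G k x)" using dG dG by (rule line_deriv_vec_inner)
  then have "line_deriv k (\<lambda>x. 1) (\<lambda>x. G k x \<bullet> d x + d x \<bullet> G k x)"
    by (rule line_deriv_cong_AE) (use unit in auto)
  from line_deriv_unique[OF this line_deriv_const] show ?thesis
    by eventually_elim (simp add: inner_commute)
qed

lemma d_inner_H: "AE x in lborel. d x \<bullet> H j k x = - (G j x \<bullet> G k x)"
proof -
  have "line_deriv k (\<lambda>x. d x \<bullet> G j x) (\<lambda>x. G k x \<bullet> G j x + d x \<bullet> H j k x)" using dG GH by (rule line_deriv_vec_inner)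
  then have "line_deriv k (\<lambda>x. 0) (\<lambda>x. G k x \<bullet> G j x + d x \<bullet> H j k x)"
    by (rule line_deriv_cong_AE) (use d_orth_G in auto)
  from line_deriv_unique[OF this line_deriv_const] show ?thesis
    by eventually_elim (simp add: inner_commute)
qed

lemma d_inner_L: "AE x in lborel. d x \<bullet> L x = - N x"
  using d_inner_H[of 1 1] d_inner_H[of 2 2]
  by eventually_elim (simp add: lap_2 grad_sq_2 inner_add_right)

lemma L_split: "AE x in lborel. (norm (L x))\<^sup>2 = (N x)\<^sup>2 + (norm (T x))\<^sup>2"
  using d_inner_L unit
proof eventually_elim
  case (elim x)
  have "T x \<bullet> T x = L x \<bullet> L x + 2 * N x * (d x \<bullet> L x) + (N x)\<^sup>2 * (d x \<bullet> d x)"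
    unfolding T_def by (simp add: inner_simps inner_commute power2_eq_square algebra_simps)
  then show ?case using elim unfolding power2_norm_eq_inner by (simp add: power2_eq_square)
qed

lemma sq_integrable_H: "sq_integrable (\<lambda>x. norm (H j k x))" and sq_integrable_G: "sq_integrable (\<lambda>x. norm (G j x))"
  using H_L2[of j k] G_L2[of j] by (auto simp: sq_integrable_def)

lemma sq_integrable_L: "sq_integrable (\<lambda>x. norm (L x))"
proof (rule sq_integrable_bound)
  show "sq_integrable (\<lambda>x. norm (H 1 1 x) + norm (H 2 2 x))" using sq_integrable_H sq_integrable_H by (rule sq_integrable_add)
  show "AE x in lborel. \<bar>norm (L x)\<bar> \<le> \<bar>norm (H 1 1 x) + norm (H 2 2 x)\<bar>"
    using norm_triangle_ineq[of "H 1 1 x" "H 2 2 x" for x] by (intro AE_I2) (simp add: lap_2)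
qed measurable

text \<open>The normal part of the Laplacian has length \<open>N\<close>, so the
  \<open>L\<^sup>4\<close> bound on the gradient comes from the sphere constraint.\<close>

lemma sq_integrable_N: "sq_integrable N"
proof (rule sq_integrable_bound[OF sq_integrable_L])
  show "AE x in lborel. \<bar>N x\<bar> \<le> \<bar>norm (L x)\<bar>"
    using L_split
  proof eventually_elim
    case (elim x)
    then have "(N x)\<^sup>2 \<le> (norm (L x))\<^sup>2" by simp
    then show ?case by (simp only: abs_le_square_iff)
  qed
qed measurable

lemma sq_integrable_T: "sq_integrable (\<lambda>x. norm (T x))"
proof (rule sq_integrable_bound[OF sq_integrable_L])
  show "AE x in lborel. \<bar>norm (T x)\<bar> \<le> \<bar>norm (L x)\<bar>"
    using L_split
  proof eventually_elim
    case (elim x)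
    then have "(norm (T x))\<^sup>2 \<le> (norm (L x))\<^sup>2" by simp
    then show ?case by (simp only: abs_le_square_iff)
  qed
qed measurable

lemma integral_L_split: "(\<integral>x. (norm (L x))\<^sup>2 \<partial>lborel) = (\<integral>x. (N x)\<^sup>2 \<partial>lborel) + (\<integral>x. (norm (T x))\<^sup>2 \<partial>lborel)"
proof -
  have "(\<integral>x. (norm (L x))\<^sup>2 \<partial>lborel) = (\<integral>x. (N x)\<^sup>2 + (norm (T x))\<^sup>2 \<partial>lborel)"
    by (intro integral_cong_AE L_split) measurable
  then show ?thesis using sq_integrable_N sq_integrable_T by (simp add: sq_integrable_def)
qed

lemma integrable_inner_H: "integrable lborel (\<lambda>x. H j k x \<bullet> H j' k' x)"
proof (rule Bochner_Integration.integrable_bound[OF sq_integrable_mult_integrable[OF sq_integrable_H sq_integrable_H]])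
  show "AE x in lborel. norm (H j k x \<bullet> H j' k' x) \<le> norm (norm (H j k x) * norm (H j' k' x))"
    by (intro AE_I2) (simp add: Cauchy_Schwarz_ineq2)
qed measurable

text \<open>Expanding the square of \<open>H 1 1 + H 2 2\<close> leaves the cross term. The Jacobian
  identity, applied to each component of \<open>G 1\<close> and \<open>G 2\<close>, changes it into
  the product of the mixed derivatives, which agree.\<close>

lemma integral_hessian:
  "(\<integral>x. (\<Sum>j\<in>UNIV. \<Sum>k\<in>UNIV. H j k x \<bullet> H j k x) \<partial>lborel) = (\<integral>x. (norm (L x))\<^sup>2 \<partial>lborel)"
proof -
  have cG: "sq_integrable (\<lambda>x. G j x $ i)" for i j using G_meas G_L2 by (rule sq_integrable_component)
  have cH: "sq_integrable (\<lambda>x. H j k x $ i)" for i j k using H_meas H_L2 by (rule sq_integrable_component)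
  have p: "line_deriv k (\<lambda>x. G j x $ i) (\<lambda>x. H j k x $ i)" for i j k using GH by (simp add: line_deriv_vec_def)
  have 2: "other 1 = 2" by (simp add: other_def)
  have "(\<integral>x. H 1 1 x $ i * H 2 2 x $ i \<partial>lborel) = (\<integral>x. H 1 2 x $ i * H 2 1 x $ i \<partial>lborel)" for i
    by (rule sq_integrable_jacobian_identity[where k=1, unfolded 2, OF cG p cH p cH cG p cH p cH])
  then have jac: "(\<integral>x. H 1 1 x \<bullet> H 2 2 x \<partial>lborel) = (\<integral>x. H 1 2 x \<bullet> H 2 1 x \<partial>lborel)"
    using sq_integrable_mult_integrable[OF cH cH] by (simp add: inner_vec_def)
  have s: "(\<integral>x. H 1 2 x \<bullet> H 2 1 x \<partial>lborel) = (\<integral>x. H 1 2 x \<bullet> H 1 2 x \<partial>lborel)"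
    "(\<integral>x. H 2 1 x \<bullet> H 2 1 x \<partial>lborel) = (\<integral>x. H 1 2 x \<bullet> H 1 2 x \<partial>lborel)"
  proof -
    have "AE x in lborel. H 1 2 x \<bullet> H 2 1 x = H 1 2 x \<bullet> H 1 2 x"
      "AE x in lborel. H 2 1 x \<bullet> H 2 1 x = H 1 2 x \<bullet> H 1 2 x"
      using sym by (eventually_elim, simp)+
    then show "(\<integral>x. H 1 2 x \<bullet> H 2 1 x \<partial>lborel) = (\<integral>x. H 1 2 x \<bullet> H 1 2 x \<partial>lborel)"
      "(\<integral>x. H 2 1 x \<bullet> H 2 1 x \<partial>lborel) = (\<integral>x. H 1 2 x \<bullet> H 1 2 x \<partial>lborel)"
      using integrable_inner_H by (auto intro!: integral_cong_AE)
  qed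
  have "(\<integral>x. (norm (L x))\<^sup>2 \<partial>lborel) =
      (\<integral>x. H 1 1 x \<bullet> H 1 1 x + H 2 2 x \<bullet> H 2 2 x + 2 * (H 1 1 x \<bullet> H 2 2 x) \<partial>lborel)"
    by (simp add: lap_2 power2_norm_eq_inner inner_simps inner_commute algebra_simps)
  also have "\<dots> = (\<integral>x. H 1 1 x \<bullet> H 1 1 x \<partial>lborel) + (\<integral>x. H 2 2 x \<bullet> H 2 2 x \<partial>lborel) + 2 * (\<integral>x. H 1 1 x \<bullet> H 2 2 x \<partial>lborel)"
    using integrable_inner_H by simp
  also have "\<dots> = (\<integral>x. H 1 1 x \<bullet> H 1 1 x \<partial>lborel) + (\<integral>x. H 1 2 x \<bullet> H 1 2 x \<partial>lborel)
      + ((\<integral>x. H 2 1 x \<bullet> H 2 1 x \<partial>lborel) + (\<integral>x. H 2 2 x \<bullet> H 2 2 x \<partial>lborel))"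
    using jac s by simp
  also have "\<dots> = (\<integral>x. (\<Sum>j\<in>UNIV. \<Sum>k\<in>UNIV. H j k x \<bullet> H j k x) \<partial>lborel)"
    using integrable_inner_H by (simp add: sum_2)
  finally show ?thesis by simp
qed

text \<open>Testing the equation of \<open>d\<^sub>3\<close> with \<open>N / d\<^sub>3\<close> amounts to saying that the divergence of the
  flux has integral zero.\<close>

definition "flux k x = (G k x $ 3 * N x) * (1 / d x $ 3)"

text \<open>Kept in the shape in which the product and reciprocal rules produce it.\<close>

definition "dflux k x =
  (H k k x $ 3 * N x + (\<Sum>j\<in>UNIV. H j k x \<bullet> G j x + G j x \<bullet> H j k x) * G k x $ 3) * (1 / d x $ 3)
   + (- (G k x $ 3 * (1 / (d x $ 3)\<^sup>2))) * (G k x $ 3 * N x)"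

lemma line_deriv_flux: "line_deriv k (flux k) (dflux k)"
proof -
  have "line_deriv k (\<lambda>x. \<Sum>j\<in>UNIV. G j x \<bullet> G j x) (\<lambda>x. \<Sum>j\<in>UNIV. H j k x \<bullet> G j x + G j x \<bullet> H j k x)"
    using GH by (intro line_deriv_sum line_deriv_vec_inner)
  then have "line_deriv k N (\<lambda>x. \<Sum>j\<in>UNIV. H j k x \<bullet> G j x + G j x \<bullet> H j k x)"
    by (simp add: grad_sq_def[abs_def] power2_norm_eq_inner)
  moreover have "line_deriv k (\<lambda>x. 1 / d x $ 3) (\<lambda>x. - (G k x $ 3 * (1 / (d x $ 3)\<^sup>2)))"
    using dG eps lower by (intro line_deriv_inverse) (auto simp: line_deriv_vec_def)
  moreover have "line_deriv k (\<lambda>x. G k x $ 3) (\<lambda>x. H k k x $ 3)"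
    using GH by (simp add: line_deriv_vec_def)
  ultimately show ?thesis
    unfolding flux_def[abs_def] dflux_def[abs_def] by (intro line_deriv_mult)
qed

lemma G_sq_le_N: "G j x \<bullet> G j x \<le> N x"
  using exhaust_2[of j] by (auto simp: grad_sq_2)

lemma norm_G_le: "norm (G j x) \<le> sqrt (N x)"
  using G_sq_le_N[of j x] by (simp add: norm_eq_sqrt_inner)

lemma integrable_flux: "integrable lborel (flux k)"
proof -
  have "integrable lborel (\<lambda>x. (1 / \<epsilon>) * (norm (G k x) * N x))"
    using sq_integrable_mult_integrable[OF sq_integrable_G sq_integrable_N] by simp
  then show ?thesis
  proof (rule Bochner_Integration.integrable_bound)
    show "flux k \<in> borel_measurable lborel" using line_deriv_measurable(1)[OF line_deriv_flux] by simp
    show "AE x in lborel. norm (flux k x) \<le> norm ((1 / \<epsilon>) * (norm (G k x) * N x))"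
      using lower
    proof eventually_elim
      case (elim x)
      have "\<bar>G k x $ 3\<bar> * N x * (1 / d x $ 3) \<le> norm (G k x) * N x * (1 / \<epsilon>)"
        using elim eps N_nonneg[of x] component_le_norm_cart[of "G k x" 3]
        by (intro mult_mono divide_left_mono) auto
      then show ?case using elim eps N_nonneg[of x] by (simp add: flux_def abs_mult mult.commute)
    qed
  qed
qed

text \<open>Each term is a second derivative times a quadratic expression in first derivatives, or
  quartic in first derivatives. As first derivatives are at most \<open>sqrt (N x)\<close>, the
  majorants are products of the square integrable functions \<open>norm (H j k x)\<close> and
  \<open>N\<close>.\<close>

lemma integrable_dflux: "integrable lborel (dflux k)"
proof -
  let ?B = "\<lambda>x. (1 / \<epsilon>) * (norm (H k k x) * N x + (\<Sum>j\<in>UNIV. 2 * (norm (H j k x) * N x))) + (1 / \<epsilon>\<^sup>2) * (N x * N x)"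
  have "integrable lborel ?B"
    using sq_integrable_mult_integrable[OF sq_integrable_H sq_integrable_N] sq_integrable_mult_integrable[OF sq_integrable_N sq_integrable_N] by simp
  then show ?thesis
  proof (rule Bochner_Integration.integrable_bound)
    show "dflux k \<in> borel_measurable lborel" using line_deriv_measurable(2)[OF line_deriv_flux] by simp
    show "AE x in lborel. norm (dflux k x) \<le> norm (?B x)"
      using lower
    proof eventually_elim
      case (elim x)
      have N: "N x \<ge> 0" by (rule N_nonneg)
      have d: "0 < 1 / d x $ 3" "1 / d x $ 3 \<le> 1 / \<epsilon>" using elim eps by (auto intro: divide_left_mono)
      have d2: "1 / (d x $ 3)\<^sup>2 \<le> 1 / \<epsilon>\<^sup>2" "0 < 1 / (d x $ 3)\<^sup>2"
        using elim eps by (auto intro!: divide_left_mono power_mono)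
      have g3: "\<bar>G k x $ 3\<bar> \<le> sqrt (N x)" using component_le_norm_cart[of "G k x" 3] norm_G_le[of k x] by simp
      have 1: "\<bar>H k k x $ 3 * N x\<bar> \<le> norm (H k k x) * N x"
        unfolding abs_mult using component_le_norm_cart[of "H k k x" 3] N by (intro mult_mono) auto
      have 2: "\<bar>(\<Sum>j\<in>UNIV. H j k x \<bullet> G j x + G j x \<bullet> H j k x) * G k x $ 3\<bar> \<le> (\<Sum>j\<in>UNIV. 2 * (norm (H j k x) * N x))"
      proof -
        have "\<bar>(H j k x \<bullet> G j x + G j x \<bullet> H j k x) * G k x $ 3\<bar> \<le> 2 * (norm (H j k x) * N x)" for j
        proof -
          have "\<bar>H j k x \<bullet> G j x\<bar> \<le> norm (H j k x) * norm (G j x)" by (rule Cauchy_Schwarz_ineq2)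
          also have "\<dots> \<le> norm (H j k x) * sqrt (N x)" using norm_G_le by (intro mult_left_mono) auto
          finally have "\<bar>H j k x \<bullet> G j x\<bar> * \<bar>G k x $ 3\<bar> \<le> norm (H j k x) * sqrt (N x) * sqrt (N x)"
            using g3 N by (intro mult_mono) auto
          then show ?thesis using N by (simp add: inner_commute abs_mult mult.assoc)
        qed
        then show ?thesis unfolding sum_distrib_right
          by (intro order_trans[OF sum_abs] sum_mono)
      qed
      have 3: "\<bar>G k x $ 3 * (G k x $ 3 * N x)\<bar> \<le> N x * N x"
      proof -
        have "\<bar>G k x $ 3\<bar> * \<bar>G k x $ 3\<bar> \<le> sqrt (N x) * sqrt (N x)"
          using g3 N by (intro mult_mono) auto
        then have "\<bar>G k x $ 3\<bar> * \<bar>G k x $ 3\<bar> * N x \<le> N x * N x" using N by (intro mult_right_mono) auto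
        then show ?thesis using N by (simp add: abs_mult mult.assoc)
      qed
      let ?X = "H k k x $ 3 * N x" and ?Y = "(\<Sum>j\<in>UNIV. H j k x \<bullet> G j x + G j x \<bullet> H j k x) * G k x $ 3"
        and ?Z = "G k x $ 3 * (G k x $ 3 * N x)"
      have "dflux k x = (?X + ?Y) * (1 / d x $ 3) + (- ?Z) * (1 / (d x $ 3)\<^sup>2)"
        by (simp add: dflux_def)
      then have "\<bar>dflux k x\<bar> \<le> \<bar>?X + ?Y\<bar> * (1 / d x $ 3) + \<bar>?Z\<bar> * (1 / (d x $ 3)\<^sup>2)"
        using d(1) d2(2) abs_triangle_ineq[of "(?X + ?Y) * (1 / d x $ 3)" "(- ?Z) * (1 / (d x $ 3)\<^sup>2)"]
        by (simp only: abs_mult abs_minus_cancel abs_of_pos)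
      also have "\<dots> \<le> (norm (H k k x) * N x + (\<Sum>j\<in>UNIV. 2 * (norm (H j k x) * N x))) * (1 / \<epsilon>) + N x * N x * (1 / \<epsilon>\<^sup>2)"
        using 1 2 3 d d2 N
        by (intro add_mono mult_mono order_trans[OF abs_triangle_ineq] add_nonneg_nonneg sum_nonneg) auto
      also have "\<dots> = ?B x" by (simp add: mult.commute)
      finally show ?case by simp
    qed
  qed
qed

text \<open>The coefficient 5/4 is 1 + 1/2 - 1/4: one from \<open>- N * d $ 3\<close> in the third
  component of \<open>L\<close>, one half from projecting the Hessian onto the tangent plane, and
  one quarter given up in Young's inequality for the tension term.\<close>

lemma flux_divergence_bound:
  "AE x in lborel. (\<Sum>k\<in>UNIV. dflux k x) \<le> (norm (T x))\<^sup>2 / \<epsilon>\<^sup>2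
     + (\<Sum>j\<in>UNIV. \<Sum>k\<in>UNIV. H j k x \<bullet> H j k x) - (5 / 4) * (N x)\<^sup>2"
proof -
  have "AE x in lborel. \<forall>j. d x \<bullet> G j x = 0" using d_orth_G by (simp add: AE_all_countable)
  moreover have "AE x in lborel. \<forall>j k. d x \<bullet> H j k x = - (G j x \<bullet> G k x)"
    using d_inner_H by (simp add: AE_all_countable)
  ultimately show ?thesis using unit lower
  proof eventually_elim
    case (elim x)
    \<comment> \<open>The gradient of the logarithm of \<open>d $ 3\<close>; it is the coefficient
      with which the square is completed below.\<close>
    define c where "c k = G k x $ 3 / d x $ 3" for k
    have d3: "d x $ 3 > 0" using elim(4) eps by linarith
    have N: "N x \<ge> 0" by (rule N_nonneg)
    have L3: "L x $ 3 = T x $ 3 - N x * d x $ 3" by (simp add: T_def)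
    have "(\<Sum>k\<in>UNIV. dflux k x) = L x $ 3 * N x / d x $ 3 +
        (\<Sum>j\<in>UNIV. \<Sum>k\<in>UNIV. 2 * c k * (G j x \<bullet> H j k x) - (c k)\<^sup>2 * (G j x \<bullet> G j x))"
      using d3 by (simp add: dflux_def sum_2 lap_2 c_def grad_sq_2 inner_commute field_simps power2_eq_square)
    also have "\<dots> \<le> L x $ 3 * N x / d x $ 3 +
        (\<Sum>j\<in>UNIV. \<Sum>k\<in>UNIV. H j k x \<bullet> H j k x - (G j x \<bullet> G k x)\<^sup>2)"
      using elim(1-3) by (intro add_left_mono sum_mono tangential_square_bound[where d="d x"]) auto
    also have "L x $ 3 * N x / d x $ 3 = T x $ 3 / d x $ 3 * N x - (N x)\<^sup>2"
      unfolding L3 using d3 by (simp add: field_simps power2_eq_square)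
    also have "T x $ 3 / d x $ 3 * N x \<le> (norm (T x))\<^sup>2 / \<epsilon>\<^sup>2 + (N x)\<^sup>2 / 4"
    proof -
      define p where "p = norm (T x) / \<epsilon>"
      have "T x $ 3 / d x $ 3 \<le> p"
        unfolding p_def using component_le_norm_cart[of "T x" 3] elim(4) eps d3
        by (intro frac_le) auto
      then have "T x $ 3 / d x $ 3 * N x \<le> p * N x" using N by (rule mult_right_mono)
      also have "\<dots> \<le> p\<^sup>2 + (N x)\<^sup>2 / 4"
        using zero_le_power2[of "p - N x / 2"] by (simp add: power2_diff power_divide)
      finally show ?thesis by (simp add: p_def power_divide)
    qed
    also have "(\<Sum>j\<in>UNIV. \<Sum>k\<in>UNIV. H j k x \<bullet> H j k x - (G j x \<bullet> G k x)\<^sup>2)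
        \<le> (\<Sum>j\<in>UNIV. \<Sum>k\<in>UNIV. H j k x \<bullet> H j k x) - (N x)\<^sup>2 / 2"
    proof -
      \<comment> \<open>The diagonal terms alone suffice, since N is the sum of the two diagonal
        entries and \<open>(a + b)\<^sup>2 \<le> 2 * (a\<^sup>2 + b\<^sup>2)\<close>.\<close>
      have "(N x)\<^sup>2 / 2 \<le> (G 1 x \<bullet> G 1 x)\<^sup>2 + (G 2 x \<bullet> G 2 x)\<^sup>2"
        using zero_le_power2[of "G 1 x \<bullet> G 1 x - G 2 x \<bullet> G 2 x"]
        by (simp add: grad_sq_2 power2_sum power2_diff)
      also have "\<dots> \<le> (\<Sum>j\<in>UNIV. \<Sum>k\<in>UNIV. (G j x \<bullet> G k x)\<^sup>2)" by (simp add: sum_2)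
      finally show ?thesis by (simp add: sum_subtractf)
    qed
    finally show ?case by simp
  qed
qed

text \<open>The Hessian gives back one full integral of \<open>N\<^sup>2\<close> and one of the
  squared tension. Against 5/4 a quarter of the former survives, whence the factor 4.\<close>

lemma gradient_bound:
  "(\<integral>x. (N x)\<^sup>2 \<partial>lborel) \<le> 4 * (1 + 1 / \<epsilon>\<^sup>2) * (\<integral>x. (norm (T x))\<^sup>2 \<partial>lborel)"
proof -
  have iN: "integrable lborel (\<lambda>x. (N x)\<^sup>2)" and iT: "integrable lborel (\<lambda>x. (norm (T x))\<^sup>2)"
    using sq_integrable_N sq_integrable_T by (auto simp: sq_integrable_def)
  let ?S = "\<lambda>x. \<Sum>j\<in>UNIV. \<Sum>k\<in>UNIV. H j k x \<bullet> H j k x"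
  have iS: "integrable lborel ?S" using integrable_inner_H by simp
  have "(\<integral>x. dflux k x \<partial>lborel) = 0" for k
    by (rule line_deriv_integral_zero[OF line_deriv_flux integrable_flux integrable_dflux])
  then have "0 = (\<integral>x. (\<Sum>k\<in>UNIV. dflux k x) \<partial>lborel)"
    using integrable_dflux by simp
  also have "\<dots> \<le> (\<integral>x. (norm (T x))\<^sup>2 / \<epsilon>\<^sup>2 + ?S x - (5 / 4) * (N x)\<^sup>2 \<partial>lborel)"
    using integrable_dflux iN iT iS flux_divergence_bound by (intro integral_mono_AE) auto
  also have "\<dots> = (\<integral>x. (norm (T x))\<^sup>2 \<partial>lborel) / \<epsilon>\<^sup>2 + (\<integral>x. ?S x \<partial>lborel) - (5 / 4) * (\<integral>x. (N x)\<^sup>2 \<partial>lborel)"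
    using iN iT iS by simp
  also have "(\<integral>x. ?S x \<partial>lborel) = (\<integral>x. (N x)\<^sup>2 \<partial>lborel) + (\<integral>x. (norm (T x))\<^sup>2 \<partial>lborel)"
    using integral_hessian integral_L_split by simp
  finally show ?thesis by (simp add: field_simps)
qed

end

section \<open>Return to Lebesgue measurable maps and the choice of the constant\<close>

lemma L2_borel_version:
  assumes "L2 f" "borel_version f f'"
  shows "integrable lborel (\<lambda>x. (norm (f' x))\<^sup>2)"
proof -
  note [measurable] = borel_versionD(2)[OF assms(2)]
  have m: "(\<lambda>x. (norm (f' x))\<^sup>2) \<in> borel_measurable lborel" by measurable
  have "integrable lebesgue (\<lambda>x. (norm (f x))\<^sup>2)" using assms(1) by (simp add: L2_def)
  then have "integrable lebesgue (\<lambda>x. (norm (f' x))\<^sup>2)"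
  proof (rule integrable_cong_AE_imp)
    show "(\<lambda>x. (norm (f' x))\<^sup>2) \<in> borel_measurable lebesgue" using m by (rule measurable_completion)
    show "AE x in lebesgue. (norm (f x))\<^sup>2 = (norm (f' x))\<^sup>2"
      using AE_completion[OF borel_versionD(3)[OF assms(2)]] by eventually_elim simp
  qed
  then show ?thesis using m by (simp add: integrable_completion)
qed

lemma nn_integral_lebesgue_eq_integral:
  fixes q q' :: "'a::euclidean_space \<Rightarrow> real"
  assumes "integrable lborel q'" "\<And>x. q' x \<ge> 0" "AE x in lborel. q x = q' x"
  shows "(\<integral>\<^sup>+ x. ennreal (q x) \<partial>lebesgue) = ennreal (\<integral>x. q' x \<partial>lborel)"
proof -
  have "(\<integral>\<^sup>+ x. ennreal (q x) \<partial>lebesgue) = (\<integral>\<^sup>+ x. ennreal (q' x) \<partial>lebesgue)"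
    using AE_completion[OF assms(3)] by (intro nn_integral_cong_AE) (auto elim: eventually_mono)
  also have "\<dots> = (\<integral>\<^sup>+ x. ennreal (q' x) \<partial>lborel)"
    by (rule nn_integral_completion)
  also have "\<dots> = ennreal (\<integral>x. q' x \<partial>lborel)"
    using assms by (intro nn_integral_eq_integral) auto
  finally show ?thesis .
qed

theorem theorem1p2:
  fixes \<epsilon>0 C0 :: real
  assumes "\<epsilon>0 > 0" and "C0 > 0"
  shows "\<exists>\<delta>0 > 0. \<forall>(d :: real^2 \<Rightarrow> real^3) (G :: 2 \<Rightarrow> real^2 \<Rightarrow> real^3)
            (H :: 2 \<Rightarrow> 2 \<Rightarrow> real^2 \<Rightarrow> real^3).
     d \<in> borel_measurable lebesgue \<longrightarrow>
     (\<forall>x. norm (d x) = 1) \<longrightarrow>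
     (\<forall>j. weak_partial j d (G j) \<and> L2 (G j)) \<longrightarrow>
     (\<forall>j k. weak_partial k (G j) (H j k) \<and> L2 (H j k)) \<longrightarrow>
     (\<integral>\<^sup>+ x. ennreal (grad_sq G x) \<partial>lebesgue) \<le> ennreal (C0\<^sup>2) \<longrightarrow>
     (\<forall>x. d x $ 3 \<ge> \<epsilon>0) \<longrightarrow>
       (\<integral>\<^sup>+ x. ennreal ((grad_sq G x)\<^sup>2) \<partial>lebesgue)
          \<le> ennreal (1 - \<delta>0) * (\<integral>\<^sup>+ x. ennreal ((norm (lap H x))\<^sup>2) \<partial>lebesgue)
       \<and> (\<integral>\<^sup>+ x. ennreal ((norm (lap H x + grad_sq G x *\<^sub>R d x))\<^sup>2) \<partial>lebesgue)
          \<ge> ennreal (\<delta>0 / 2) * ((\<integral>\<^sup>+ x. ennreal ((norm (lap H x))\<^sup>2) \<partial>lebesgue)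
                                + (\<integral>\<^sup>+ x. ennreal ((grad_sq G x)\<^sup>2) \<partial>lebesgue))"
proof -
  define K where "K = 4 * (1 + 1 / \<epsilon>0\<^sup>2)"
  \<comment> \<open>From \<open>A \<le> K * C\<close> and \<open>B = A + C\<close> one gets
    \<open>A \<le> K / (K + 1) * B\<close>, and \<open>K / (K + 1)\<close> is
    \<open>1 - \<delta>\<close>.\<close>
  define \<delta> where "\<delta> = 1 / (K + 1)"
  have K: "K > 0" unfolding K_def by (simp add: add_pos_nonneg)
  have \<delta>: "\<delta> > 0" "\<delta> \<le> 1" "1 - \<delta> = K / (K + 1)" using K by (auto simp: \<delta>_def field_simps)
  show ?thesis
  proof (intro exI[of _ \<delta>] conjI[OF \<delta>(1)] allI impI)
    fix d :: "real^2 \<Rightarrow> real^3" and G :: "2 \<Rightarrow> real^2 \<Rightarrow> real^3" and H :: "2 \<Rightarrow> 2 \<Rightarrow> real^2 \<Rightarrow> real^3"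
    assume d: "d \<in> borel_measurable lebesgue" and unit: "\<forall>x. norm (d x) = 1"
      and wG: "\<forall>j. weak_partial j d (G j) \<and> L2 (G j)"
      and wH: "\<forall>j k. weak_partial k (G j) (H j k) \<and> L2 (H j k)"
      and lower: "\<forall>x. d x $ 3 \<ge> \<epsilon>0"
    obtain d' where d': "borel_version d d'" using borel_version_exists[OF d] .
    have "\<exists>g'. borel_version (G j) g'" for j
      using borel_version_exists[of "G j"] wG unfolding L2_def by blast
    then obtain G' where G': "\<And>j. borel_version (G j) (G' j)" by metis
    have "\<exists>h'. borel_version (H j k) h'" for j k
      using borel_version_exists[of "H j k"] wH unfolding L2_def by blast
    then obtain H' where H': "\<And>j k. borel_version (H j k) (H' j k)" by metis
    interpret sphere_map d' G' H' \<epsilon>0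
    proof
      show "d' \<in> borel_measurable borel" "\<And>j. G' j \<in> borel_measurable borel"
        "\<And>j k. H' j k \<in> borel_measurable borel"
        using d' G' H' by (auto simp: borel_version_def)
      show "\<epsilon>0 > 0" by fact
      show "AE x in lborel. d' x \<bullet> d' x = 1"
        using borel_versionD(3)[OF d'] by eventually_elim (metis unit norm_eq_1)
      show "AE x in lborel. d' x $ 3 \<ge> \<epsilon>0"
        using borel_versionD(3)[OF d'] by eventually_elim (metis lower)
      show "line_deriv_vec j d' (G' j)" for j using wG d' G' by (intro weak_partial_imp_line_deriv_vec) auto
      show "line_deriv_vec k (G' j) (H' j k)" for j k using wH G' H' by (intro weak_partial_imp_line_deriv_vec) auto
      have "other 1 = 2" by (simp add: other_def)
      then show "AE x in lborel. H' 1 2 x = H' 2 1 x"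
        using wG wH by (intro weak_mixed_partials_commute[where k=1, OF _ _ _ _ d' G' G' H' H']) auto
      show "integrable lborel (\<lambda>x. (norm (G' j x))\<^sup>2)" for j
        using wG G' by (intro L2_borel_version) auto
      show "integrable lborel (\<lambda>x. (norm (H' j k x))\<^sup>2)" for j k
        using wH H' by (intro L2_borel_version) auto
    qed
    define A B C where "A = (\<integral>x. (grad_sq G' x)\<^sup>2 \<partial>lborel)" and "B = (\<integral>x. (norm (lap H' x))\<^sup>2 \<partial>lborel)"
      and "C = (\<integral>x. (norm (T x))\<^sup>2 \<partial>lborel)"
    have ABC: "A \<ge> 0" "B \<ge> 0" "C \<ge> 0" by (auto simp: A_def B_def C_def)
    have aeG: "AE x in lborel. grad_sq G x = grad_sq G' x"
      using borel_versionD(3)[OF G'[of 1]] borel_versionD(3)[OF G'[of 2]]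
      by eventually_elim (simp add: grad_sq_2)
    have aeH: "AE x in lborel. lap H x = lap H' x"
      using borel_versionD(3)[OF H'[of 1 1]] borel_versionD(3)[OF H'[of 2 2]]
      by eventually_elim (simp add: lap_2)
    have A: "(\<integral>\<^sup>+ x. ennreal ((grad_sq G x)\<^sup>2) \<partial>lebesgue) = ennreal A"
      unfolding A_def using sq_integrable_N aeG
      by (intro nn_integral_lebesgue_eq_integral) (auto simp: sq_integrable_def elim!: eventually_mono)
    have B: "(\<integral>\<^sup>+ x. ennreal ((norm (lap H x))\<^sup>2) \<partial>lebesgue) = ennreal B"
      unfolding B_def using sq_integrable_L aeH
      by (intro nn_integral_lebesgue_eq_integral) (auto simp: sq_integrable_def elim!: eventually_mono)
    have C: "(\<integral>\<^sup>+ x. ennreal ((norm (lap H x + grad_sq G x *\<^sub>R d x))\<^sup>2) \<partial>lebesgue) = ennreal C"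
      unfolding C_def
    proof (rule nn_integral_lebesgue_eq_integral)
      show "AE x in lborel. (norm (lap H x + grad_sq G x *\<^sub>R d x))\<^sup>2 = (norm (T x))\<^sup>2"
        using aeG aeH borel_versionD(3)[OF d'] by eventually_elim (simp add: T_def)
    qed (use sq_integrable_T in \<open>auto simp: sq_integrable_def\<close>)
    have split: "B = A + C" using integral_L_split by (simp add: A_def B_def C_def)
    have "A \<le> K * C" using gradient_bound by (simp add: A_def C_def K_def)
    then have le: "A \<le> (1 - \<delta>) * B" unfolding \<delta>(3) split using K by (simp add: field_simps)
    \<comment> \<open>Here \<open>A \<le> B\<close>, and \<open>C = B - A\<close> is at least
      \<open>\<delta> * B\<close> by the first inequality; the factor one half pays for including
      \<open>A\<close>.\<close>
    have "\<delta> / 2 * (B + A) \<le> \<delta> / 2 * (B + B)"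
      using split ABC \<delta>(1) by (intro mult_left_mono) auto
    also have "\<dots> \<le> C" using le split by (simp add: algebra_simps)
    finally have "\<delta> / 2 * (B + A) \<le> C" .
    then show "(\<integral>\<^sup>+ x. ennreal ((grad_sq G x)\<^sup>2) \<partial>lebesgue)
          \<le> ennreal (1 - \<delta>) * (\<integral>\<^sup>+ x. ennreal ((norm (lap H x))\<^sup>2) \<partial>lebesgue)
       \<and> (\<integral>\<^sup>+ x. ennreal ((norm (lap H x + grad_sq G x *\<^sub>R d x))\<^sup>2) \<partial>lebesgue)
          \<ge> ennreal (\<delta> / 2) * ((\<integral>\<^sup>+ x. ennreal ((norm (lap H x))\<^sup>2) \<partial>lebesgue)
                                + (\<integral>\<^sup>+ x. ennreal ((grad_sq G x)\<^sup>2) \<partial>lebesgue))"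
      unfolding A B C using le ABC \<delta>
      by (simp add: ennreal_mult[symmetric] ennreal_plus[symmetric] ennreal_leI del: ennreal_plus)
  qed
qed

end
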